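(* Let $f$ be a meromorphic function and $g$ be a transcendental entire function such that $\rho_f(p,q)$ and $\lambda_g^{[l]}$ are both finite, where $p,q,l$ are positive integers with $p>q$ and $l\ge 2$. Let $G=g^{\alpha}Q[g]$, where $Q[g]$ is a differential polynomial in $g$. Then for any integer $\alpha\ge 1$: (i) if $q\ge l-1>1$, $$\liminf_{r\to\infty}\frac{\log^{[p-1]}T_{f\circ g}(r)}{\log^{[l-2]}T_G(r)}\le\rho_f(p,q)\cdot 2^{\lambda_g^{[l]}};$$ (ii) if $q<l-1$, $$\liminf_{r\to\infty}\frac{\log^{[p+l-q-2]}T_{f\circ g}(r)}{\log^{[l-2]}T_G(r)}\le 2^{\lambda_g^{[l]}};$$ (iii) if $q\ge l-1=1$, then for every real $\beta>1$, $$\liminf_{r\to\infty}\frac{\log^{[p-1]}T_{f\circ g}(r)}{T_G(r)}\le 3\beta\cdot\rho_f(p,q)\cdot 2^{\lambda_g}.$$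
   Context: All functions are defined on the complex plane $\mathbb{C}$. Iterated logarithms: $\log^{[0]}x=x$, and for positive integers $k$, $\log^{[k]}x=\log(\log^{[k-1]}x)$ (for $x$ large enough that this is defined). $T_h(r)$ is the Nevanlinna characteristic function of a meromorphic function $h$, and $M_g(r)=\max_{|z|=r}|g(z)|$ for an entire function $g$. For positive integers $p\ge q$, the $(p,q)$-th order of a meromorphic function $f$ is $\rho_f(p,q)=\limsup_{r\to\infty}\frac{\log^{[p-1]}T_f(r)}{\log^{[q]}r}$. For an integer $l\ge 2$, the generalized lower order of an entire function $g$ is $\lambda_g^{[l]}=\liminf_{r\to\infty}\frac{\log^{[l]}M_g(r)}{\log r}$, and $\lambda_g=\lambda_g^{[2]}$ is the lower order. A monomial generated by a transcendental meromorphic function $g$ is an expression $M[g]=g^{n_0}(g^{(1)})^{n_1}\cdots(g^{(k)})^{n_k}$ with non-negative integers $n_0,\dots,n_k$. A differential polynomial generated by (in) $g$ is an expression $Q[g]=a_1M_1[g]+\cdots+a_sM_s[g]$, where $M_1[g],\dots,M_s[g]$ are monomials in $g$ and $a_1,\dots,a_s$ are nonzero constants. *)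

theory Defs
  imports "HOL-Complex_Analysis.Complex_Analysis"
begin

text \<open>
  The real \<^term>\<open>ln\<close> is total, so the iterates have arbitrary values where the iterated
  logarithm is undefined. They are only used inside a limit inferior or superior at infinity.
\<close>

definition iter_log :: "nat \<Rightarrow> real \<Rightarrow> real" where
  "iter_log k = ln ^^ k"

text \<open>
  Meromorphic functions on the plane are functions satisfying \<open>h meromorphic_on UNIV\<close>. Their
  values at poles (and at other points of a sparse set) are irrelevant: the characteristic depends
  only on the limiting behaviour of \<open>h\<close> and on integral means.
\<close>

definition log_plus :: "real \<Rightarrow> real" where
  "log_plus x = max 0 (ln x)"

definition proximity_fun :: "(complex \<Rightarrow> complex) \<Rightarrow> real \<Rightarrow> real" where
  "proximity_fun h r =
     integral {0..2*pi} (\<lambda>t. log_plus (norm (h (of_real r * cis t)))) / (2 * pi)"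

definition pole_count :: "(complex \<Rightarrow> complex) \<Rightarrow> real \<Rightarrow> nat" where
  "pole_count h t = (\<Sum>z | z \<in> cball 0 t \<and> is_pole h z. nat (- zorder h z))"

text \<open>The integrand below vanishes in a neighbourhood of 0, so there is no singularity there.\<close>

definition pole_counting_fun :: "(complex \<Rightarrow> complex) \<Rightarrow> real \<Rightarrow> real" where
  "pole_counting_fun h r =
     integral {0..r} (\<lambda>t. (real (pole_count h t) - real (pole_count h 0)) / t)
     + real (pole_count h 0) * ln r"

definition nevanlinna_char :: "(complex \<Rightarrow> complex) \<Rightarrow> real \<Rightarrow> real" where
  "nevanlinna_char h r = proximity_fun h r + pole_counting_fun h r"

definition max_modulus :: "(complex \<Rightarrow> complex) \<Rightarrow> real \<Rightarrow> real" where
  "max_modulus g r = (SUP z\<in>sphere 0 r. norm (g z))"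

definition pq_order :: "nat \<Rightarrow> nat \<Rightarrow> (complex \<Rightarrow> complex) \<Rightarrow> ereal" where
  "pq_order p q f =
     Limsup at_top (\<lambda>r::real. ereal (iter_log (p - 1) (nevanlinna_char f r) / iter_log q r))"

definition gen_lower_order :: "nat \<Rightarrow> (complex \<Rightarrow> complex) \<Rightarrow> ereal" where
  "gen_lower_order l g =
     Liminf at_top (\<lambda>r::real. ereal (iter_log l (max_modulus g r) / ln r))"

definition lower_order :: "(complex \<Rightarrow> complex) \<Rightarrow> ereal" where
  "lower_order g = gen_lower_order 2 g"

definition transcendental_entire :: "(complex \<Rightarrow> complex) \<Rightarrow> bool" where
  "transcendental_entire g \<longleftrightarrow>
     g holomorphic_on UNIV \<and> \<not> (\<exists>P :: complex poly. \<forall>z. g z = poly P z)"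

text \<open>
  The list \<open>[n\<^sub>0, \<dots>, n\<^sub>k]\<close> encodes the exponents of \<open>g\<close> and of its first \<open>k\<close> derivatives.
\<close>

definition diff_monomial :: "nat list \<Rightarrow> (complex \<Rightarrow> complex) \<Rightarrow> complex \<Rightarrow> complex" where
  "diff_monomial ns g z = (\<Prod>i<length ns. ((deriv ^^ i) g z) ^ (ns ! i))"

definition diff_polynomial_in :: "(complex \<Rightarrow> complex) \<Rightarrow> (complex \<Rightarrow> complex) \<Rightarrow> bool" where
  "diff_polynomial_in g Q \<longleftrightarrow>
     (\<exists>s\<ge>1. \<exists>(a :: nat \<Rightarrow> complex) (ns :: nat \<Rightarrow> nat list).
        (\<forall>j\<in>{1..s}. a j \<noteq> 0) \<and>
        Q = (\<lambda>z. \<Sum>j=1..s. a j * diff_monomial (ns j) g z))"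

end

theory Submission
  imports Defs
begin

text \<open>
  Upper bound. If \<open>|g| \<le> M\<close> on the disc of radius \<open>r\<close>, then Poisson's and Jensen's formulas give
  \<open>T(r, f \<circ> g) \<le> C (1 + ln R) (T(R, f) + T(2R, f))\<close> for some \<open>R\<close> between \<open>2M\<close> and \<open>4M\<close>. As \<open>p > q \<ge> 1\<close>,
  at least one logarithm is taken, so the extra factors are harmless and \<open>iter_log (p - 1)\<close> of the
  left-hand side is at most \<open>(\<rho> + \<epsilon>) iter_log q M\<close> for large \<open>M\<close>.

  Lower bound. Since \<open>G = g W\<close> with \<open>W\<close> entire, \<open>T(r, G) \<ge> ln M\<^sub>g(s) / 3 - C (1 + ln ln M\<^sub>g(128 s))\<close> for
  some \<open>r\<close> slightly larger than \<open>2 s\<close>. The logarithmic derivatives of \<open>g\<close> are bounded pointwise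
  on a circle that stays away from the zeros of \<open>g\<close> and its derivatives, and so no exceptional set for
  functions of infinite order appears.

  Comparison. For \<open>\<psi> = iter_log (l - 1) \<circ> M\<^sub>g\<close>, finite lower order \<open>\<lambda>\<close> provides arbitrarily large \<open>s\<close>
  with \<open>\<psi>(t s) \<le> t powr (\<lambda> + \<epsilon>) \<psi>(s)\<close> both for \<open>t\<close> slightly above \<open>2\<close>, which produces the constant
  \<open>2 powr \<lambda>\<close>, and for \<open>t = 128\<close>, which makes the error term of the lower bound negligible.
  All inequalities are only needed on circles that avoid the finitely many relevant zeros and poles.
\<close>

section \<open>Poisson's and Jensen's formulas\<close>

text \<open>An upper bound for a limit inferior needs one good radius per scale. Numerator and
  denominator are therefore estimated at a common radius between \<open>2 * s\<close> and
  \<open>\<tau> * s\<close>: the numerator fails only at finitely many radii there, and the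
  denominator can be treated at a radius outside any given finite set. The lower end
  \<open>2 * s\<close> makes the quotient (r + s) / (r - s) at most 3. This 3 stays visible in
  (iii), where no logarithm of the denominator is taken; for l > 2 a logarithm turns it into an
  additive constant. The number 128 is a power of 2 that is large enough for the nested discs of the
  logarithmic derivative estimate. The totality of \<open>ln\<close> is an obstacle: iterated
  logarithms are not monotone on all reals, and the characteristic of \<open>f \<circ> g\<close> may
  be bounded. Hence the dichotomy that a characteristic is either constant or exceeds every bound,
  up to finitely many radii in each bounded interval. The case \<open>G = 0\<close> is separate as
  well.\<close>

definition poisson :: "real \<Rightarrow> complex \<Rightarrow> real \<Rightarrow> real" where
  "poisson R w t = (R\<^sup>2 - (norm w)\<^sup>2) / (norm (of_real R * cis t - w))\<^sup>2"

text \<open>Harnack's bound: \<open>R - norm w\<close> is the least distance of \<open>w\<close>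
  from the circle. For \<open>norm w \<le> R / 2\<close> the quotient is at most 3, which is the
  origin of the factor 3 in (iii).\<close>

lemma poisson_bounds:
  assumes "norm w < R"
  shows "0 < poisson R w t" "poisson R w t \<le> (R + norm w) / (R - norm w)"
proof -
  have R: "R > 0" using assms norm_ge_zero[of w] by linarith
  have d: "R - norm w \<le> norm (of_real R * cis t - w)"
    using norm_triangle_ineq2[of "of_real R * cis t" w] R by (simp add: norm_mult)
  have pos: "0 < norm (of_real R * cis t - w)" using d assms by linarith
  have num: "R\<^sup>2 - (norm w)\<^sup>2 = (R + norm w) * (R - norm w)"
    by (simp add: power2_eq_square algebra_simps)
  show "0 < poisson R w t" unfolding poisson_def num using pos assms R norm_ge_zero[of w]
    by (intro divide_pos_pos mult_pos_pos zero_less_power) linarith+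
  have "poisson R w t \<le> (R + norm w) * (R - norm w) / (R - norm w)\<^sup>2"
    unfolding poisson_def num using d assms R pos
    by (intro divide_left_mono power_mono mult_pos_pos) auto
  also have "\<dots> = (R + norm w) / (R - norm w)" using assms by (simp add: power2_eq_square)
  finally show "poisson R w t \<le> (R + norm w) / (R - norm w)" .
qed

lemma poisson_0 [simp]: "R > 0 \<Longrightarrow> poisson R 0 t = 1"
  by (simp add: poisson_def norm_mult)

lemma continuous_on_poisson [continuous_intros]:
  assumes "norm w < R"
  shows "continuous_on A (poisson R w)"
proof -
  have "of_real R * cis t - w \<noteq> 0" for t
    using assms norm_ge_zero[of w]
    by (metis abs_of_nonneg eq_iff_diff_eq_0 less_le_not_le mult.right_neutral norm_cis norm_mult norm_of_real order_trans order.strict_implies_order)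
  then show ?thesis unfolding poisson_def
    by (intro continuous_intros) auto
qed

text \<open>The Cauchy kernel is completed by a term whose pole \<open>R^2 / cnj w\<close> is the
  reflection of \<open>w\<close> in the circle. On the circle \<open>R^2 = u * cnj u\<close>, which
  turns that term into \<open>cnj w / (cnj u - cnj w)\<close>.\<close>

lemma poisson_kernel_split:
  assumes "norm w < R"
  shows "of_real R * cis t / (of_real R * cis t - w) + cnj w * (of_real R * cis t) / (of_real (R\<^sup>2) - cnj w * (of_real R * cis t))
    = of_real (poisson R w t)"
proof -
  define u where "u = of_real R * cis t"
  have R: "R > 0" using assms norm_ge_zero[of w] by linarith
  have nu: "norm u = R" using R by (simp add: u_def norm_mult)
  have u0: "u \<noteq> 0" using nu R by auto
  have uw: "u \<noteq> w" using nu assms by auto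
  have R2: "of_real (R\<^sup>2) = u * cnj u" using nu by (simp add: complex_norm_square[symmetric])
  have "cnj w * u / (of_real (R\<^sup>2) - cnj w * u) = cnj w / (cnj u - cnj w)"
    unfolding R2 using u0 by (simp add: right_diff_distrib[symmetric] mult.commute[of _ u] )
  then have "u / (u - w) + cnj w * u / (of_real (R\<^sup>2) - cnj w * u) = u / (u - w) + cnj w / (cnj u - cnj w)"
    by simp
  also have "\<dots> = (u * (cnj u - cnj w) + cnj w * (u - w)) / ((u - w) * (cnj u - cnj w))"
    using uw by (intro add_frac_eq) auto
  finally have "u / (u - w) + cnj w * u / (of_real (R\<^sup>2) - cnj w * u) = (u * (cnj u - cnj w) + cnj w * (u - w)) / ((u - w) * (cnj u - cnj w))" .
  also have "u * (cnj u - cnj w) + cnj w * (u - w) = of_real (R\<^sup>2 - (norm w)\<^sup>2)"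
    unfolding of_real_diff R2 complex_norm_square by (simp add: algebra_simps)
  also have "(u - w) * (cnj u - cnj w) = of_real ((norm (u - w))\<^sup>2)"
    by (simp only: complex_norm_square complex_cnj_diff)
  finally show ?thesis by (simp add: poisson_def u_def)
qed

text \<open>Cauchy's formula evaluates the first half of the split kernel. The second half times
  \<open>H\<close> is holomorphic on the closed disc, because the reflected point lies outside, and
  integrates to 0.\<close>

lemma poisson_integral_holomorphic:
  fixes H :: "complex \<Rightarrow> complex"
  assumes H: "H holomorphic_on ball 0 R'" and "R < R'" and w: "norm w < R"
  shows "((\<lambda>t. of_real (poisson R w t) * H (of_real R * cis t)) has_integral (2 * pi * H w)) {0..2*pi}"
proof -
  have R: "R > 0" using assms norm_ge_zero[of w] by linarith
  have R': "R' > 0" using R assms by linarith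
  define K where "K = (\<lambda>u. H u * cnj w / (of_real (R\<^sup>2) - cnj w * u))"
  have sub: "cball 0 R \<subseteq> ball (0::complex) R'" using assms by (auto simp: subset_iff)
  have HR: "H holomorphic_on cball 0 R"
    using H sub by (rule holomorphic_on_subset)
  have 1: "((\<lambda>u. H u/(u-w)) has_contour_integral (2 * of_real pi * \<i> * H w)) (circlepath 0 R)"
    by (rule Cauchy_integral_circlepath_simple[OF HR]) (use w in simp)
  have nz: "of_real (R\<^sup>2) - cnj w * u \<noteq> 0" if "u \<in> cball 0 R" for u
  proof
    assume "of_real (R\<^sup>2) - cnj w * u = 0"
    then have "R\<^sup>2 = norm (cnj w * u)"
      by (metis abs_of_nonneg eq_iff_diff_eq_0 norm_of_real zero_le_power2)
    also have "\<dots> \<le> norm w * R" using that by (auto simp: norm_mult intro!: mult_left_mono)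
    also have "\<dots> < R * R" using w R by simp
    finally show False by (simp add: power2_eq_square)
  qed
  have 2: "(K has_contour_integral 0) (circlepath 0 R)"
    by (rule Cauchy_theorem_convex_simple[where S="cball 0 R"])
       (use nz R in \<open>auto simp: K_def intro!: holomorphic_intros HR\<close>)
  have 3: "((\<lambda>u. H u/(u-w) + K u) has_contour_integral (2 * of_real pi * \<i> * H w + 0)) (circlepath 0 R)"
    by (intro has_contour_integral_add 1 2)
  then have "((\<lambda>t. (H (of_real R * cis t)/(of_real R * cis t-w) + K (of_real R * cis t)) * R * \<i> * cis t) has_integral (2 * of_real pi * \<i> * H w)) {0..2*pi}"
    unfolding circlepath_def by (subst (asm) has_contour_integral_part_circlepath_iff) auto
  moreover have "(H (of_real R * cis t)/(of_real R * cis t-w) + K (of_real R * cis t)) * R * \<i> * cis t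
     = \<i> * (of_real (poisson R w t) * H (of_real R * cis t))" for t
    unfolding poisson_kernel_split[OF w, symmetric] K_def by (simp add: field_simps)
  ultimately have "((\<lambda>t. \<i> * (of_real (poisson R w t) * H (of_real R * cis t))) has_integral (2 * of_real pi * \<i> * H w)) {0..2*pi}"
    by simp
  from has_integral_mult_right[OF this, of "-\<i>"] show ?thesis
    by (simp add: mult.assoc[symmetric]) (simp add: mult_ac)
qed

text \<open>\<open>ln (norm (h z))\<close> is the real part of a holomorphic logarithm
  \<open>H\<close> of \<open>h\<close>, which exists on a slightly larger disc.\<close>

lemma poisson_ln_norm_nonvanishing:
  fixes h :: "complex \<Rightarrow> complex"
  assumes h: "h holomorphic_on UNIV" and nz: "\<And>z. z \<in> cball 0 R \<Longrightarrow> h z \<noteq> 0" and w: "norm w < R"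
  shows "((\<lambda>t. poisson R w t * ln (norm (h (of_real R * cis t)))) has_integral (2 * pi * ln (norm (h w)))) {0..2*pi}"
proof -
  have R: "R > 0" using assms norm_ge_zero[of w] by linarith
  \<comment> \<open>Compactness of the closed disc yields a margin \<open>e\<close> in which
    \<open>h\<close> still has no zeros.\<close>
  have op: "open (h -` (- {0}))"
    using h by (intro open_vimage) (auto simp: holomorphic_on_imp_continuous_on)
  have sub: "cball 0 R \<subseteq> h -` (- {0})" using nz by auto
  obtain e where e: "e > 0" "(\<Union>x\<in>cball 0 R. ball x e) \<subseteq> h -` (- {0})"
    using compact_subset_open_imp_ball_epsilon_subset[OF compact_cball op sub] by metis
  have nz': "h z \<noteq> 0" if z: "z \<in> ball 0 (R + e)" for z
  proof -
    obtain y where y: "y \<in> cball 0 R" "dist y z < e"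
    proof (cases "norm z \<le> R")
      case True then show ?thesis using that[of z] e(1) by simp
    next
      case False
      define y where "y = of_real (R / norm z) * z"
      have "z \<noteq> 0" using False R by auto
      have "z - y = of_real (1 - R / norm z) * z" by (simp add: y_def algebra_simps)
      then have "norm (z - y) = \<bar>1 - R / norm z\<bar> * norm z"
        by (simp only: norm_mult norm_of_real)
      also have "\<bar>1 - R / norm z\<bar> = 1 - R / norm z" using False R by (auto simp: divide_simps)
      also have "(1 - R / norm z) * norm z = norm z - R" using False R by (auto simp add: left_diff_distrib)
      finally have "dist y z < e" using z by (simp add: dist_norm norm_minus_commute)
      moreover have "norm y = R" using \<open>z \<noteq> 0\<close> R by (simp add: y_def norm_mult norm_divide)
      ultimately show ?thesis using that[of y] by simp
    qed
    have "z \<in> (\<Union>x\<in>cball 0 R. ball x e)" using y by (intro UN_I[of y]) auto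
    from subsetD[OF e(2) this] show ?thesis by simp
  qed
  obtain H where H: "H holomorphic_on ball 0 (R+e)" "\<And>x. x \<in> ball 0 (R+e) \<Longrightarrow> exp (H x) = h x"
    by (rule holomorphic_logarithm_exists[of "ball 0 (R+e)" h 0])
       (use nz' R e in \<open>auto intro: holomorphic_on_subset[OF h]\<close>)
  have ReH: "ln (norm (h x)) = Re (H x)" if "x \<in> ball 0 (R+e)" for x
    using H(2)[OF that] by (metis ln_exp norm_exp_eq_Re)
  have "((\<lambda>t. Re (of_real (poisson R w t) * H (of_real R * cis t))) has_integral (Re (2 * pi * H w))) {0..2*pi}"
    by (intro has_integral_Re poisson_integral_holomorphic[OF H(1) _ w]) (use e in simp)
  also have "(\<lambda>t. Re (of_real (poisson R w t) * H (of_real R * cis t))) = (\<lambda>t. poisson R w t * ln (norm (h (of_real R * cis t))))"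
    using R e by (auto simp: ReH norm_mult)
  also have "Re (2 * pi * H w) = 2 * pi * ln (norm (h w))"
    using w e by (subst ReH) auto
  finally show ?thesis .
qed

section \<open>Zeros of entire functions\<close>

lemma entire_not_identically_zero_eventually:
  fixes u :: "complex \<Rightarrow> complex"
  assumes "u holomorphic_on UNIV" "u z0 \<noteq> (0::complex)"
  shows "eventually (\<lambda>w. u w \<noteq> 0) (at z)"
  using non_zero_neighbour_alt[OF assms(1) _ _ _ _ assms(2), of z] by auto

lemma entire_finite_zeros:
  fixes u :: "complex \<Rightarrow> complex"
  assumes "u holomorphic_on UNIV" "u z0 \<noteq> (0::complex)"
  shows "finite {z\<in>cball 0 R. u z = 0}"
proof (cases "u constant_on UNIV")
  case True
  then have "{z\<in>cball 0 R. u z = 0} = {}" using assms(2) by (auto simp: constant_on_def)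
  then show ?thesis by (simp only: finite.emptyI)
next
  case False
  then show ?thesis
    using holomorphic_compact_finite_zeros[OF assms(1), of "cball 0 R"] by (auto simp: Convex.connected_UNIV)
qed

lemma zorder_entire_zero:
  fixes u :: "complex \<Rightarrow> complex"
  assumes "u holomorphic_on UNIV" "u z0 \<noteq> (0::complex)"
  shows "if u z = 0 then zorder u z > 0 else zorder u z = 0"
  using zorder_exist_zero[OF assms(1), of z] exI[of "\<lambda>w. u w \<noteq> 0", OF assms(2)] by (simp add: Convex.connected_UNIV split: if_splits)

lemma zorder_prod_powers:
  assumes "finite Z" "a \<in> Z"
  shows "zorder (\<lambda>z. \<Prod>b\<in>Z. (z - b) ^ m b) a = int (m a)"
proof (rule zorder_eqI[of UNIV _ "\<lambda>z. \<Prod>b\<in>Z-{a}. (z - b) ^ m b"])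
  show "(\<Prod>b\<in>Z - {a}. (a - b) ^ m b) \<noteq> 0" using assms by auto
  show "(\<Prod>b\<in>Z. (w - b) ^ m b) = (\<Prod>b\<in>Z - {a}. (w - b) ^ m b) * (w - a) powi int (m a)" for w
    using assms by (subst prod.remove[of _ a]) (auto simp: mult.commute)
qed (auto intro!: holomorphic_intros)

text \<open>Division by the polynomial \<open>P\<close> with the same zeros and orders leaves
  removable singularities. The filled-in quotient has order 0 at the points of \<open>Z\<close>, so
  it is analytic and nonzero there.\<close>

lemma entire_zero_factorization:
  fixes u :: "complex \<Rightarrow> complex"
  assumes u: "u holomorphic_on UNIV" and nz: "u z0 \<noteq> (0::complex)"
    and Z: "Z = {z\<in>cball 0 R. u z = 0}"
  obtains h :: "complex \<Rightarrow> complex" where "h holomorphic_on UNIV"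
    "\<And>z. u z = (\<Prod>a\<in>Z. (z - a) ^ nat (zorder u a)) * h z"
    "\<And>z. z \<in> cball 0 R \<Longrightarrow> h z \<noteq> 0"
proof -
  have fin: "finite Z" unfolding Z by (rule entire_finite_zeros[OF u nz])
  define P where "P = (\<lambda>z. \<Prod>a\<in>Z. (z - a) ^ nat (zorder u a))"
  define Q where "Q = (\<lambda>z. u z / P z)"
  define h where "h = remove_sings Q"
  have pos: "zorder u a > 0" if "a \<in> Z" for a
    using zorder_entire_zero[OF u nz, of a] that Z by auto
  have P0: "P z = 0 \<longleftrightarrow> z \<in> Z" for z
    using fin pos by (auto simp: P_def)
  have P: "P holomorphic_on UNIV" unfolding P_def by (intro holomorphic_intros)
  have uana: "u analytic_on {z}" and Pana: "P analytic_on {z}" for z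
    using u P analytic_at by blast+
  obtain y where y: "P y \<noteq> 0"
    using P0 ex_new_if_finite[OF infinite_UNIV_char_0 fin] by blast
  have freq: "\<exists>\<^sub>F w in at z. u w \<noteq> 0" "\<exists>\<^sub>F w in at z. P w \<noteq> 0" for z
    using entire_not_identically_zero_eventually[OF u nz, of z]
      entire_not_identically_zero_eventually[OF P y, of z]
    by (auto intro: eventually_frequently)
  have mero: "Q meromorphic_on {z}" for z
    unfolding Q_def by (intro meromorphic_intros analytic_on_imp_meromorphic_on uana Pana)
  have iso: "isolated_singularity_at Q z" and ess: "not_essential Q z" for z
    using mero[of z] by (auto simp: meromorphic_at_iff)
  have zQ: "zorder Q a = 0" if "a \<in> Z" for a
  proof -
    have "zorder Q a = zorder u a - zorder P a" unfolding Q_def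
      by (intro zorder_divide freq analytic_on_imp_meromorphic_on uana Pana)
    also have "zorder P a = zorder u a"
      unfolding P_def using zorder_prod_powers[OF fin that, of "\<lambda>a. nat (zorder u a)"] pos[OF that] by simp
    finally show ?thesis by simp
  qed
  have Qana: "Q analytic_on {z}" if "z \<notin> Z" for z
    unfolding Q_def using that P0 by (intro analytic_intros uana Pana) auto
  \<comment> \<open>Off \<open>Z\<close> the quotient is analytic; at a point of \<open>Z\<close> a
    pole would have negative order, whereas the orders of \<open>u\<close> and \<open>P\<close>
    cancel.\<close>
  have nopole: "\<not> is_pole Q z" for z
    using Qana[of z] analytic_at_imp_no_pole[of Q z] isolated_pole_imp_neg_zorder[OF iso[of z]] zQ[of z] by force
  have lim: "\<exists>c. Q \<midarrow>z\<rightarrow> c" for z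
    using ess[of z] nopole[of z] by (auto simp: not_essential_def)
  have hana: "h analytic_on {z}" for z
    unfolding h_def using lim[of z] iso[of z] by (auto intro: remove_sings_analytic_at)
  have freqQ: "\<exists>\<^sub>F w in at z. Q w \<noteq> 0" for z
  proof -
    have "eventually (\<lambda>w. Q w \<noteq> 0) (at z)"
      using entire_not_identically_zero_eventually[OF u nz, of z]
      entire_not_identically_zero_eventually[OF P y, of z]
      by eventually_elim (auto simp: Q_def)
    then show ?thesis by (auto intro: eventually_frequently)
  qed
  have hQ: "h z = Q z" if "z \<notin> Z" for z
    unfolding h_def using Qana[OF that] by simp
  show ?thesis
  proof
    show "h holomorphic_on UNIV"
      using hana by (meson analytic_imp_holomorphic analytic_on_analytic_at)
    show "u z = (\<Prod>a\<in>Z. (z - a) ^ nat (zorder u a)) * h z" for z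
    proof (cases "z \<in> Z")
      case True
      then show ?thesis using P0[of z] Z by (auto simp: P_def)
    next
      case False
      then show ?thesis using P0[of z] hQ[OF False] by (auto simp: P_def Q_def)
    qed
    show "h z \<noteq> 0" if "z \<in> cball 0 R" for z
    proof (cases "z \<in> Z")
      case False
      then show ?thesis using that P0[of z] hQ[OF False] Z by (auto simp: Q_def)
    next
      case True
      have "zorder h z = 0" using zQ[OF True] iso[of z] ess[of z] by (simp add: h_def)
      moreover have "\<exists>\<^sub>F w in at z. h w \<noteq> 0"
        using freqQ[of z] eventually_remove_sings_eq_at[OF iso[of z]] unfolding h_def
        by (auto elim!: frequently_rev_mp eventually_mono)
      ultimately show ?thesis using zorder_eq_0_iff[OF hana[of z]] by auto
    qed
  qed
qed

text \<open>The function \<open>ln (norm (u - a))\<close> is not harmonic in the disc. On the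
  circle, however, \<open>norm (u - a)\<close> agrees with
  \<open>norm (R^2 - cnj a * u) / R\<close>, which has no zero in the closed disc: the reflected
  point of \<open>a\<close> lies outside.\<close>

lemma poisson_ln_linear_factor:
  fixes a w :: complex and R :: real
  assumes a: "norm a < R" and w: "norm w < R"
  shows "((\<lambda>t. poisson R w t * ln (norm (complex_of_real R * cis t - a))) has_integral
            (2 * pi * ln (norm ((of_real (R\<^sup>2) - cnj a * w) / of_real R)))) {0..2*pi}"
proof -
  have R: "R > 0" using assms norm_ge_zero[of w] by linarith
  define h where "h = (\<lambda>z. (of_real (R\<^sup>2) - cnj a * z) / of_real R)"
  have R2: "0 \<le> R\<^sup>2" by simp
  have "h z \<noteq> 0" if "z \<in> cball 0 R" for z
  proof
    assume "h z = 0"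
    then have "of_real (R\<^sup>2) - cnj a * z = 0" using R by (auto simp: h_def)
    then have "R\<^sup>2 = norm (cnj a * z)"
      by (metis R2 abs_of_nonneg eq_iff_diff_eq_0 norm_of_real)
    also have "\<dots> \<le> norm a * R" using that by (auto simp: norm_mult intro!: mult_left_mono)
    also have "\<dots> < R * R" using a R by simp
    finally show False by (simp add: power2_eq_square)
  qed
  moreover have "h holomorphic_on UNIV" unfolding h_def using R by (intro holomorphic_intros) auto
  ultimately have "((\<lambda>t. poisson R w t * ln (norm (h (of_real R * cis t)))) has_integral (2 * pi * ln (norm (h w)))) {0..2*pi}"
    by (intro poisson_ln_norm_nonvanishing w) auto
  moreover have "norm (h (of_real R * cis t)) = norm (of_real R * cis t - a)" for t
  proof -
    have "h (of_real R * cis t) = cis t * cnj (of_real R * cis t - a)"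
      using R by (simp add: h_def field_simps power2_eq_square cis_cnj cis_mult)
    then show ?thesis by (simp add: norm_mult del: complex_cnj_diff complex_cnj_mult)
  qed
  ultimately show ?thesis by (simp add: h_def)
qed

text \<open>The formulas for the linear factors are added with their multiplicities to the one for
  the zero-free factor \<open>h\<close>. The value \<open>w = 0\<close> leads to Jensen's formula; a
  comparison of each reflected factor with \<open>w - a\<close> leads to the subharmonicity of
  \<open>ln (norm (u w))\<close>.\<close>

lemma poisson_jensen:
  fixes u h :: "complex \<Rightarrow> complex"
  assumes Z: "finite Z" "Z \<subseteq> ball 0 R" and h: "h holomorphic_on UNIV" "\<And>z. z \<in> cball 0 R \<Longrightarrow> h z \<noteq> 0"
    and u: "\<And>z. u z = (\<Prod>a\<in>Z. (z - a) ^ m a) * h z" and w: "norm w < R"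
  shows "((\<lambda>t. poisson R w t * ln (norm (u (of_real R * cis t)))) has_integral
            (2 * pi * ((\<Sum>a\<in>Z. m a * ln (norm ((of_real (R\<^sup>2) - cnj a * w) / of_real R))) + ln (norm (h w))))) {0..2*pi}"
proof -
  have R: "R > 0" using w norm_ge_zero[of w] by linarith
  have lin: "((\<lambda>t. poisson R w t * ln (norm (complex_of_real R * cis t - a))) has_integral
            (2 * pi * ln (norm ((of_real (R\<^sup>2) - cnj a * w) / of_real R)))) {0..2*pi}" if "a \<in> Z" for a
    using that Z w by (intro poisson_ln_linear_factor) auto
  have ln_u: "ln (norm (u (of_real R * cis t))) = (\<Sum>a\<in>Z. m a * ln (norm (of_real R * cis t - a))) + ln (norm (h (of_real R * cis t)))" for t
  proof -
    have ne: "of_real R * cis t - a \<noteq> 0" if "a \<in> Z" for a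
    proof
      assume "of_real R * cis t - a = 0"
      then have "norm a = norm (of_real R * cis t)" by simp
      then show False using that Z R by (auto simp: norm_mult)
    qed
    have "h (of_real R * cis t) \<noteq> 0" using h(2) R by (auto simp: norm_mult)
    then show ?thesis unfolding u norm_mult prod_norm[symmetric] norm_power
      by (subst ln_mult_pos) (use ne Z in \<open>auto simp: ln_prod ln_realpow intro!: prod_pos sum.cong\<close>)
  qed
  have "((\<lambda>t. (\<Sum>a\<in>Z. m a * (poisson R w t * ln (norm (of_real R * cis t - a)))) + poisson R w t * ln (norm (h (of_real R * cis t)))) has_integral
            ((\<Sum>a\<in>Z. m a * (2 * pi * ln (norm ((of_real (R\<^sup>2) - cnj a * w) / of_real R)))) + 2 * pi * ln (norm (h w)))) {0..2*pi}"
    by (intro has_integral_add has_integral_sum has_integral_mult_right poisson_ln_norm_nonvanishing lin)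
       (use Z h w in auto)
  then show ?thesis unfolding ln_u
    by (simp add: sum_distrib_left algebra_simps)
qed

section \<open>Circle means and the positive part of the logarithm\<close>

definition circle_mean :: "(complex \<Rightarrow> real) \<Rightarrow> real \<Rightarrow> real" where
  "circle_mean \<phi> r = integral {0..2*pi} (\<lambda>t. \<phi> (of_real r * cis t)) / (2*pi)"

lemma proximity_fun_eq_circle_mean: "proximity_fun h r = circle_mean (\<lambda>z. log_plus (norm (h z))) r"
  by (simp add: proximity_fun_def circle_mean_def)

lemma circle_integrable:
  assumes "continuous_on (sphere 0 \<bar>r\<bar>) (\<phi> :: complex \<Rightarrow> real)"
  shows "(\<lambda>t. \<phi> (of_real r * cis t)) integrable_on {0..2*pi}"
proof (rule integrable_continuous_real)
  have "continuous_on {0..2*pi} (\<phi> \<circ> (\<lambda>t. of_real r * cis t))"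
    by (rule continuous_on_compose) (auto intro!: continuous_intros continuous_on_subset[OF assms] simp: norm_mult)
  then show "continuous_on {0..2*pi} (\<lambda>t. \<phi> (of_real r * cis t))" by (simp add: o_def)
qed

lemma circle_mean_mono:
  assumes "continuous_on (sphere 0 r) \<phi>" "continuous_on (sphere 0 r) \<psi>" "r \<ge> 0"
    "\<And>z. norm z = r \<Longrightarrow> \<phi> z \<le> \<psi> z"
  shows "circle_mean \<phi> r \<le> circle_mean \<psi> r"
  unfolding circle_mean_def
  by (intro divide_right_mono integral_le circle_integrable) (use assms in \<open>auto simp: norm_mult\<close>)

lemma circle_mean_add:
  assumes "continuous_on (sphere 0 r) \<phi>" "continuous_on (sphere 0 r) \<psi>" "r \<ge> 0"
  shows "circle_mean (\<lambda>z. \<phi> z + \<psi> z) r = circle_mean \<phi> r + circle_mean \<psi> r"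
  unfolding circle_mean_def
  by (subst Henstock_Kurzweil_Integration.integral_add) (use assms in \<open>auto intro!: circle_integrable simp: add_divide_distrib\<close>)

lemma circle_mean_const [simp]: "circle_mean (\<lambda>z. c) r = c"
  by (simp add: circle_mean_def)

lemma circle_mean_diff:
  assumes "continuous_on (sphere 0 r) \<phi>" "continuous_on (sphere 0 r) \<psi>" "r \<ge> 0"
  shows "circle_mean (\<lambda>z. \<phi> z - \<psi> z) r = circle_mean \<phi> r - circle_mean \<psi> r"
  unfolding circle_mean_def
  by (subst Henstock_Kurzweil_Integration.integral_diff) (use assms in \<open>auto intro!: circle_integrable simp: diff_divide_distrib\<close>)

lemma log_plus_nonneg [simp]: "0 \<le> log_plus x" by (simp add: log_plus_def)

lemma ln_le_log_plus: "ln x \<le> log_plus x" by (simp add: log_plus_def)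

lemma continuous_on_ln_norm:
  assumes "continuous_on S (u :: complex \<Rightarrow> complex)" "\<And>z. z \<in> S \<Longrightarrow> u z \<noteq> 0"
  shows "continuous_on S (\<lambda>z. ln (norm (u z)))"
  using assms by (intro continuous_intros) auto

lemma log_plus_eq_ln_max: "x \<ge> 0 \<Longrightarrow> log_plus x = ln (max 1 x)"
  by (cases "x = 0") (auto simp: log_plus_def max_def)

lemma continuous_on_log_plus_norm:
  assumes "continuous_on S (u :: complex \<Rightarrow> complex)"
  shows "continuous_on S (\<lambda>z. log_plus (norm (u z)))"
  by (simp add: log_plus_eq_ln_max) (intro continuous_intros assms, auto simp: max_def)

text \<open>A Blaschke factor has modulus at most 1, by the identity |R^2 - cnj a w|^2 - R^2 |w -
  a|^2 = (R^2 - |a|^2) (R^2 - |w|^2).\<close>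

lemma norm_moebius_factor_le:
  fixes a w :: complex
  assumes "norm a < R" "norm w < R"
  shows "norm (w - a) \<le> norm ((of_real (R\<^sup>2) - cnj a * w) / of_real R)"
proof -
  have R: "R > 0" using assms norm_ge_zero[of w] by linarith
  have "(norm (of_real (R\<^sup>2) - cnj a * w))\<^sup>2 - (R * norm (w - a))\<^sup>2 = (R\<^sup>2 - (norm a)\<^sup>2) * (R\<^sup>2 - (norm w)\<^sup>2)"
    unfolding power_mult_distrib cmod_power2 by (simp add: power2_eq_square algebra_simps)
  also have "\<dots> \<ge> 0" using assms by (intro mult_nonneg_nonneg) (simp_all add: power_mono less_imp_le)
  finally have "(R * norm (w - a))\<^sup>2 \<le> (norm (of_real (R\<^sup>2) - cnj a * w))\<^sup>2" by linarith
  then have "R * norm (w - a) \<le> norm (of_real (R\<^sup>2) - cnj a * w)"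
    by (rule power2_le_imp_le) simp
  then show ?thesis using R by (simp add: norm_divide field_simps)
qed

lemma poisson_integrable:
  assumes "continuous_on (sphere 0 R) (\<phi> :: complex \<Rightarrow> real)" "norm w < R"
  shows "(\<lambda>t. poisson R w t * \<phi> (of_real R * cis t)) integrable_on {0..2*pi}"
proof (rule integrable_continuous_real)
  have R: "R > 0" using assms norm_ge_zero[of w] by linarith
  have "continuous_on {0..2*pi} (\<phi> \<circ> (\<lambda>t. of_real R * cis t))"
    using R by (intro continuous_on_compose) (auto intro!: continuous_intros continuous_on_subset[OF assms(1)] simp: norm_mult)
  then show "continuous_on {0..2*pi} (\<lambda>t. poisson R w t * \<phi> (of_real R * cis t))"
    using assms by (intro continuous_intros) (auto simp: o_def)
qed

lemma entire_sphere_factorization: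
  fixes u :: "complex \<Rightarrow> complex"
  assumes u: "u holomorphic_on UNIV" and sph: "\<And>z. norm z = R \<Longrightarrow> u z \<noteq> 0" and R: "R > 0"
  obtains h where "h holomorphic_on UNIV" "finite {z\<in>ball 0 R. u z = 0}"
    "\<And>z. u z = (\<Prod>a\<in>{z\<in>ball 0 R. u z = 0}. (z - a) ^ nat (zorder u a)) * h z"
    "\<And>z. z \<in> cball 0 R \<Longrightarrow> h z \<noteq> 0"
proof -
  have nz: "u (of_real R) \<noteq> 0" using sph[of "of_real R"] R by simp
  have Z: "{z\<in>ball 0 R. u z = 0} = {z\<in>cball 0 R. u z = 0}"
    using sph by (auto simp: order_le_less)
  have fin: "finite {z\<in>ball 0 R. u z = 0}" unfolding Z by (rule entire_finite_zeros[OF u nz])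
  show ?thesis
    by (rule entire_zero_factorization[OF u nz Z]) (use that fin in blast)
qed

text \<open>Subharmonicity of ln |u|: in the Poisson-Jensen formula each reflected factor dominates
  the corresponding \<open>w - a\<close>.\<close>

lemma poisson_jensen_le:
  fixes u :: "complex \<Rightarrow> complex"
  assumes u: "u holomorphic_on UNIV" and sph: "\<And>z. norm z = R \<Longrightarrow> u z \<noteq> 0" and w: "norm w < R" "u w \<noteq> 0"
  shows "2 * pi * ln (norm (u w)) \<le> integral {0..2*pi} (\<lambda>t. poisson R w t * ln (norm (u (of_real R * cis t))))"
proof -
  have R: "R > 0" using w norm_ge_zero[of w] by linarith
  define Z where "Z = {z\<in>ball 0 R. u z = 0}"
  obtain h where h: "h holomorphic_on UNIV" "finite Z"
    "\<And>z. u z = (\<Prod>a\<in>Z. (z - a) ^ nat (zorder u a)) * h z"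
    "\<And>z. z \<in> cball 0 R \<Longrightarrow> h z \<noteq> 0"
    using entire_sphere_factorization[OF u sph R] unfolding Z_def by metis
  have ZR: "Z \<subseteq> ball 0 R" by (auto simp: Z_def)
  have ne: "w - a \<noteq> 0" if "a \<in> Z" for a using that w by (auto simp: Z_def)
  have "ln (norm (u w)) = (\<Sum>a\<in>Z. nat (zorder u a) * ln (norm (w - a))) + ln (norm (h w))"
    unfolding h(3)[of w] norm_mult prod_norm[symmetric] norm_power
    by (subst ln_mult_pos) (use ne h w in \<open>auto simp: ln_prod ln_realpow intro!: prod_pos sum.cong\<close>)
  also have "\<dots> \<le> (\<Sum>a\<in>Z. nat (zorder u a) * ln (norm ((of_real (R\<^sup>2) - cnj a * w) / of_real R))) + ln (norm (h w))"
  proof (intro add_right_mono sum_mono mult_left_mono)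
    fix a assume a: "a \<in> Z"
    have "norm (w - a) \<le> norm ((of_real (R\<^sup>2) - cnj a * w) / of_real R)"
      using a ZR w by (intro norm_moebius_factor_le) auto
    then show "ln (norm (w - a)) \<le> ln (norm ((of_real (R\<^sup>2) - cnj a * w) / of_real R))"
      using ne[OF a] by (intro ln_mono) auto
  qed auto
  also have "2 * pi * \<dots> = integral {0..2*pi} (\<lambda>t. poisson R w t * ln (norm (u (of_real R * cis t))))"
    using poisson_jensen[OF h(2) ZR h(1) h(4) h(3) w(1)] by (simp add: integral_unique)
  finally show ?thesis by simp
qed

text \<open>Zeros of \<open>F\<close> in the disc only help, since ln |F| is subharmonic, while the
  zero-free \<open>D\<close> makes ln |D| harmonic. Passing from \<open>ln\<close> to
  \<open>log_plus\<close> makes the integrand nonnegative, so that the kernel may be replaced by its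
  upper bound.\<close>

lemma log_plus_quotient_le_proximity:
  fixes F D :: "complex \<Rightarrow> complex"
  assumes F: "F holomorphic_on UNIV" and Fs: "\<And>z. norm z = R \<Longrightarrow> F z \<noteq> 0"
    and D: "D holomorphic_on UNIV" and Dz: "\<And>z. norm z \<le> R \<Longrightarrow> D z \<noteq> 0" and w: "norm w < R"
  shows "log_plus (norm (F w / D w)) \<le> (R + norm w) / (R - norm w) * proximity_fun (\<lambda>z. F z / D z) R"
proof -
  have R: "R > 0" using w norm_ge_zero[of w] by linarith
  let ?f = "\<lambda>z. F z / D z"
  have cF: "continuous_on S F" and cD: "continuous_on S D" for S
    using F D holomorphic_on_imp_continuous_on holomorphic_on_subset by blast+
  have c: "continuous_on (sphere 0 R) ?f"
    by (intro continuous_intros cF cD) (use Dz in auto)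
  have cp: "continuous_on (sphere 0 R) (\<lambda>z. log_plus (norm (?f z)))"
    by (intro continuous_on_log_plus_norm c)
  have prox0: "proximity_fun ?f R \<ge> 0"
    unfolding proximity_fun_def using circle_integrable[of R "\<lambda>z. log_plus (norm (?f z))"] cp R
    by (intro divide_nonneg_nonneg integral_nonneg) auto
  have K: "(R + norm w) / (R - norm w) \<ge> 0" using w R by auto
  show ?thesis
  proof (cases "F w = 0")
    case True
    \<comment> \<open>The convention \<open>ln 0 = 0\<close> makes the left-hand side 0.\<close>
    then show ?thesis using mult_nonneg_nonneg[OF K prox0] by (simp add: log_plus_def)
  next
    case False
    have Dw: "D w \<noteq> 0" using Dz w by auto
    have "ln (norm (?f w)) = ln (norm (F w)) - ln (norm (D w))"
      using False Dw by (simp add: norm_divide ln_div)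
    then have "2 * pi * ln (norm (?f w)) = 2 * pi * ln (norm (F w)) - 2 * pi * ln (norm (D w))"
      by (simp add: right_diff_distrib)
    also have "\<dots> \<le> integral {0..2*pi} (\<lambda>t. poisson R w t * ln (norm (F (of_real R * cis t))))
       - integral {0..2*pi} (\<lambda>t. poisson R w t * ln (norm (D (of_real R * cis t))))"
      using poisson_jensen_le[OF F Fs w False] integral_unique[OF poisson_ln_norm_nonvanishing[OF D _ w]] Dz by auto
    also have "\<dots> = integral {0..2*pi} (\<lambda>t. poisson R w t * ln (norm (F (of_real R * cis t))) - poisson R w t * ln (norm (D (of_real R * cis t))))"
      by (subst Henstock_Kurzweil_Integration.integral_diff)
         (use Fs Dz w in \<open>auto intro!: poisson_integrable continuous_on_ln_norm cF cD\<close>)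
    also have "\<dots> \<le> integral {0..2*pi} (\<lambda>t. (R + norm w) / (R - norm w) * log_plus (norm (?f (of_real R * cis t))))"
    proof (rule integral_le)
      show "(\<lambda>t. poisson R w t * ln (norm (F (of_real R * cis t))) - poisson R w t * ln (norm (D (of_real R * cis t)))) integrable_on {0..2*pi}"
        by (intro integrable_diff poisson_integrable continuous_on_ln_norm cF cD)
           (use Fs Dz w in auto)
      show "(\<lambda>t. (R + norm w) / (R - norm w) * log_plus (norm (?f (of_real R * cis t)))) integrable_on {0..2*pi}"
        using circle_integrable[of R "\<lambda>z. log_plus (norm (?f z))"] cp R by (intro integrable_on_mult_right) auto
      fix t :: real
      let ?z = "of_real R * cis t"
      have n: "norm ?z = R" using R by (simp add: norm_mult)
      have "poisson R w t * ln (norm (F ?z)) - poisson R w t * ln (norm (D ?z)) = poisson R w t * ln (norm (?f ?z))"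
        using Fs[OF n] Dz[of ?z] n by (simp add: norm_divide ln_div right_diff_distrib)
      also have "\<dots> \<le> poisson R w t * log_plus (norm (?f ?z))"
        using poisson_bounds(1)[OF w(1), of t] by (intro mult_left_mono ln_le_log_plus) auto
      also have "\<dots> \<le> (R + norm w) / (R - norm w) * log_plus (norm (?f ?z))"
        by (intro mult_right_mono poisson_bounds w) auto
      finally show "poisson R w t * ln (norm (F ?z)) - poisson R w t * ln (norm (D ?z)) \<le> (R + norm w) / (R - norm w) * log_plus (norm (?f ?z))" .
    qed
    also have "\<dots> = 2 * pi * ((R + norm w) / (R - norm w) * proximity_fun ?f R)"
      by (simp add: proximity_fun_def)
    finally have "ln (norm (?f w)) \<le> (R + norm w) / (R - norm w) * proximity_fun ?f R"
      by (rule mult_left_le_imp_le) simp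
    then show ?thesis using mult_nonneg_nonneg[OF K prox0] by (simp add: log_plus_def)
  qed
qed

lemma log_plus_le_proximity:
  fixes u :: "complex \<Rightarrow> complex"
  assumes "u holomorphic_on UNIV" "\<And>z. norm z = R \<Longrightarrow> u z \<noteq> 0" "norm w < R"
  shows "log_plus (norm (u w)) \<le> (R + norm w) / (R - norm w) * proximity_fun u R"
  using log_plus_quotient_le_proximity[OF assms(1,2), where D="\<lambda>_. 1"] assms by simp

text \<open>The contribution of a zero or pole \<open>a\<close> to Jensen's formula: the integral of
  1 / t from |a| to r. At the origin it is \<open>ln r\<close>, in agreement with the separate term
  for the origin in the counting function.\<close>

definition jensen_weight :: "real \<Rightarrow> complex \<Rightarrow> real" where
  "jensen_weight r a = (if a = 0 then ln r else ln (r / norm a))"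

lemma jensen_weight_nonneg:
  assumes "r \<ge> 1" "norm a \<le> r"
  shows "jensen_weight r a \<ge> 0"
proof (cases "a = 0")
  case False
  then have "1 \<le> r / norm a" using assms by (simp add: le_divide_eq)
  then show ?thesis using False ln_ge_zero[of "r / norm a"] by (simp add: jensen_weight_def)
qed (use assms in \<open>simp add: jensen_weight_def\<close>)

lemma entire_isCont: "u holomorphic_on UNIV \<Longrightarrow> isCont u (z :: complex)"
  using holomorphic_on_imp_continuous_on continuous_on_eq_continuous_at[OF open_UNIV] by blast

text \<open>Away from 0 the power of \<open>z\<close> cancels from both factorizations, and both
  remaining functions are continuous at 0.\<close>

lemma leading_coefficient_product:
  fixes u V h :: "complex \<Rightarrow> complex"
  assumes Z: "finite Z" "0 \<in> Z \<Longrightarrow> m 0 = k" "0 \<notin> Z \<Longrightarrow> k = 0"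
    and h: "h holomorphic_on UNIV" "\<And>z. u z = (\<Prod>a\<in>Z. (z - a) ^ m a) * h z"
    and V: "V holomorphic_on UNIV" "\<And>z. u z = z ^ k * V z"
  shows "V 0 = (\<Prod>a\<in>Z-{0}. (0 - a) ^ m a) * h 0"
proof -
  have eqV: "V z = (\<Prod>a\<in>Z-{0}. (z - a) ^ m a) * h z" if "z \<noteq> 0" for z
  proof -
    have "(\<Prod>a\<in>Z. (z - a) ^ m a) = z ^ k * (\<Prod>a\<in>Z-{0}. (z - a) ^ m a)"
      using Z by (cases "0 \<in> Z") (auto simp: prod.remove)
    then show ?thesis using V(2)[of z] h(2)[of z] that by simp
  qed
  show "V 0 = (\<Prod>a\<in>Z-{0}. (0 - a) ^ m a) * h 0"
  proof (rule LIM_unique)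
    have "isCont V 0" using V(1)
      by (rule entire_isCont)
    then show "V \<midarrow>0\<rightarrow> V 0" by (simp add: isCont_def)
    have "(\<lambda>z. (\<Prod>a\<in>Z-{0}. (z - a) ^ m a) * h z) holomorphic_on UNIV"
      by (intro holomorphic_on_mult h(1)) (intro holomorphic_intros)
    then have "isCont (\<lambda>z. (\<Prod>a\<in>Z-{0}. (z - a) ^ m a) * h z) 0"
      by (rule entire_isCont)
    then have "(\<lambda>z. (\<Prod>a\<in>Z-{0}. (z - a) ^ m a) * h z) \<midarrow>0\<rightarrow> (\<Prod>a\<in>Z-{0}. (0 - a) ^ m a) * h 0"
      by (simp add: isCont_def)
    moreover have "eventually (\<lambda>z. V z = (\<Prod>a\<in>Z-{0}. (z - a) ^ m a) * h z) (at 0)"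
      using eqV by (simp add: eventually_at_filter)
    ultimately show "V \<midarrow>0\<rightarrow> (\<Prod>a\<in>Z-{0}. (0 - a) ^ m a) * h 0"
      by (simp only: filterlim_cong[OF refl refl, of V])
  qed
qed

text \<open>At the centre the Poisson-Jensen formula gives each zero the weight \<open>ln r\<close>
  and leaves \<open>ln (norm (h 0))\<close>. Expressing \<open>h 0\<close> through the leading
  coefficient \<open>V 0\<close> subtracts \<open>ln (norm a)\<close> for each zero \<open>a\<close>
  other than 0, with multiplicity, which changes \<open>ln r\<close> into the Jensen weight.\<close>

lemma jensen_formula:
  fixes u V :: "complex \<Rightarrow> complex"
  assumes u: "u holomorphic_on UNIV" and sph: "\<And>z. norm z = r \<Longrightarrow> u z \<noteq> 0" and r: "r > 0"
    and V: "V holomorphic_on UNIV" "V 0 \<noteq> 0" "\<And>z. u z = z ^ k * V z"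
  shows "circle_mean (\<lambda>z. ln (norm (u z))) r =
    (\<Sum>a\<in>{z\<in>ball 0 r. u z = 0}. nat (zorder u a) * jensen_weight r a) + ln (norm (V 0))"
    "finite {z\<in>ball 0 r. u z = 0}"
proof -
  define Z where "Z = {z\<in>ball 0 r. u z = 0}"
  define m where "m = (\<lambda>a. nat (zorder u a))"
  obtain h where h: "h holomorphic_on UNIV" "finite Z"
    "\<And>z. u z = (\<Prod>a\<in>Z. (z - a) ^ m a) * h z"
    "\<And>z. z \<in> cball 0 r \<Longrightarrow> h z \<noteq> 0"
    using entire_sphere_factorization[OF u sph r] unfolding Z_def m_def by metis
  show "finite {z\<in>ball 0 r. u z = 0}" using h(2) by (simp add: Z_def)
  have ZR: "Z \<subseteq> ball 0 r" by (auto simp: Z_def)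
  have "zorder u 0 = int k"
    by (rule zorder_eqI[of UNIV _ V]) (use V in \<open>auto simp: mult.commute\<close>)
  then have mk: "m 0 = k" by (simp add: m_def)
  have Z0: "0 \<in> Z \<longleftrightarrow> k > 0" using V(2) V(3)[of 0] r by (auto simp: Z_def)
  have "V 0 = (\<Prod>a\<in>Z-{0}. (0 - a) ^ m a) * h 0"
    by (rule leading_coefficient_product[OF h(2) _ _ h(1,3) V(1,3)]) (use Z0 mk in auto)
  then have "norm (V 0) = (\<Prod>a\<in>Z-{0}. norm a ^ m a) * norm (h 0)"
    by (simp add: norm_mult prod_norm[symmetric] norm_power)
  then have lnV: "ln (norm (V 0)) = (\<Sum>a\<in>Z-{0}. m a * ln (norm a)) + ln (norm (h 0))"
  proof -
    have p: "0 < norm a ^ m a" if "a \<in> Z-{0}" for a using that by (intro zero_less_power) auto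
    have "0 < (\<Prod>a\<in>Z-{0}. norm a ^ m a)" by (intro prod_pos p)
    moreover have "0 < norm (h 0)" using h(4)[of 0] r by simp
    ultimately have "ln ((\<Prod>a\<in>Z-{0}. norm a ^ m a) * norm (h 0)) = ln (\<Prod>a\<in>Z-{0}. norm a ^ m a) + ln (norm (h 0))"
      by (rule ln_mult_pos)
    also have "ln (\<Prod>a\<in>Z-{0}. norm a ^ m a) = (\<Sum>a\<in>Z-{0}. ln (norm a ^ m a))"

    proof (rule ln_prod)
      show "norm a ^ m a \<noteq> 0" if "a \<in> Z-{0}" for a using p[OF that] by linarith
    qed (use h(2) in simp)
    finally show ?thesis using \<open>norm (V 0) = _\<close> by (simp add: ln_realpow)
  qed
  have "circle_mean (\<lambda>z. ln (norm (u z))) r = (\<Sum>a\<in>Z. m a * ln r) + ln (norm (h 0))"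
    using poisson_jensen[OF h(2) ZR h(1) h(4) h(3), of 0] r
    by (simp add: circle_mean_def integral_unique power2_eq_square norm_mult)
  also have "(\<Sum>a\<in>Z. m a * ln r) = (\<Sum>a\<in>Z. m a * jensen_weight r a) + (\<Sum>a\<in>Z. if a = 0 then 0 else m a * ln (norm a))"
    unfolding sum.distrib[symmetric]
  proof (rule sum.cong[OF refl])
    fix a show "m a * ln r = m a * jensen_weight r a + (if a = 0 then 0 else m a * ln (norm a))"
      using r by (cases "a = 0") (simp_all add: jensen_weight_def ln_div right_diff_distrib)
  qed
  also have "(\<Sum>a\<in>Z. if a = 0 then 0 else m a * ln (norm a)) = (\<Sum>a\<in>Z-{0}. m a * ln (norm a))"
    using h(2) by (intro sum.mono_neutral_cong_right) auto
  finally show "circle_mean (\<lambda>z. ln (norm (u z))) r =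
    (\<Sum>a\<in>{z\<in>ball 0 r. u z = 0}. nat (zorder u a) * jensen_weight r a) + ln (norm (V 0))"
    using lnV by (simp add: Z_def m_def)
qed

text \<open>For \<open>r \<ge> 1\<close> all weights are nonnegative, so leaving out zeros or
  lowering multiplicities decreases the sum. It serves twice: with \<open>A\<close> the poles of
  \<open>f \<circ> g\<close> it bounds a counting function, and with \<open>A\<close> empty it
  bounds a mean from below.\<close>

lemma jensen_lower_bound:
  fixes u V :: "complex \<Rightarrow> complex"
  assumes u: "u holomorphic_on UNIV" and sph: "\<And>z. norm z = r \<Longrightarrow> u z \<noteq> 0" and r: "r \<ge> 1"
    and V: "V holomorphic_on UNIV" "V 0 \<noteq> 0" "\<And>z. u z = z ^ k * V z"
    and A: "A \<subseteq> ball 0 r" "\<And>a. a \<in> A \<Longrightarrow> int (m a) \<le> zorder u a" "\<And>a. a \<in> A \<Longrightarrow> u a = 0"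
  shows "(\<Sum>a\<in>A. m a * jensen_weight r a) + ln (norm (V 0)) \<le> circle_mean (\<lambda>z. ln (norm (u z))) r"
proof -
  let ?Z = "{z\<in>ball 0 r. u z = 0}"
  have r0: "r > 0" using r by simp
  have fin: "finite ?Z" using jensen_formula[OF u sph r0 V] by blast
  have "(\<Sum>a\<in>A. m a * jensen_weight r a) \<le> (\<Sum>a\<in>A. nat (zorder u a) * jensen_weight r a)"
  proof (intro sum_mono mult_right_mono)
    fix a assume a: "a \<in> A"
    have "m a \<le> nat (zorder u a)" using A(2)[OF a] by linarith
    then show "real (m a) \<le> real (nat (zorder u a))" by simp
    have "a \<in> ball 0 r" using a A(1) by blast
    then show "0 \<le> jensen_weight r a" using r by (intro jensen_weight_nonneg) auto
  qed
  also have "\<dots> \<le> (\<Sum>a\<in>?Z. nat (zorder u a) * jensen_weight r a)"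
  proof (rule sum_mono2[OF fin])
    show "A \<subseteq> ?Z" using A by auto
    fix a assume "a \<in> ?Z - A"
    then have "0 \<le> jensen_weight r a" using r by (intro jensen_weight_nonneg) auto
    then show "0 \<le> real (nat (zorder u a)) * jensen_weight r a" by simp
  qed
  finally show ?thesis using jensen_formula(1)[OF u sph r0 V] by simp
qed

text \<open>This is the zero factorization on the degenerate disc of radius 0, where only the origin
  can be a zero.\<close>

lemma entire_leading_factor:
  fixes u :: "complex \<Rightarrow> complex"
  assumes "u holomorphic_on UNIV" "u z0 \<noteq> 0"
  obtains k V where "V holomorphic_on UNIV" "V 0 \<noteq> 0" "\<And>z. u z = z ^ k * V z"
proof -
  define Z where "Z = {z\<in>cball 0 0. u z = 0}"
  obtain h where h: "h holomorphic_on UNIV"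
    "\<And>z. u z = (\<Prod>a\<in>Z. (z - a) ^ nat (zorder u a)) * h z"
    "\<And>z. z \<in> cball 0 0 \<Longrightarrow> h z \<noteq> 0"
    using entire_zero_factorization[OF assms Z_def] by metis
  have h0: "h 0 \<noteq> 0" by (rule h(3)) simp
  have "Z \<subseteq> {0}" by (auto simp: Z_def)
  then consider "Z = {}" | "Z = {0}" by blast
  then show ?thesis
  proof cases
    case 1
    have "u z = z ^ 0 * h z" for z using h(2)[of z] unfolding 1 by simp
    then show ?thesis using that h(1) h0 by blast
  next
    case 2
    have "u z = z ^ nat (zorder u 0) * h z" for z using h(2)[of z] unfolding 2 by simp
    then show ?thesis using that h(1) h0 by blast
  qed
qed

section \<open>The Nevanlinna characteristic\<close>

lemma finite_singularities:
  assumes "h meromorphic_on UNIV"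
  shows "finite {z\<in>cball 0 R. \<not> h analytic_on {z}}"
proof -
  have "finite (cball 0 R \<inter> {z. \<not> h analytic_on {z}})"
    by (rule sparse_in_compact_finite)
       (auto intro: sparse_in_subset[OF meromorphic_on_imp_sparse_singularities[OF assms]])
  then show ?thesis by (simp add: Int_def)
qed

lemma finite_poles:
  assumes "h meromorphic_on UNIV"
  shows "finite {z\<in>cball 0 R. is_pole h z}"
  by (rule finite_subset[OF _ finite_singularities[OF assms, of R]])
     (auto dest: analytic_at_imp_no_pole)

lemma has_integral_inverse_from:
  fixes c r :: real
  assumes "0 < c" "c \<le> r"
  shows "((\<lambda>t. if c \<le> t then 1 / t else 0) has_integral ln (r / c)) {0..r}"
proof -
  have "((\<lambda>t. 1 / t) has_integral (ln r - ln c)) {c..r}"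
    by (rule fundamental_theorem_of_calculus)
       (use assms in \<open>auto intro!: derivative_eq_intros simp: has_real_derivative_iff_has_vector_derivative[symmetric]\<close>)
  then have "((\<lambda>t. if t \<in> {c..r} then 1 / t else 0) has_integral (ln r - ln c)) {0..r}"
    using assms by (subst has_integral_restrict) auto
  then have "((\<lambda>t. if c \<le> t then 1 / t else 0) has_integral (ln r - ln c)) {0..r}"
    by (rule has_integral_eq[rotated]) auto
  then show ?thesis using assms by (simp add: ln_div)
qed

text \<open>The index set on the right does not depend on \<open>t\<close>, which allows sum and
  integral to be interchanged.\<close>

lemma pole_count_eq_sum:
  assumes "h meromorphic_on UNIV" "t \<le> r"
  shows "real (pole_count h t) = (\<Sum>a\<in>{z\<in>cball 0 r. is_pole h z}. real (nat (- zorder h a)) * (if norm a \<le> t then 1 else (0::real)))"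
proof -
  have "(\<Sum>a\<in>{z\<in>cball 0 r. is_pole h z}. nat (- zorder h a) * (if norm a \<le> t then 1 else (0::real)))
    = (\<Sum>a\<in>{z\<in>cball 0 r. is_pole h z}. if norm a \<le> t then real (nat (- zorder h a)) else 0)"
    by (rule sum.cong) auto
  also have "\<dots> = (\<Sum>a\<in>{a\<in>{z\<in>cball 0 r. is_pole h z}. norm a \<le> t}. real (nat (- zorder h a)))"
    by (rule sum.inter_filter[symmetric]) (rule finite_poles[OF assms(1)])
  also have "{a\<in>{z\<in>cball 0 r. is_pole h z}. norm a \<le> t} = {z. z \<in> cball 0 t \<and> is_pole h z}"
    using assms(2) by auto
  finally show ?thesis by (simp add: pole_count_def)
qed

text \<open>A pole \<open>a\<close> other than 0 contributes a step function divided by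
  \<open>t\<close>, with integral \<open>ln (r / norm a)\<close>. A pole at the origin cancels in
  the integrand and returns through the term with \<open>ln r\<close>. In this form the counting
  function is comparable with Jensen's formula.\<close>

lemma pole_counting_fun_eq:
  assumes h: "h meromorphic_on UNIV" and r: "r > 0"
  shows "pole_counting_fun h r = (\<Sum>a\<in>{z\<in>cball 0 r. is_pole h z}. nat (- zorder h a) * jensen_weight r a)"
proof -
  define A where "A = {z\<in>cball 0 r. is_pole h z}"
  define m where "m = (\<lambda>a. real (nat (- zorder h a)))"
  have fin: "finite A" unfolding A_def by (rule finite_poles[OF h])
  have pc: "real (pole_count h t) = (\<Sum>a\<in>A. m a * (if norm a \<le> t then 1 else 0))" if "t \<le> r" for t
    using pole_count_eq_sum[OF h that] by (simp only: A_def m_def)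
  have integrand: "(real (pole_count h t) - real (pole_count h 0)) / t
      = (\<Sum>a\<in>A. if a = 0 then 0 else m a * (if norm a \<le> t then 1 / t else 0))" if "t \<in> {0..r}" for t
    using that r unfolding pc[of 0, OF less_imp_le[OF r]] sum_subtractf[symmetric] sum_divide_distrib
    by (subst pc) (auto simp: sum_subtractf[symmetric] sum_divide_distrib intro!: sum.cong)
  have "((\<lambda>t. \<Sum>a\<in>A. if a = 0 then 0 else m a * (if norm a \<le> t then 1 / t else 0)) has_integral
     (\<Sum>a\<in>A. if a = 0 then 0 else m a * ln (r / norm a))) {0..r}"
  proof (rule has_integral_sum[OF fin])
    fix a assume a: "a \<in> A"
    show "((\<lambda>t. if a = 0 then 0 else m a * (if norm a \<le> t then 1 / t else 0)) has_integral
       (if a = 0 then 0 else m a * ln (r / norm a))) {0..r}"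
    proof (cases "a = 0")
      case False
      then show ?thesis using a has_integral_mult_right[OF has_integral_inverse_from[of "norm a" r], of "m a"]
        by (simp add: A_def)
    qed simp
  qed
  then have "((\<lambda>t. (real (pole_count h t) - real (pole_count h 0)) / t) has_integral
     (\<Sum>a\<in>A. if a = 0 then 0 else m a * ln (r / norm a))) {0..r}"
    by (rule has_integral_eq[rotated]) (use integrand in simp)
  then have "integral {0..r} (\<lambda>t. (real (pole_count h t) - real (pole_count h 0)) / t)
     = (\<Sum>a\<in>A. if a = 0 then 0 else m a * ln (r / norm a))" by (rule integral_unique)
  moreover have "real (pole_count h 0) * ln r = (\<Sum>a\<in>A. if a = 0 then m a * ln r else 0)"
    unfolding pc[of 0, OF less_imp_le[OF r]] sum_distrib_right by (rule sum.cong) auto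
  ultimately have "pole_counting_fun h r = (\<Sum>a\<in>A. if a = 0 then 0 else m a * ln (r / norm a)) + (\<Sum>a\<in>A. if a = 0 then m a * ln r else 0)"
    by (simp add: pole_counting_fun_def)
  also have "\<dots> = (\<Sum>a\<in>A. m a * jensen_weight r a)"
    unfolding sum.distrib[symmetric] by (rule sum.cong) (auto simp: jensen_weight_def)
  finally show ?thesis by (simp only: A_def m_def)
qed

lemma pole_counting_fun_nonneg:
  assumes "h meromorphic_on UNIV" "r \<ge> 1"
  shows "pole_counting_fun h r \<ge> 0"
proof -
  have r: "r > 0" using assms by simp
  show ?thesis unfolding pole_counting_fun_eq[OF assms(1) r]
    by (intro sum_nonneg mult_nonneg_nonneg jensen_weight_nonneg) (use assms in auto)
qed

lemma proximity_fun_nonneg: "proximity_fun h r \<ge> 0"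
proof -
  \<comment> \<open>A non-integrable integrand has the default integral 0, so the inequality holds
    in that case too.\<close>
  have "integral {0..2*pi} (\<lambda>t. log_plus (norm (h (of_real r * cis t)))) \<ge> 0"
    by (cases "(\<lambda>t. log_plus (norm (h (of_real r * cis t)))) integrable_on {0..2*pi}")
       (auto intro: integral_nonneg simp: not_integrable_integral)
  then show ?thesis by (simp add: proximity_fun_def)
qed

lemma nevanlinna_char_nonneg:
  assumes "h meromorphic_on UNIV" "r \<ge> 1"
  shows "nevanlinna_char h r \<ge> 0"
  using pole_counting_fun_nonneg[OF assms] proximity_fun_nonneg[of h r] by (simp add: nevanlinna_char_def)

lemma proximity_le_nevanlinna_char:
  assumes "h meromorphic_on UNIV" "r \<ge> 1"
  shows "proximity_fun h r \<le> nevanlinna_char h r"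
  using pole_counting_fun_nonneg[OF assms] by (simp add: nevanlinna_char_def)

text \<open>A pole in the disc of radius \<open>R\<close> has Jensen weight at least
  \<open>ln 2\<close> with respect to radius \<open>2 * R\<close>. This is why the characteristic at
  \<open>2 * R\<close> enters the upper bound.\<close>

lemma pole_count_le_nevanlinna_char:
  assumes h: "h meromorphic_on UNIV" and R: "R \<ge> 1"
  shows "pole_count h R * ln 2 \<le> nevanlinna_char h (2 * R)"
proof -
  let ?A = "{z\<in>cball 0 R. is_pole h z}" and ?B = "{z\<in>cball 0 (2*R). is_pole h z}"
  have "pole_count h R * ln 2 = (\<Sum>a\<in>?A. nat (- zorder h a) * ln 2)"
    by (simp add: pole_count_def sum_distrib_right)
  also have "\<dots> \<le> (\<Sum>a\<in>?A. nat (- zorder h a) * jensen_weight (2*R) a)"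
  proof (intro sum_mono mult_left_mono)
    fix a assume "a \<in> ?A"
    then have a: "norm a \<le> R" by auto
    show "ln 2 \<le> jensen_weight (2*R) a"
    proof (cases "a = 0")
      case True then show ?thesis using R by (simp add: jensen_weight_def)
    next
      case False
      have "2 \<le> 2 * R / norm a" using a False by (simp add: le_divide_eq)
      then show ?thesis using False by (simp add: jensen_weight_def)
    qed
  qed auto
  also have "\<dots> \<le> (\<Sum>a\<in>?B. nat (- zorder h a) * jensen_weight (2*R) a)"
  proof (rule sum_mono2[OF finite_poles[OF h]])
    show "?A \<subseteq> ?B" using R by auto
    fix a assume "a \<in> ?B - ?A"
    then have "0 \<le> jensen_weight (2*R) a" using R by (intro jensen_weight_nonneg) auto
    then show "0 \<le> real (nat (- zorder h a)) * jensen_weight (2*R) a" by simp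
  qed
  also have "\<dots> = pole_counting_fun h (2*R)" using R by (intro pole_counting_fun_eq[OF h, symmetric]) simp
  also have "\<dots> \<le> nevanlinna_char h (2*R)" using proximity_fun_nonneg[of h "2*R"] by (simp add: nevanlinna_char_def)
  finally show ?thesis .
qed

lemma pole_counting_fun_no_poles:
  assumes "h meromorphic_on UNIV" "r > 0" "\<And>z. \<not> is_pole h z"
  shows "pole_counting_fun h r = 0"
  using pole_counting_fun_eq[OF assms(1,2)] assms(3) by simp

lemma entire_meromorphic: "u holomorphic_on UNIV \<Longrightarrow> u meromorphic_on UNIV"
  by (intro analytic_on_imp_meromorphic_on) (simp add: analytic_on_open)

lemma nevanlinna_char_entire:
  assumes "u holomorphic_on UNIV" "r > 0"
  shows "nevanlinna_char u r = proximity_fun u r"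
proof -
  have "\<not> is_pole u z" for z using assms(1) by (meson UNIV_I not_is_pole_holomorphic open_UNIV)
  then show ?thesis using pole_counting_fun_no_poles[OF entire_meromorphic[OF assms(1)] assms(2)]
    by (simp add: nevanlinna_char_def)
qed

text \<open>The Weierstrass factorization is applied to \<open>remove_sings h\<close>, since the
  values of \<open>h\<close> at its singularities are arbitrary; the equation with the quotient is
  therefore restricted to points of analyticity.\<close>

lemma meromorphic_quotient_representation:
  assumes h: "h meromorphic_on UNIV"
  obtains F D :: "complex \<Rightarrow> complex" where "F holomorphic_on UNIV" "D holomorphic_on UNIV"
    "\<And>z. D z = 0 \<longleftrightarrow> is_pole h z" "\<And>z. is_pole h z \<Longrightarrow> zorder D z = - zorder h z"
    "\<And>z. h analytic_on {z} \<Longrightarrow> h z = F z / D z"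
proof -
  have nm: "remove_sings h nicely_meromorphic_on UNIV"
    by (rule remove_sings_nicely_meromorphic[OF h])
  obtain H f1 f2 where H: "H holomorphic_on UNIV" "f1 holomorphic_on UNIV" "f2 holomorphic_on UNIV"
    "\<forall>z. f1 z = 0 \<longleftrightarrow> \<not>is_pole (remove_sings h) z \<and> remove_sings h z = 0"
    "\<forall>z. f2 z = 0 \<longleftrightarrow> is_pole (remove_sings h) z"
    "\<forall>z. \<not>is_pole (remove_sings h) z \<longrightarrow> zorder f1 z = zorder (remove_sings h) z"
    "\<forall>z. is_pole (remove_sings h) z \<longrightarrow> zorder f2 z = -zorder (remove_sings h) z"
    "\<forall>z. H z \<noteq> 0"
    "\<forall>z. remove_sings h z = H z * f1 z / f2 z"
    by (rule weierstrass_factorization_meromorphic_UNIV[OF nm])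
  have iso: "isolated_singularity_at h z" for z
    using h by (meson UNIV_I meromorphic_on_altdef)
  show ?thesis
  proof
    show "(\<lambda>z. H z * f1 z) holomorphic_on UNIV" using H by (intro holomorphic_intros)
    show "f2 holomorphic_on UNIV" by fact
    show "f2 z = 0 \<longleftrightarrow> is_pole h z" for z using H(5) iso by simp
    show "zorder f2 z = - zorder h z" if "is_pole h z" for z using H(7) iso that by simp
    show "h z = H z * f1 z / f2 z" if "h analytic_on {z}" for z
      using H(9) that by (metis remove_sings_at_analytic)
  qed
qed

section \<open>Composition with an entire function\<close>

lemma log_plus_mult_le:
  assumes "x \<ge> 0" "y \<ge> 0"
  shows "log_plus (x * y) \<le> log_plus x + log_plus y"
  using assms by (cases "x = 0 \<or> y = 0") (auto simp: log_plus_def ln_mult intro: add_mono)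

text \<open>Pointwise form of the first fundamental theorem; Jensen's formula supplies the mean of
  the term \<open>ln x\<close>.\<close>

lemma log_plus_inverse: "x > 0 \<Longrightarrow> log_plus (inverse x) = log_plus x - ln x"
  by (simp add: log_plus_def ln_inverse max_def)

lemma log_plus_le_ln:
  assumes "0 \<le> x" "x \<le> y" "1 \<le> y"
  shows "log_plus x \<le> ln y"
  using assms by (cases "x = 0") (auto simp: log_plus_def)

lemma filterlim_at_entire:
  assumes g: "g holomorphic_on UNIV" "\<not> g constant_on (UNIV :: complex set)"
  shows "filterlim g (at (g a)) (at a)"
proof -
  obtain y where "g y \<noteq> g a" using g(2) by (auto simp: constant_on_def)
  then have "eventually (\<lambda>z. g z - g a \<noteq> 0) (at a)"
    using g(1) by (intro entire_not_identically_zero_eventually[of _ y]) (auto intro!: holomorphic_intros)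
  then have ev: "eventually (\<lambda>z. g z \<noteq> g a) (at a)" by simp
  have "isCont g a" by (rule entire_isCont[OF g(1)])
  then show ?thesis using ev by (auto simp: filterlim_at isCont_def)
qed

text \<open>The singularities of \<open>f\<close> are isolated, and the non-constant
  \<open>g\<close> takes the value \<open>g a\<close> only at isolated points.\<close>

lemma eventually_analytic_comp:
  assumes f: "f meromorphic_on UNIV" and g: "g holomorphic_on UNIV" "\<not> g constant_on (UNIV :: complex set)"
  shows "eventually (\<lambda>z. f analytic_on {g z}) (at a)"
proof -
  have "eventually (\<lambda>w. f analytic_on {w}) (at (g a))"
    using f by (auto simp: meromorphic_on_altdef intro: isolated_singularity_at_altdef[THEN iffD1])
  then show ?thesis
    by (rule eventually_compose_filterlim[OF _ filterlim_at_entire[OF g]])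
qed

lemma finite_comp_singularities:
  assumes f: "f meromorphic_on UNIV" and g: "g holomorphic_on UNIV" "\<not> g constant_on (UNIV :: complex set)"
  shows "finite {z\<in>cball 0 r. \<not> f analytic_on {g z}}"
proof -
  have "\<not> z islimpt {z. \<not> f analytic_on {g z}}" for z
    using eventually_analytic_comp[OF assms, of z] by (simp add: islimpt_iff_eventually)
  then have "{z. \<not> f analytic_on {g z}} sparse_in cball 0 r"
    by (auto simp: sparse_in_def)
  then have "finite (cball 0 r \<inter> {z. \<not> f analytic_on {g z}})"
    by (intro sparse_in_compact_finite) auto
  then show ?thesis by (simp add: Int_def)
qed

lemma comp_meromorphic:
  assumes "f meromorphic_on UNIV" "g holomorphic_on UNIV"
  shows "(f \<circ> g) meromorphic_on UNIV"
  unfolding o_def using assms by (intro meromorphic_on_compose[of f UNIV g UNIV]) (auto simp: analytic_on_open)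

lemma analytic_comp:
  assumes "f analytic_on {g z}" "g holomorphic_on UNIV"
  shows "(f \<circ> g) analytic_on {z}"
  using assms by (intro analytic_on_compose) (auto simp: analytic_on_holomorphic)

text \<open>
  Let \<open>P\<close> be the polynomial whose zeros are the poles of \<open>f\<close> in the disc of radius \<open>R\<close>, and
  \<open>E = f P\<close>. Since \<open>log\<^sup>+ |f \<circ> g| \<le> log\<^sup>+ |E \<circ> g| + log\<^sup>+ |P \<circ> g| - ln |P \<circ> g|\<close>, Jensen's formula for
  \<open>P \<circ> g\<close> cancels the counting function of \<open>f \<circ> g\<close>.
\<close>
lemma nevanlinna_char_comp_le_core:
  fixes f g F D :: "complex \<Rightarrow> complex"
  assumes f: "f meromorphic_on UNIV" and g: "g holomorphic_on UNIV" "\<not> g constant_on UNIV"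
    and F: "F holomorphic_on UNIV" and D: "D holomorphic_on UNIV"
    and D0: "\<And>z. D z = 0 \<longleftrightarrow> is_pole f z" and Dord: "\<And>z. is_pole f z \<Longrightarrow> zorder D z = - zorder f z"
    and fFD: "\<And>z. f analytic_on {z} \<Longrightarrow> f z = F z / D z"
    and R: "R \<ge> 1" and FR: "\<And>w. norm w = R \<Longrightarrow> F w \<noteq> 0" and fR: "\<And>w. norm w = R \<Longrightarrow> f analytic_on {w}"
    and r: "r \<ge> 1" and gr: "\<And>z. norm z \<le> r \<Longrightarrow> norm (g z) \<le> R / 2" and fg: "\<And>z. norm z = r \<Longrightarrow> f analytic_on {g z}"
    and \<delta>: "0 < \<delta>" "\<And>b. is_pole f b \<Longrightarrow> \<exists>k V. V holomorphic_on UNIV \<and> \<delta> \<le> norm (V 0) \<and> (\<forall>z. g z - b = z ^ k * V z)"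
  shows "nevanlinna_char (f \<circ> g) r \<le> 3 * proximity_fun f R + (4 * ln (2 * R) - ln \<delta>) * pole_count f R"
proof -
  have R0: "R > 0" and r0: "r > 0" using R r by auto
  define B where "B = {z\<in>cball 0 R. D z = 0}"
  define m where "m = (\<lambda>b. nat (zorder D b))"
  define n where "n = (\<Sum>b\<in>B. m b)"
  define P where "P = (\<lambda>w. \<Prod>b\<in>B. (w - b) ^ m b)"
  have "f analytic_on {of_real R}" using fR[of "of_real R"] R by simp
  then have DR: "D (of_real R) \<noteq> 0" using D0 analytic_at_imp_no_pole by blast
  obtain D1 where D1: "D1 holomorphic_on UNIV" "\<And>z. D z = P z * D1 z" "\<And>z. z \<in> cball 0 R \<Longrightarrow> D1 z \<noteq> 0"
    using entire_zero_factorization[OF D DR B_def] unfolding P_def m_def by metis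
  have finB: "finite B" unfolding B_def by (rule entire_finite_zeros[OF D DR])
  have P: "P holomorphic_on UNIV" unfolding P_def by (intro holomorphic_intros)
  have BR: "norm b \<le> R" if "b \<in> B" for b using that by (auto simp: B_def)
  have Bpole: "is_pole f b" if "b \<in> B" for b using that D0 by (auto simp: B_def)
  have "n = pole_count f R"
    unfolding n_def pole_count_def m_def
    by (rule sum.cong) (auto simp: B_def D0 Dord)
  then have n: "real n = real (pole_count f R)" by simp
  \<comment> \<open>Where \<open>f\<close> is analytic this is \<open>f P\<close>, but as a quotient
    by \<open>D1\<close>, which has no zeros in the closed disc, it is holomorphic on all of that
    disc.\<close>
  define E where "E = (\<lambda>w. F w / D1 w)"
  have P0: "P w = 0 \<Longrightarrow> w \<in> B" for w using finB by (auto simp: P_def)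
  have fE: "f w * P w = E w" and fE': "f w = E w / P w" and Pw: "P w \<noteq> 0" if "f analytic_on {w}" for w
  proof -
    have "D w \<noteq> 0" using that D0 analytic_at_imp_no_pole by blast
    then show "P w \<noteq> 0" using D1(2)[of w] by auto
    then show "f w * P w = E w" "f w = E w / P w" using fFD[OF that] unfolding E_def D1(2)[of w] by auto
  qed

  have P_le: "log_plus (norm (P w)) \<le> n * ln (2 * R)" if "norm w \<le> R" for w
  proof -
    have "norm (P w) = (\<Prod>b\<in>B. norm (w - b) ^ m b)" by (simp add: P_def prod_norm[symmetric] norm_power)
    also have "\<dots> \<le> (\<Prod>b\<in>B. (2 * R) ^ m b)"
    proof (intro prod_mono conjI power_mono)
      fix b assume "b \<in> B"
      show "norm (w - b) \<le> 2 * R" using norm_triangle_ineq4[of w b] BR[OF \<open>b \<in> B\<close>] that by linarith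
    qed auto
    also have "\<dots> = (2 * R) ^ n" by (simp add: n_def power_sum)
    finally have "log_plus (norm (P w)) \<le> ln ((2 * R) ^ n)"
      using R by (intro log_plus_le_ln one_le_power) auto
    then show ?thesis by (simp only: ln_realpow)
  qed

  have E_le: "log_plus (norm (E w)) \<le> 3 * proximity_fun E R" if "norm w \<le> R / 2" for w
  proof -
    have "log_plus (norm (E w)) \<le> (R + norm w) / (R - norm w) * proximity_fun E R"
      unfolding E_def by (rule log_plus_quotient_le_proximity[OF F FR D1(1)]) (use D1(3) that R in auto)
    also have "(R + norm w) / (R - norm w) \<le> 3" using that R by (simp add: divide_simps)
    then have "(R + norm w) / (R - norm w) * proximity_fun E R \<le> 3 * proximity_fun E R"
      by (intro mult_right_mono proximity_fun_nonneg)
    finally show ?thesis .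
  qed

  have contP: "continuous_on S P" and contE: "continuous_on (cball 0 R) E" for S
    using P D1 F unfolding E_def
    by (auto intro!: continuous_intros intro: holomorphic_on_imp_continuous_on holomorphic_on_subset)
  have contf: "continuous_on (sphere 0 R) f"
    using fR by (intro analytic_imp_holomorphic[THEN holomorphic_on_imp_continuous_on]) (auto simp: analytic_on_analytic_at[of _ "sphere 0 R"])
  have contE': "continuous_on (sphere 0 R) E" by (rule continuous_on_subset[OF contE]) auto
  have "proximity_fun E R \<le> circle_mean (\<lambda>w. log_plus (norm (f w)) + n * ln (2 * R)) R"
    unfolding proximity_fun_eq_circle_mean
  proof (intro circle_mean_mono)
    fix w :: complex assume w: "norm w = R"
    have "log_plus (norm (E w)) = log_plus (norm (f w) * norm (P w))"
      unfolding fE[OF fR[OF w], symmetric] norm_mult ..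
    also have "\<dots> \<le> log_plus (norm (f w)) + log_plus (norm (P w))" by (intro log_plus_mult_le) auto
    finally show "log_plus (norm (E w)) \<le> log_plus (norm (f w)) + n * ln (2 * R)"
      using P_le[of w] w by simp
  qed (use R0 in \<open>auto intro!: continuous_intros continuous_on_log_plus_norm contf contE'\<close>)
  also have "\<dots> = proximity_fun f R + n * ln (2 * R)"
    unfolding proximity_fun_eq_circle_mean
    by (subst circle_mean_add) (use R0 in \<open>auto intro!: continuous_intros continuous_on_log_plus_norm contf\<close>)
  finally have proxE: "proximity_fun E R \<le> proximity_fun f R + n * ln (2 * R)" .

  define k where "k = (\<lambda>z. P (g z))"
  have k: "k holomorphic_on UNIV"
    unfolding k_def using holomorphic_on_compose[OF g(1) holomorphic_on_subset[OF P]] by (simp add: o_def)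
  have k_nz: "k z \<noteq> 0" if "norm z = r" for z using Pw[OF fg[OF that]] by (simp add: k_def)
  have contfg: "continuous_on (sphere 0 r) (f \<circ> g)"
    using analytic_comp[OF fg g(1)]
    by (intro analytic_imp_holomorphic[THEN holomorphic_on_imp_continuous_on]) (auto simp: analytic_on_analytic_at[of _ "sphere 0 r"])
  have contk: "continuous_on S k" for S using k holomorphic_on_imp_continuous_on holomorphic_on_subset by blast
  \<comment> \<open>The first summand is three times the bound for \<open>proximity_fun E R\<close>
    obtained above, the second the bound for the positive logarithm of
    \<open>P \<circ> g\<close>.\<close>
  define c where "c = 3 * (proximity_fun f R + n * ln (2 * R)) + n * ln (2 * R)"
  have "proximity_fun (f \<circ> g) r \<le> circle_mean (\<lambda>z. c - ln (norm (k z))) r"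
    unfolding proximity_fun_eq_circle_mean
  proof (intro circle_mean_mono)
    fix z :: complex assume z: "norm z = r"
    have gz: "norm (g z) \<le> R / 2" using gr z by simp
    have kz: "norm (k z) > 0" using k_nz[OF z] by simp
    have "log_plus (norm ((f \<circ> g) z)) = log_plus (norm (E (g z)) * inverse (norm (k z)))"
      using fE'[OF fg[OF z]] by (simp add: k_def norm_mult norm_inverse divide_inverse)
    also have "\<dots> \<le> log_plus (norm (E (g z))) + log_plus (inverse (norm (k z)))"
      by (intro log_plus_mult_le) auto
    also have "\<dots> = log_plus (norm (E (g z))) + log_plus (norm (k z)) - ln (norm (k z))"
      using log_plus_inverse[OF kz] by simp
    also have "\<dots> \<le> 3 * proximity_fun E R + n * ln (2 * R) - ln (norm (k z))"
      using E_le[OF gz] P_le[of "g z"] gz R unfolding k_def by auto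
    also have "\<dots> \<le> c - ln (norm (k z))" unfolding c_def using proxE by simp
    finally show "log_plus (norm ((f \<circ> g) z)) \<le> c - ln (norm (k z))" .
  qed (use r0 k_nz in \<open>auto intro!: continuous_on_diff continuous_on_const continuous_on_log_plus_norm continuous_on_ln_norm contfg[unfolded o_def] contk\<close>)
  also have "\<dots> = c - circle_mean (\<lambda>z. ln (norm (k z))) r"
    by (subst circle_mean_diff) (use r0 k_nz in \<open>auto intro!: continuous_on_const continuous_on_ln_norm contk\<close>)
  finally have prox: "proximity_fun (f \<circ> g) r \<le> c - circle_mean (\<lambda>z. ln (norm (k z))) r" .

  have "\<forall>b\<in>B. \<exists>kV. snd kV holomorphic_on UNIV \<and> \<delta> \<le> norm (snd kV 0) \<and> (\<forall>z. g z - b = z ^ fst kV * snd kV z)"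
    using \<delta>(2)[OF Bpole] by (metis fst_conv snd_conv)
  then obtain kV where kV: "\<forall>b\<in>B. snd (kV b) holomorphic_on UNIV \<and> \<delta> \<le> norm (snd (kV b) 0) \<and> (\<forall>z. g z - b = z ^ fst (kV b) * snd (kV b) z)"
    by (rule bchoice[THEN exE])
  \<comment> \<open>\<open>V 0\<close> is the leading coefficient of \<open>k\<close> at 0. Each of
    its \<open>n\<close> factors, counted with multiplicity, has modulus at least
    \<open>\<delta>\<close>.\<close>
  define V where "V = (\<lambda>z. \<Prod>b\<in>B. snd (kV b) z ^ m b)"
  have V: "V holomorphic_on UNIV" unfolding V_def using kV by (intro holomorphic_intros) auto
  have kV_eq: "k z = z ^ (\<Sum>b\<in>B. fst (kV b) * m b) * V z" for z
  proof -
    have "k z = (\<Prod>b\<in>B. (z ^ fst (kV b) * snd (kV b) z) ^ m b)"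
      unfolding k_def P_def by (rule prod.cong) (use kV in auto)
    then show ?thesis by (simp add: V_def power_mult_distrib prod.distrib power_sum power_mult)
  qed
  have "ln (norm (V 0)) = ln (\<Prod>b\<in>B. norm (snd (kV b) 0) ^ m b)" by (simp add: V_def prod_norm[symmetric] norm_power)
  also have "\<dots> = (\<Sum>b\<in>B. ln (norm (snd (kV b) 0) ^ m b))"
  proof (rule ln_prod[OF finB])
    fix b assume "b \<in> B"
    then have "norm (snd (kV b) 0) > 0" using kV \<delta>(1) by fastforce
    then show "norm (snd (kV b) 0) ^ m b \<noteq> 0" by simp
  qed
  also have "\<dots> = (\<Sum>b\<in>B. m b * ln (norm (snd (kV b) 0)))" by (simp add: ln_realpow)
  also have "\<dots> \<ge> (\<Sum>b\<in>B. m b * ln \<delta>)"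
    using kV \<delta>(1) by (intro sum_mono mult_left_mono ln_mono) auto
  finally have lnV: "ln (norm (V 0)) \<ge> n * ln \<delta>" by (simp add: n_def sum_distrib_right)
  have V0: "V 0 \<noteq> 0"
    unfolding V_def using kV \<delta>(1) finB by (auto simp: prod_zero_iff)

  let ?A = "{z\<in>cball 0 r. is_pole (f \<circ> g) z}"
  have fgm: "(f \<circ> g) meromorphic_on UNIV" by (rule comp_meromorphic[OF f g(1)])
  have Aball: "?A \<subseteq> ball 0 r"
  proof
    fix z assume z: "z \<in> ?A"
    then have "norm z \<noteq> r" using analytic_at_imp_no_pole[OF analytic_comp[OF fg g(1)]] by auto
    then show "z \<in> ball 0 r" using z by auto
  qed
  \<comment> \<open>Near \<open>a\<close> the composition is the quotient of the analytic functions
    \<open>Eg\<close> and \<open>k\<close>. A pole must come from a zero of \<open>k\<close>, and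
    its order is at most the order of that zero.\<close>
  have ord: "int (nat (- zorder (f \<circ> g) a)) \<le> zorder k a \<and> k a = 0" if a: "a \<in> ?A" for a
  proof -
    have pole: "is_pole (f \<circ> g) a" and na: "norm a \<le> r" using a by auto
    define Eg where "Eg = (\<lambda>z. E (g z))"
    have Eana: "E analytic_on {g a}" unfolding E_def
      using D1 F gr[OF na] R by (intro analytic_intros) (auto simp: analytic_on_holomorphic)
    have Ega: "Eg analytic_on {a}" unfolding Eg_def
      using analytic_comp[OF Eana g(1)] by (simp add: o_def)
    have ka: "k analytic_on {a}" using k by (auto simp: analytic_on_holomorphic)
    have ev: "eventually (\<lambda>z. (f \<circ> g) z = Eg z / k z) (at a)"
      using eventually_analytic_comp[OF f g, of a]
      by eventually_elim (use fE' in \<open>simp add: Eg_def k_def\<close>)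
    have pole': "is_pole (\<lambda>z. Eg z / k z) a" using pole is_pole_cong[OF ev refl] by simp
    have k0: "k a = 0"
    proof (rule ccontr)
      assume "k a \<noteq> 0"
      then have "(\<lambda>z. Eg z / k z) analytic_on {a}" by (intro analytic_intros Ega ka) auto
      then show False using pole' analytic_at_imp_no_pole by blast
    qed
    have "eventually (\<lambda>z. Eg z / k z \<noteq> 0) (at a)"
      using pole' non_zero_neighbour_pole by blast
    then have fr: "\<exists>\<^sub>F z in at a. Eg z \<noteq> 0" "\<exists>\<^sub>F z in at a. k z \<noteq> 0"
      by (auto intro!: eventually_frequently elim!: eventually_mono)
    have "zorder (f \<circ> g) a = zorder (\<lambda>z. Eg z / k z) a" by (rule zorder_cong[OF ev refl])
    also have "\<dots> = zorder Eg a - zorder k a"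
      by (intro zorder_divide analytic_on_imp_meromorphic_on Ega ka fr)
    finally have "zorder (f \<circ> g) a = zorder Eg a - zorder k a" .
    moreover have "zorder Eg a \<ge> 0" "zorder k a \<ge> 0" using zorder_ge_0 Ega ka fr by auto
    ultimately show ?thesis using k0 by simp
  qed
  have "(\<Sum>a\<in>?A. nat (- zorder (f \<circ> g) a) * jensen_weight r a) + ln (norm (V 0)) \<le> circle_mean (\<lambda>z. ln (norm (k z))) r"
    using jensen_lower_bound[OF k k_nz r V V0 kV_eq Aball, of "\<lambda>a. nat (- zorder (f \<circ> g) a)"] ord by blast
  then have "pole_counting_fun (f \<circ> g) r \<le> circle_mean (\<lambda>z. ln (norm (k z))) r - n * ln \<delta>"
    unfolding pole_counting_fun_eq[OF fgm r0] using lnV by linarith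
  then have "nevanlinna_char (f \<circ> g) r \<le> c - n * ln \<delta>"
    using prox unfolding nevanlinna_char_def by linarith
  also have "c - n * ln \<delta> = 3 * proximity_fun f R + (4 * ln (2 * R) - ln \<delta>) * n"
    by (simp add: c_def algebra_simps)
  finally show ?thesis using n by simp
qed

text \<open>The bound has to be uniform in \<open>b\<close>, since more and more poles come into
  play as the radius grows. For \<open>b\<close> different from \<open>g 0\<close> one takes
  \<open>k = 0\<close> and \<open>V = g - b\<close>, and the distance of \<open>b\<close> from
  \<open>g 0\<close> is bounded below because the singularities of \<open>f\<close> do not
  accumulate at \<open>g 0\<close>. The value \<open>b = g 0\<close> adds a single leading
  factor.\<close>

lemma pole_value_leading_factor_bound:
  fixes f g :: "complex \<Rightarrow> complex"
  assumes f: "f meromorphic_on UNIV" and g: "g holomorphic_on UNIV" "\<not> g constant_on UNIV"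
  obtains \<delta> :: real where "\<delta> > 0"
    "\<And>b. is_pole f b \<Longrightarrow> \<exists>k V. V holomorphic_on UNIV \<and> \<delta> \<le> norm (V 0) \<and> (\<forall>z. g z - b = z ^ k * V z)"
proof -
  have "eventually (\<lambda>w. f analytic_on {w}) (at (g 0))"
    using f by (auto simp: meromorphic_on_altdef intro: isolated_singularity_at_altdef[THEN iffD1])
  then obtain d where d: "d > 0" "\<And>w. w \<noteq> g 0 \<Longrightarrow> dist w (g 0) < d \<Longrightarrow> f analytic_on {w}"
    by (auto simp: eventually_at)
  obtain y where y: "g y - g 0 \<noteq> 0" using g(2) by (auto simp: constant_on_def)
  have "(\<lambda>z. g z - g 0) holomorphic_on UNIV" using g(1) by (intro holomorphic_intros)
  then obtain k V where V: "V holomorphic_on UNIV" "V 0 \<noteq> 0" "\<And>z. g z - g 0 = z ^ k * V z"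
    using entire_leading_factor[of "\<lambda>z. g z - g 0", OF _ y] by blast
  show ?thesis
  proof (rule that[of "min d (norm (V 0))"])
    fix b assume b: "is_pole f b"
    show "\<exists>k V'. V' holomorphic_on UNIV \<and> min d (norm (V 0)) \<le> norm (V' 0) \<and> (\<forall>z. g z - b = z ^ k * V' z)"
    proof (cases "b = g 0")
      case True
      then show ?thesis using V by (intro exI[of _ k] exI[of _ V]) auto
    next
      case False
      then have "\<not> dist b (g 0) < d" using d(2) b analytic_at_imp_no_pole by blast
      then show ?thesis using g(1)
        by (intro exI[of _ 0] exI[of _ "\<lambda>z. g z - b"]) (auto intro!: holomorphic_intros simp: dist_norm norm_minus_commute)
    qed
  qed (use d V in auto)
qed

text \<open>\<open>R\<close> is chosen off the moduli of the zeros of \<open>F\<close> and of the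
  singularities of \<open>f\<close>. From \<open>R \<ge> 2 * M\<close> the values of
  \<open>g\<close> lie in the half disc, where the Harnack quotient is at most 3. The exceptional
  radii are the moduli of points that \<open>g\<close> maps to a singularity of
  \<open>f\<close>.\<close>

lemma nevanlinna_char_comp_le:
  fixes f g :: "complex \<Rightarrow> complex"
  assumes f: "f meromorphic_on UNIV" and g: "g holomorphic_on UNIV" "\<not> g constant_on UNIV"
  obtains C :: real where "C \<ge> 0"
    "\<And>t M. M \<ge> 1 \<Longrightarrow> (\<And>z. norm z \<le> t \<Longrightarrow> norm (g z) \<le> M) \<Longrightarrow>
       \<exists>R\<in>{2*M..4*M}. finite {r\<in>{1..t}. \<not> nevanlinna_char (f \<circ> g) r
           \<le> C * (1 + ln R) * (nevanlinna_char f R + nevanlinna_char f (2 * R))}"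
proof -
  obtain F D where FD: "F holomorphic_on UNIV" "D holomorphic_on UNIV"
    "\<And>z. D z = 0 \<longleftrightarrow> is_pole f z" "\<And>z. is_pole f z \<Longrightarrow> zorder D z = - zorder f z"
    "\<And>z. f analytic_on {z} \<Longrightarrow> f z = F z / D z"
    using meromorphic_quotient_representation[OF f] by metis
  obtain \<delta> where \<delta>: "\<delta> > 0"
    "\<And>b. is_pole f b \<Longrightarrow> \<exists>k V. V holomorphic_on UNIV \<and> \<delta> \<le> norm (V 0) \<and> (\<forall>z. g z - b = z ^ k * V z)"
    using pole_value_leading_factor_bound[OF f g] by metis
  define c0 where "c0 = max 0 (- ln \<delta>)"
  \<comment> \<open>The 3 covers the proximity term. The other summand comes from
    \<open>4 * ln (2 * R) - ln \<delta> \<le> (4 + c0) * (1 + ln R)\<close> and from the division by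
    \<open>ln 2\<close> in the bound of the pole count.\<close>
  define C where "C = 3 + (4 + c0) / ln 2"
  have c0: "c0 \<ge> 0" "- ln \<delta> \<le> c0" by (auto simp: c0_def)
  have C: "C \<ge> 3" using c0 by (simp add: C_def)
  have fgm: "(f \<circ> g) meromorphic_on UNIV" by (rule comp_meromorphic[OF f g(1)])
  show ?thesis
  proof (rule that[of C])
    show "C \<ge> 0" using C by simp
    fix t M :: real
    assume M: "M \<ge> 1" and gM: "\<And>z. norm z \<le> t \<Longrightarrow> norm (g z) \<le> M"
    let ?S = "norm ` {z\<in>cball 0 t. \<not> f analytic_on {g z}}"
    have finS: "finite ?S" using finite_comp_singularities[OF f g] by blast
    show "\<exists>R\<in>{2*M..4*M}. finite {r\<in>{1..t}. \<not> nevanlinna_char (f \<circ> g) r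
           \<le> C * (1 + ln R) * (nevanlinna_char f R + nevanlinna_char f (2 * R))}"
    proof (cases "\<forall>z. F z = 0")
      \<comment> \<open>No circle avoids the zeros of \<open>F = 0\<close>. Here
        \<open>f \<circ> g\<close> vanishes off the singularities, so its characteristic is 0 at all
        other radii, and \<open>R = 2 * M\<close> will do.\<close>
      case True
      have "nevanlinna_char (f \<circ> g) r \<le> C * (1 + ln (2*M)) * (nevanlinna_char f (2*M) + nevanlinna_char f (2 * (2*M)))"
        if r: "r \<in> {1..t} - ?S" for r
      proof -
        have an: "f analytic_on {g z}" if "norm z = r" for z
          using r that by force
        have z0: "(f \<circ> g) z = 0" if "f analytic_on {g z}" for z
          using FD(5)[OF that] True by simp
        have "proximity_fun (f \<circ> g) r = circle_mean (\<lambda>z. 0) r"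
          unfolding proximity_fun_eq_circle_mean circle_mean_def
          using z0 an r by (intro arg_cong2[where f="(/)"] refl Henstock_Kurzweil_Integration.integral_cong)
             (auto simp: norm_mult log_plus_def)
        moreover have "\<not> is_pole (f \<circ> g) a" for a
        proof
          assume "is_pole (f \<circ> g) a"
          then have "eventually (\<lambda>z. (f \<circ> g) z \<noteq> 0) (at a)" by (rule non_zero_neighbour_pole)
          with eventually_analytic_comp[OF f g, of a] have "eventually (\<lambda>z. False) (at a)"
            by eventually_elim (use z0 in auto)
          then show False by simp
        qed
        ultimately have "nevanlinna_char (f \<circ> g) r = 0"
          using pole_counting_fun_no_poles[OF fgm, of r] r by (auto simp: nevanlinna_char_def)
        moreover have "0 \<le> C * (1 + ln (2*M)) * (nevanlinna_char f (2*M) + nevanlinna_char f (2 * (2*M)))"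
          using C M by (intro mult_nonneg_nonneg add_nonneg_nonneg nevanlinna_char_nonneg[OF f] ln_ge_zero) auto
        ultimately show ?thesis by simp
      qed
      then have "{r\<in>{1..t}. \<not> nevanlinna_char (f \<circ> g) r
           \<le> C * (1 + ln (2*M)) * (nevanlinna_char f (2*M) + nevanlinna_char f (2 * (2*M)))} \<subseteq> ?S" by blast
      then show ?thesis using finS finite_subset M by (intro bexI[of _ "2*M"]) auto
    next
      case False
      then obtain y where y: "F y \<noteq> 0" by blast
      let ?X = "norm ` ({z\<in>cball 0 (4*M). F z = 0} \<union> {z\<in>cball 0 (4*M). \<not> f analytic_on {z}})"
      have "finite ?X" using entire_finite_zeros[OF FD(1) y] finite_singularities[OF f] by blast
      moreover have "infinite {2*M<..<4*M}" using M by (simp add: infinite_Ioo)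
      ultimately obtain R where R: "R \<in> {2*M<..<4*M}" "R \<notin> ?X"
        by (meson finite_subset subsetI)
      have FR: "F w \<noteq> 0" and fR: "f analytic_on {w}" if "norm w = R" for w
        using R that by force+
      have R1: "R \<ge> 1" using R M by auto
      have "nevanlinna_char (f \<circ> g) r \<le> C * (1 + ln R) * (nevanlinna_char f R + nevanlinna_char f (2 * R))"
        if r: "r \<in> {1..t} - ?S" for r
      proof -
        have an: "f analytic_on {g z}" if "norm z = r" for z
          using r that by force
        have gr: "norm (g z) \<le> R / 2" if "norm z \<le> r" for z
          using gM[of z] that r R by auto
        have "nevanlinna_char (f \<circ> g) r \<le> 3 * proximity_fun f R + (4 * ln (2 * R) - ln \<delta>) * pole_count f R"
          by (rule nevanlinna_char_comp_le_core[OF f g FD R1 FR fR _ gr an \<delta>]) (use r in auto)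
        also have "\<dots> \<le> 3 * nevanlinna_char f R + (4 + c0) * (1 + ln R) * (nevanlinna_char f (2 * R) / ln 2)"
        proof (intro add_mono mult_mono)
          show "proximity_fun f R \<le> nevanlinna_char f R" by (rule proximity_le_nevanlinna_char[OF f R1])
          have "ln (2::real) \<le> 1" using ln_le_minus_one[of "2::real"] by simp
          then have "4 * ln (2 * R) - ln \<delta> \<le> 4 * (1 + ln R) + c0 * 1"
            using R1 c0 by (simp add: ln_mult)
          also have "\<dots> \<le> 4 * (1 + ln R) + c0 * (1 + ln R)" using c0 R1 by (intro add_mono mult_left_mono) auto
          finally show "4 * ln (2 * R) - ln \<delta> \<le> (4 + c0) * (1 + ln R)" by (simp add: algebra_simps)
          show "real (pole_count f R) \<le> nevanlinna_char f (2 * R) / ln 2"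
            using pole_count_le_nevanlinna_char[OF f R1] by (simp add: le_divide_eq)
          show "0 \<le> (4 + c0) * (1 + ln R)" using c0 R1 by (intro mult_nonneg_nonneg) auto
        qed (auto simp: proximity_fun_nonneg)
        also have "\<dots> \<le> C * (1 + ln R) * nevanlinna_char f R + C * (1 + ln R) * nevanlinna_char f (2 * R)"
        proof (intro add_mono)
          have "3 * 1 \<le> C * (1 + ln R)" using C R1 by (intro mult_mono) auto
          then show "3 * nevanlinna_char f R \<le> C * (1 + ln R) * nevanlinna_char f R"
            using nevanlinna_char_nonneg[OF f R1] by (intro mult_right_mono) auto
          have "(4 + c0) / ln 2 * ((1 + ln R) * nevanlinna_char f (2 * R)) \<le> C * ((1 + ln R) * nevanlinna_char f (2 * R))"
            using R1 nevanlinna_char_nonneg[OF f, of "2*R"] by (intro mult_right_mono mult_nonneg_nonneg) (auto simp: C_def)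
          then show "(4 + c0) * (1 + ln R) * (nevanlinna_char f (2 * R) / ln 2) \<le> C * (1 + ln R) * nevanlinna_char f (2 * R)"
            by (simp add: mult_ac)
        qed
        finally show ?thesis by (simp add: distrib_left)
      qed
      then have "{r\<in>{1..t}. \<not> nevanlinna_char (f \<circ> g) r
           \<le> C * (1 + ln R) * (nevanlinna_char f R + nevanlinna_char f (2 * R))} \<subseteq> ?S" by blast
      then show ?thesis using finS finite_subset R by (intro bexI[of _ R]) auto
    qed
  qed
qed

text \<open>It decides whether an iterated logarithm of the characteristic is a fixed number or has
  an argument beyond a given threshold. A pole forces growth like \<open>ln r\<close>. Without poles
  \<open>h\<close> agrees with an entire \<open>v\<close> at all points where it is analytic; by
  Liouville \<open>v\<close> is constant or takes arbitrarily large values, and one large value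
  bounds the characteristic from below at the later radii.\<close>

lemma nevanlinna_char_const_or_unbounded:
  fixes h :: "complex \<Rightarrow> complex"
  assumes h: "h meromorphic_on UNIV"
  shows "(\<exists>c. \<forall>b. finite {r\<in>{0<..b}. nevanlinna_char h r \<noteq> c}) \<or>
         (\<forall>A. \<exists>r0. \<forall>b. finite {r\<in>{r0..b}. nevanlinna_char h r < A})"
proof (cases "\<exists>a. is_pole h a")
  case True
  then obtain a where a: "is_pole h a" by blast
  have iso: "isolated_singularity_at h a" using h by (meson UNIV_I meromorphic_on_altdef)
  have ma: "nat (- zorder h a) \<ge> 1" using isolated_pole_imp_neg_zorder[OF iso a] by linarith
  have lim: "filterlim (\<lambda>r. jensen_weight r a) at_top at_top"
  proof (cases "a = 0")
    case True
    then show ?thesis by (simp add: jensen_weight_def ln_at_top)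
  next
    case False
    have "filterlim (\<lambda>r. r * inverse (norm a)) at_top at_top"
      using False by (intro filterlim_at_top_mult_tendsto_pos[of _ "inverse (norm a)"] filterlim_ident tendsto_const) auto
    then have "filterlim (\<lambda>r. ln (r / norm a)) at_top at_top"
      by (intro filterlim_compose[OF ln_at_top]) (simp add: divide_inverse)
    then show ?thesis using False by (simp add: jensen_weight_def)
  qed
  have "\<exists>r0. \<forall>b. finite {r\<in>{r0..b}. nevanlinna_char h r < A}" for A
  proof -
    have "eventually (\<lambda>r. A \<le> jensen_weight r a) at_top" using lim by (simp add: filterlim_at_top)
    then obtain r1 where r1: "\<And>r. r \<ge> r1 \<Longrightarrow> A \<le> jensen_weight r a" by (auto simp: eventually_at_top_linorder)
    define r0 where "r0 = max r1 (max 1 (norm a))"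
    have "A \<le> nevanlinna_char h r" if r: "r \<ge> r0" for r
    proof -
      have r': "r \<ge> r1" "r \<ge> 1" "norm a \<le> r" "r > 0" using r by (auto simp: r0_def)
      have "A \<le> 1 * jensen_weight r a" using r1 r' by simp
      also have "\<dots> \<le> nat (- zorder h a) * jensen_weight r a"
        using ma r' by (intro mult_right_mono jensen_weight_nonneg) auto
      also have "\<dots> \<le> (\<Sum>a\<in>{z\<in>cball 0 r. is_pole h z}. nat (- zorder h a) * jensen_weight r a)"
        by (rule member_le_sum)
           (use a r' finite_poles[OF h] in \<open>auto intro!: mult_nonneg_nonneg jensen_weight_nonneg\<close>)
      also have "\<dots> = pole_counting_fun h r" using pole_counting_fun_eq[OF h r'(4)] by simp
      also have "\<dots> \<le> nevanlinna_char h r" using proximity_fun_nonneg by (simp add: nevanlinna_char_def)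
      finally show ?thesis .
    qed
    then have e: "{r\<in>{r0..b}. nevanlinna_char h r < A} = {}" for b by (auto simp: not_less[symmetric])
    have "finite {r\<in>{r0..b}. nevanlinna_char h r < A}" for b unfolding e by (rule finite.emptyI)
    then show ?thesis by blast
  qed
  then show ?thesis by blast
next
  case False
  obtain F D where FD: "F holomorphic_on UNIV" "D holomorphic_on UNIV"
    "\<And>z. D z = 0 \<longleftrightarrow> is_pole h z" "\<And>z. is_pole h z \<Longrightarrow> zorder D z = - zorder h z"
    "\<And>z. h analytic_on {z} \<Longrightarrow> h z = F z / D z"
    using meromorphic_quotient_representation[OF h] by metis
  define v where "v = (\<lambda>z. F z / D z)"
  have D0: "D z \<noteq> 0" for z using False FD(3) by blast
  have v: "v holomorphic_on UNIV" unfolding v_def using D0 by (intro holomorphic_intros FD)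
  let ?S = "\<lambda>b. norm ` {z\<in>cball 0 b. \<not> h analytic_on {z}}"
  have finS: "finite (?S b)" for b using finite_singularities[OF h] by blast
  have Th: "nevanlinna_char h r = proximity_fun v r" if r: "r \<in> {0<..b} - ?S b" for r b
  proof -
    have "h analytic_on {z}" if "norm z = r" for z using r that by force
    then have "h z = v z" if "norm z = r" for z using FD(5) that by (simp add: v_def)
    then have "proximity_fun h r = proximity_fun v r"
      unfolding proximity_fun_def using r
      by (intro arg_cong2[where f="(/)"] refl Henstock_Kurzweil_Integration.integral_cong) (auto simp: norm_mult)
    then show ?thesis using pole_counting_fun_no_poles[OF h, of r] False r by (auto simp: nevanlinna_char_def)
  qed
  show ?thesis
  proof (cases "v constant_on UNIV")
    case True
    then obtain c where c: "\<And>z. v z = c" by (auto simp: constant_on_def)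
    have "finite {r\<in>{0<..b}. nevanlinna_char h r \<noteq> log_plus (norm c)}" for b
      by (rule finite_subset[OF _ finS[of b]])
         (use Th[of _ b] in \<open>fastforce simp: proximity_fun_eq_circle_mean c\<close>)
    then show ?thesis by blast
  next
    case nc: False
    then obtain y where y: "v y \<noteq> 0" by (auto simp: constant_on_def)
    have "\<exists>r0. \<forall>b. finite {r\<in>{r0..b}. nevanlinna_char h r < A}" for A
    proof -
      have "\<not> bounded (range v)" using Liouville_theorem[OF v] nc by (auto simp: constant_on_def)
      \<comment> \<open>The 3 in the exponent compensates the Harnack quotient, which is at most 3
        for \<open>r \<ge> 2 * norm w + 1\<close>.\<close>
      then obtain w where w: "norm (v w) > exp (3 * A)" unfolding bounded_iff by (auto simp: not_le)
      have lw: "log_plus (norm (v w)) > 3 * A"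
        using w ln_le_log_plus[of "norm (v w)"] by (smt (verit, best) exp_gt_zero ln_exp ln_less_cancel_iff)
      define r0 where "r0 = 2 * norm w + 1"
      have "finite {r\<in>{r0..b}. nevanlinna_char h r < A}" for b
      proof (rule finite_subset)
        show "finite (?S b \<union> norm ` {z\<in>cball 0 b. v z = 0})"
          using finS entire_finite_zeros[OF v y] by blast
        show "{r\<in>{r0..b}. nevanlinna_char h r < A} \<subseteq> ?S b \<union> norm ` {z\<in>cball 0 b. v z = 0}"
        proof (rule ccontr)
          assume "\<not> ?thesis"
          then obtain r where r: "r0 \<le> r" "r \<le> b" "nevanlinna_char h r < A" "r \<notin> ?S b" "r \<notin> norm ` {z\<in>cball 0 b. v z = 0}"
            by auto
          have wr: "norm w < r" "r > 0" using r(1) norm_ge_zero[of w] unfolding r0_def by linarith+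
          have vz: "v z \<noteq> 0" if "norm z = r" for z using r that by force
          have "log_plus (norm (v w)) \<le> (r + norm w) / (r - norm w) * proximity_fun v r"
            by (rule log_plus_le_proximity[OF v vz wr(1)])
          also have "\<dots> \<le> 3 * proximity_fun v r"
            using r(1) wr by (intro mult_right_mono proximity_fun_nonneg) (auto simp: r0_def divide_simps)
          also have "proximity_fun v r = nevanlinna_char h r" using Th[of r b] r wr by auto
          finally show False using lw r(3) by simp
        qed
      qed
      then show ?thesis by blast
    qed
    then show ?thesis by blast
  qed
qed

section \<open>Logarithmic derivatives\<close>

text \<open>Since Re K < A, the quotient \<open>K / (2 * A - K)\<close> maps the disc into the unit
  disc and vanishes at 0. Schwarz's lemma gives |K| \<le> 2 A on the half disc, and Cauchy's
  estimate on the circle of radius \<open>R / 4\<close> about \<open>z\<close> gives 8 A /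
  R.\<close>

lemma borel_caratheodory_deriv:
  fixes H :: "complex \<Rightarrow> complex"
  assumes H: "H holomorphic_on ball 0 R" and R: "R \<ge> 1"
    and A: "\<And>z. norm z < R \<Longrightarrow> Re (H z) - Re (H 0) < A" and z: "norm z \<le> R / 4"
  shows "norm (deriv H z) \<le> 8 * A"
proof -
  have A0: "A > 0" using A[of 0] R by simp
  define K where "K = (\<lambda>z. H z - H 0)"
  have K: "K holomorphic_on ball 0 R" unfolding K_def by (intro holomorphic_intros H)
  have ReK: "Re (K z) < A" if "norm z < R" for z using A[OF that] by (simp add: K_def)
  have den: "2 * of_real A - K z \<noteq> 0" if "norm z < R" for z
  proof
    assume "2 * of_real A - K z = 0"
    then have "Re (2 * of_real A - K z) = 0" by simp
    then show False using ReK[OF that] A0 by simp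
  qed
  have lt: "norm (K z) < norm (2 * of_real A - K z)" if "norm z < R" for z
  proof -
    have "(norm (2 * of_real A - K z))\<^sup>2 - (norm (K z))\<^sup>2 = 4 * A * (A - Re (K z))"
      unfolding cmod_power2 by (simp add: power2_eq_square algebra_simps)
    also have "\<dots> > 0" using ReK[OF that] A0 by simp
    finally have "(norm (K z))\<^sup>2 < (norm (2 * of_real A - K z))\<^sup>2" by simp
    then show ?thesis by (rule power_less_imp_less_base) simp
  qed
  define \<phi> where "\<phi> = (\<lambda>z. K (of_real R * z) / (2 * of_real A - K (of_real R * z)))"
  have small: "norm (of_real R * z) < R" if "norm z < 1" for z :: complex
    using that R by (simp add: norm_mult)
  have KR: "(\<lambda>z. K (of_real R * z)) holomorphic_on ball 0 1"
  proof -
    have "(\<lambda>z. of_real R * z) ` ball 0 1 \<subseteq> ball (0::complex) R"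
    proof (rule image_subsetI)
      fix z :: complex assume "z \<in> ball 0 1"
      then show "of_real R * z \<in> ball 0 R" using small[of z] by simp
    qed
    then have "K \<circ> (\<lambda>z. of_real R * z) holomorphic_on ball 0 1"
      by (intro holomorphic_on_compose_gen[OF _ K]) (auto intro!: holomorphic_intros)
    then show ?thesis by (simp add: o_def)
  qed
  have K_le: "norm (K w) \<le> 2 * A" if w: "norm w \<le> R / 2" for w
  proof -
    define \<xi> where "\<xi> = w / of_real R"
    have \<xi>: "norm \<xi> \<le> 1/2" "of_real R * \<xi> = w" using w R by (auto simp: \<xi>_def norm_divide)
    have wR: "norm w < R" using w R by simp
    have "norm (\<phi> \<xi>) \<le> norm \<xi>"
    proof (rule Schwarz_Lemma(1))
      show "\<phi> holomorphic_on ball 0 1" unfolding \<phi>_def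
        using KR den small by (intro holomorphic_intros) auto
      show "\<phi> 0 = 0" by (simp add: \<phi>_def K_def)
      show "norm (\<phi> z) < 1" if "norm z < 1" for z
        using lt[OF small[OF that]] den[OF small[OF that]] by (simp add: \<phi>_def norm_divide divide_less_eq_1_pos)
    qed (use \<xi> in simp)
    moreover have "norm (\<phi> \<xi>) = norm (K w) / norm (2 * of_real A - K w)" using \<xi>(2) by (simp add: \<phi>_def norm_divide)
    ultimately have "norm (K w) / norm (2 * of_real A - K w) \<le> 1 / 2" using \<xi>(1) by linarith
    then have "norm (K w) \<le> 1 / 2 * norm (2 * of_real A - K w)" using den[OF wR] by (simp add: divide_le_eq)
    also have "norm (2 * of_real A - K w) \<le> 2 * A + norm (K w)"
      using norm_triangle_ineq4[of "2 * of_real A" "K w"] A0 by (simp add: norm_mult)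
    finally show ?thesis by simp
  qed
  have sub: "norm x \<le> R / 2" if "x \<in> cball z (R/4)" for x
  proof -
    have "norm x \<le> norm z + dist z x" using norm_triangle_ineq4[of z "z - x"] by (simp add: dist_norm)
    then show ?thesis using that z by simp
  qed
  have sub': "cball z (R/4) \<subseteq> ball 0 R"
  proof
    fix x assume "x \<in> cball z (R/4)"
    from sub[OF this] R show "x \<in> ball 0 R" by simp
  qed
  have KH: "deriv K z = deriv H z"
  proof -
    have "z \<in> ball 0 R" using z R by simp
    then have "H field_differentiable at z" using H by (simp add: holomorphic_on_imp_differentiable_at)
    then show ?thesis unfolding K_def by (subst deriv_diff) auto
  qed
  have "norm ((deriv ^^ 1) K z) \<le> fact 1 * (2 * A) / (R / 4) ^ 1"
  proof (rule Cauchy_inequality)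
    show "K holomorphic_on ball z (R/4)" "continuous_on (cball z (R/4)) K"
      using K sub' holomorphic_on_subset holomorphic_on_imp_continuous_on ball_subset_cball by blast+
    show "norm (K x) \<le> 2 * A" if "norm (z - x) = R / 4" for x
      using K_le[OF sub[of x]] that by (simp add: dist_norm)
  qed (use R in simp)
  then have "norm (deriv H z) \<le> 8 * A / R" by (simp add: KH)
  also have "\<dots> \<le> 8 * A" using R A0 by (simp add: divide_le_eq)
  finally show ?thesis .
qed

lemma log_deriv_product:
  fixes u h :: "complex \<Rightarrow> complex"
  assumes "finite Z" "\<And>w. u w = (\<Prod>a\<in>Z. (w - a) ^ m a) * h w" "h holomorphic_on UNIV" "h z \<noteq> 0" "z \<notin> Z"
  shows "deriv u z / u z = (\<Sum>a\<in>Z. of_nat (m a) / (z - a)) + deriv h z / h z"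
  using assms
proof (induction Z arbitrary: u rule: finite_induct)
  case empty
  then have "u = h" by (auto simp: fun_eq_iff)
  then show ?case by simp
next
  case (insert b Z)
  define v where "v = (\<lambda>w. (\<Prod>a\<in>Z. (w - a) ^ m a) * h w)"
  have IH: "deriv v z / v z = (\<Sum>a\<in>Z. of_nat (m a) / (z - a)) + deriv h z / h z"
    by (rule insert.IH) (use insert.prems in \<open>auto simp: v_def\<close>)
  have zb: "z \<noteq> b" using insert.prems by auto
  have v0: "v z \<noteq> 0" unfolding v_def using insert.hyps insert.prems by auto
  have "v holomorphic_on UNIV" unfolding v_def using insert.prems by (intro holomorphic_intros) auto
  then have "(v has_field_derivative deriv v z) (at z)" by (rule holomorphic_derivI) auto
  moreover have "((\<lambda>w. (w - b) ^ m b) has_field_derivative of_nat (m b) * (z - b) ^ (m b - 1)) (at z)"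
    by (auto intro!: derivative_eq_intros)
  ultimately have "((\<lambda>w. (w - b) ^ m b * v w) has_field_derivative
      of_nat (m b) * (z - b) ^ (m b - 1) * v z + deriv v z * (z - b) ^ m b) (at z)"
    by (rule DERIV_mult[rotated])
  moreover have uv: "u = (\<lambda>w. (w - b) ^ m b * v w)"
    using insert.hyps insert.prems(1) by (auto simp: fun_eq_iff v_def mult_ac)
  ultimately have du: "deriv u z = of_nat (m b) * (z - b) ^ (m b - 1) * v z + deriv v z * (z - b) ^ m b"
    by (simp add: DERIV_imp_deriv)
  have uz: "u z = (z - b) ^ m b * v z" by (simp add: uv)
  have "of_nat (m b) * (z - b) ^ (m b - 1) = of_nat (m b) / (z - b) * (z - b) ^ m b"
    using zb by (cases "m b") auto
  then have "deriv u z / u z = of_nat (m b) / (z - b) + deriv v z / v z"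
    unfolding du uz using zb v0 by (simp add: add_divide_distrib)
  then show ?case using IH insert.hyps by simp
qed

text \<open>With the zeros in the disc of radius \<open>R\<close> split off, their part of the
  logarithmic derivative is at most \<open>n / \<eta>\<close>, and the zero-free factor
  \<open>h\<close> falls under the Borel-Caratheodory estimate. The fourfold disc is used because
  each linear factor is at least \<open>3 * R\<close> on its boundary but at most \<open>R\<close>
  at the origin. This ratio gains a factor 3^n in the bound for |h|, which pays for the number
  \<open>n\<close> of zeros.\<close>

lemma log_deriv_bound:
  fixes u V :: "complex \<Rightarrow> complex" and A M R :: real
  assumes u: "u holomorphic_on UNIV" and V: "V holomorphic_on UNIV" "V 0 \<noteq> 0" "\<And>z. u z = z ^ k * V z"
    and R: "R \<ge> 1" and M: "\<And>z. norm z \<le> 4 * R \<Longrightarrow> norm (u z) \<le> M"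
    and A: "A = ln M - ln (norm (V 0)) + 1" and Z: "Z = {z\<in>cball 0 R. u z = 0}"
  shows "finite Z" "card Z \<le> A"
    "\<And>z \<eta>. norm z \<le> R / 4 \<Longrightarrow> \<eta> > 0 \<Longrightarrow> (\<And>a. a \<in> Z \<Longrightarrow> \<eta> \<le> \<bar>norm z - norm a\<bar>) \<Longrightarrow> norm (deriv u z / u z) \<le> A / \<eta> + 8 * A"
proof -
  have "eventually (\<lambda>z. V z \<noteq> 0) (at 0)"
    using entire_not_identically_zero_eventually[OF V(1,2)] by blast
  then have "eventually (\<lambda>z. u z \<noteq> 0) (at 0)" unfolding V(3) eventually_at_filter by (auto elim: eventually_mono)
  then obtain y where y: "u y \<noteq> 0" using eventually_happens[of "\<lambda>z. u z \<noteq> 0" "at 0"] by auto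
  obtain h where h: "h holomorphic_on UNIV" "\<And>z. u z = (\<Prod>a\<in>Z. (z - a) ^ nat (zorder u a)) * h z"
    "\<And>z. z \<in> cball 0 R \<Longrightarrow> h z \<noteq> 0"
    using entire_zero_factorization[OF u y Z] by metis
  define m where "m = (\<lambda>a. nat (zorder u a))"
  define n where "n = (\<Sum>a\<in>Z. m a)"
  have um: "u z = (\<Prod>a\<in>Z. (z - a) ^ m a) * h z" for z using h(2)[of z] by (simp only: m_def)
  show fin: "finite Z" unfolding Z by (rule entire_finite_zeros[OF u y])
  have mpos: "m a \<ge> 1" if "a \<in> Z" for a
    using zorder_entire_zero[OF u y, of a] that Z by (simp add: m_def)
  have "card Z \<le> n" unfolding n_def card_eq_sum by (intro sum_mono mpos)
  have aR: "norm a \<le> R" if "a \<in> Z" for a using that Z by auto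
  have "zorder u 0 = int k"
    by (rule zorder_eqI[of UNIV _ V]) (use V in \<open>auto simp: mult.commute\<close>)
  then have mk: "m 0 = k" by (simp add: m_def)
  have Z0: "0 \<in> Z \<longleftrightarrow> k > 0" using V(2) V(3)[of 0] R by (auto simp: Z)
  have "V 0 = (\<Prod>a\<in>Z-{0}. (0 - a) ^ m a) * h 0"
    by (rule leading_coefficient_product[OF fin _ _ h(1) um V(1,3)]) (use Z0 mk in auto)
  then have "norm (V 0) = (\<Prod>a\<in>Z-{0}. norm a ^ m a) * norm (h 0)"
    by (simp add: norm_mult prod_norm[symmetric] norm_power)
  also have "(\<Prod>a\<in>Z-{0}. norm a ^ m a) \<le> (\<Prod>a\<in>Z-{0}. R ^ m a)"
    using aR by (intro prod_mono conjI power_mono) auto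
  also have "\<dots> \<le> (\<Prod>a\<in>Z. R ^ m a)"
    using fin R by (intro prod_mono2) (auto intro: one_le_power)
  also have "\<dots> = R ^ n" by (simp add: n_def power_sum)
  finally have V_le: "norm (V 0) \<le> R ^ n * norm (h 0)" by (simp add: mult_right_mono)
  have h0: "norm (h 0) > 0" using h(3)[of 0] R by simp
  have "norm (u 0) \<le> M" using M[of 0] R by simp
  have h_le: "norm (h z) \<le> M / (3 * R) ^ n" if z: "norm z \<le> R" for z
  proof (rule maximum_modulus_frontier[of h "cball 0 (4*R)"])
    show "h holomorphic_on interior (cball 0 (4 * R))" by (rule holomorphic_on_subset[OF h(1)]) simp
    show "continuous_on (closure (cball 0 (4 * R))) h"
      by (rule holomorphic_on_imp_continuous_on[OF holomorphic_on_subset[OF h(1)]]) simp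
    show "z \<in> cball 0 (4 * R)" using z R by simp
    fix x assume "x \<in> frontier (cball (0::complex) (4 * R))"
    then have x: "norm x = 4 * R" using R by (simp add: frontier_cball)
    have "(3 * R) ^ n = (\<Prod>a\<in>Z. (3 * R) ^ m a)" by (simp add: n_def power_sum)
    also have "\<dots> \<le> (\<Prod>a\<in>Z. norm (x - a) ^ m a)"
    proof (intro prod_mono conjI power_mono)
      fix a assume "a \<in> Z"
      show "3 * R \<le> norm (x - a)" using norm_triangle_ineq2[of x a] aR[OF \<open>a \<in> Z\<close>] x by linarith
    qed (use R in auto)
    finally have "(3 * R) ^ n * norm (h x) \<le> norm (u x)"
      unfolding um norm_mult prod_norm[symmetric] norm_power by (intro mult_right_mono) auto
    also have "\<dots> \<le> M" using M x by simp
    finally show "norm (h x) \<le> M / (3 * R) ^ n" using R by (simp add: le_divide_eq mult.commute)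
  qed simp
  have M0: "M > 0"
  proof -
    have "0 < M / (3 * R) ^ n" by (rule less_le_trans[OF h0 h_le]) (use R in simp)
    then have "0 < M / (3 * R) ^ n * (3 * R) ^ n" using R by (intro mult_pos_pos zero_less_power) auto
    then show ?thesis using R by simp
  qed
  \<comment> \<open>This converts the gain \<open>n * ln 3\<close> into a gain of at least
    \<open>n\<close>.\<close>
  have ln3: "ln (3::real) \<ge> 1"
    using ln_mono[of "exp 1" "3::real"] exp_le by simp
  have key: "ln (norm (h z)) - ln (norm (h 0)) < A - n" if z: "norm z \<le> R" for z
  proof -
    have "norm (h z) > 0" using h(3) z by simp
    then have "ln (norm (h z)) \<le> ln (M / (3 * R) ^ n)" using h_le[OF z] by (intro ln_mono) auto
    also have "\<dots> = ln M - ln ((3 * R) ^ n)" using M0 R by (intro ln_divide_pos) auto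
    also have "ln ((3 * R) ^ n) = n * (ln 3 + ln R)" unfolding ln_realpow using R by (simp add: ln_mult)
    finally have 1: "ln (norm (h z)) \<le> ln M - n * (ln 3 + ln R)" .
    have "ln (norm (V 0)) \<le> ln (R ^ n * norm (h 0))" using V_le V(2) by (intro ln_mono) auto
    also have "\<dots> = n * ln R + ln (norm (h 0))" using h0 R by (simp add: ln_mult ln_realpow)
    finally have "ln (norm (h z)) - ln (norm (h 0)) \<le> ln M - ln (norm (V 0)) - n * ln 3"
      using 1 by (simp add: algebra_simps)
    moreover have "n * (1::real) \<le> n * ln 3" using ln3 by (intro mult_left_mono) auto
    ultimately show ?thesis unfolding A by linarith
  qed
  \<comment> \<open>At 0 the left-hand side of \<open>key\<close> vanishes, which bounds the number
    of zeros.\<close>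
  have nA: "n \<le> A" using key[of 0] R by simp
  then show "card Z \<le> A" using \<open>card Z \<le> n\<close> by linarith
  obtain H where H: "H holomorphic_on ball 0 R" "\<And>x. x \<in> ball 0 R \<Longrightarrow> exp (H x) = h x"
    by (rule holomorphic_logarithm_exists[of "ball 0 R" h 0])
       (use h R in \<open>auto intro: holomorphic_on_subset[OF h(1)]\<close>)
  have ReH: "ln (norm (h x)) = Re (H x)" if "x \<in> ball 0 R" for x
    using H(2)[OF that] by (metis ln_exp norm_exp_eq_Re)
  have ReH_lt: "Re (H z) - Re (H 0) < A" if "norm z < R" for z
    using key[of z] ReH[of z] ReH[of 0] that R by simp
  show "norm (deriv u z / u z) \<le> A / \<eta> + 8 * A"
    if z: "norm z \<le> R / 4" and \<eta>: "\<eta> > 0" "\<And>a. a \<in> Z \<Longrightarrow> \<eta> \<le> \<bar>norm z - norm a\<bar>" for z \<eta>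
  proof -
    have zR: "z \<in> ball 0 R" using z R by simp
    have hz: "h z \<noteq> 0" using h(3)[of z] zR by simp
    have zZ: "z \<notin> Z" using \<eta> by force
    have dH: "deriv h z = deriv H z * h z"
    proof -
      have "(H has_field_derivative deriv H z) (at z)" using H(1) zR by (intro holomorphic_derivI) auto
      then have "((\<lambda>x. exp (H x)) has_field_derivative exp (H z) * deriv H z) (at z)" by (rule DERIV_fun_exp)
      then have "(h has_field_derivative exp (H z) * deriv H z) (at z)"
        by (rule DERIV_cong_ev[THEN iffD1, rotated -1])
           (use H(2) zR eventually_nhds_in_open[OF open_ball zR] in \<open>auto elim: eventually_mono\<close>)
      then show ?thesis using H(2)[OF zR] by (simp add: DERIV_imp_deriv mult.commute)
    qed
    have "norm (deriv u z / u z) = norm ((\<Sum>a\<in>Z. of_nat (m a) / (z - a)) + deriv H z)"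
      unfolding log_deriv_product[OF fin um h(1) hz zZ] using dH hz by simp
    also have "\<dots> \<le> (\<Sum>a\<in>Z. norm (of_nat (m a) / (z - a))) + norm (deriv H z)"
      by (intro order_trans[OF norm_triangle_ineq] add_right_mono norm_sum)
    also have "\<dots> \<le> (\<Sum>a\<in>Z. m a / \<eta>) + 8 * A"
    proof (intro add_mono sum_mono)
      fix a assume a: "a \<in> Z"
      have "\<eta> \<le> norm (z - a)" using \<eta>(2)[OF a] norm_triangle_ineq3[of z a] by linarith
      then have "m a / norm (z - a) \<le> m a / \<eta>"
        using \<eta>(1) by (intro divide_left_mono mult_pos_pos) auto
      then show "norm (of_nat (m a) / (z - a)) \<le> m a / \<eta>" by (simp add: norm_divide)
    next
      show "norm (deriv H z) \<le> 8 * A" by (rule borel_caratheodory_deriv[OF H(1) R ReH_lt z])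
    qed
    also have "(\<Sum>a\<in>Z. m a / \<eta>) = n / \<eta>" by (simp add: n_def sum_divide_distrib)
    also have "n / \<eta> \<le> A / \<eta>" using nA \<eta>(1) by (intro divide_right_mono) auto
    finally show ?thesis by simp
  qed
qed

lemma higher_deriv_entire: "g holomorphic_on UNIV \<Longrightarrow> (deriv ^^ j) g holomorphic_on (UNIV :: complex set)"
  by (intro holomorphic_higher_deriv) auto

section \<open>Higher derivatives and the choice of a radius\<close>

lemma higher_deriv_bound:
  fixes g :: "complex \<Rightarrow> complex"
  assumes g: "g holomorphic_on UNIV" and M: "\<And>z. norm z \<le> r + 1 \<Longrightarrow> norm (g z) \<le> M" and z: "norm z \<le> r"
  shows "norm ((deriv ^^ j) g z) \<le> fact j * M"
proof -
  have "norm ((deriv ^^ j) g z) \<le> fact j * M / 1 ^ j"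
  proof (rule Cauchy_inequality)
    show "norm (g x) \<le> M" if "norm (z - x) = 1" for x
      using M[of x] norm_triangle_ineq4[of z "z - x"] that z by simp
  qed (use g holomorphic_on_subset holomorphic_on_imp_continuous_on in \<open>auto intro: holomorphic_on_subset[OF g] holomorphic_on_imp_continuous_on\<close>)
  then show ?thesis by simp
qed

text \<open>If some derivative vanished identically, the Taylor series at 0 would be finite and
  \<open>g\<close> a polynomial.\<close>

lemma transcendental_higher_deriv_nonzero:
  assumes "transcendental_entire g"
  shows "\<exists>z. (deriv ^^ j) g z \<noteq> 0"
proof (rule ccontr)
  assume "\<not> ?thesis"
  then have 0: "(deriv ^^ j) g = (\<lambda>_. 0)" by auto
  have g: "g holomorphic_on UNIV" and np: "\<not> (\<exists>P :: complex poly. \<forall>z. g z = poly P z)"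
    using assms by (auto simp: transcendental_entire_def)
  have d0: "(deriv ^^ n) g 0 = 0" if "n \<ge> j" for n
  proof -
    have "(deriv ^^ (i + j)) g = (\<lambda>_. 0)" for i
      by (induction i) (auto simp: 0)
    from this[of "n - j"] show ?thesis using that by simp
  qed
  define P where "P = (\<Sum>n<j. monom ((deriv ^^ n) g 0 / fact n) n)"
  have "g z = poly P z" for z
  proof -
    have "(\<lambda>n. (deriv ^^ n) g 0 / fact n * (z - 0) ^ n) sums g z"
      by (rule holomorphic_power_series[of g 0 "norm z + 1"]) (auto intro: holomorphic_on_subset[OF g])
    moreover have "(\<lambda>n. (deriv ^^ n) g 0 / fact n * (z - 0) ^ n) sums (\<Sum>n<j. (deriv ^^ n) g 0 / fact n * (z - 0) ^ n)"
      by (rule sums_finite) (use d0 in auto)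
    ultimately show ?thesis using sums_unique2 by (fastforce simp: P_def poly_sum poly_monom)
  qed
  then show False using np by blast
qed

text \<open>Pigeonhole: of \<open>N + 1\<close> equal open subintervals one contains no point of
  \<open>A\<close>. Its middle third keeps a third of the length away from \<open>A\<close>, and
  being infinite it has a point outside \<open>X\<close>.\<close>

lemma radius_away_from_finite_set:
  fixes A X :: "real set" and a b :: real
  assumes "finite A" "finite X" "a < b" "card A \<le> N"
  obtains r where "a \<le> r" "r \<le> b" "r \<notin> X" "\<And>x. x \<in> A \<Longrightarrow> (b - a) / (3 * (N + 1)) \<le> \<bar>r - x\<bar>"
proof -
  define h where "h = (b - a) / (N + 1)"
  have h: "h > 0" using assms by (simp add: h_def)
  define I where "I = (\<lambda>j::nat. {a + j * h<..<a + (j + 1) * h})"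
  have "\<exists>j\<le>N. I j \<inter> A = {}"
  proof (rule ccontr)
    assume "\<not> ?thesis"
    then have "\<forall>j\<in>{..N}. \<exists>x. x \<in> I j \<inter> A" by blast
    then obtain x where x: "\<forall>j\<in>{..N}. x j \<in> I j \<inter> A" by (rule bchoice[THEN exE])
    have "inj_on x {..N}"
    proof (rule inj_onI)
      fix i j assume ij: "i \<in> {..N}" "j \<in> {..N}" "x i = x j"
      have less: False if "i' < j'" "i' \<in> {..N}" "j' \<in> {..N}" "x i' = x j'" for i' j'
      proof -
        have "x i' < a + (real i' + 1) * h" "a + real j' * h < x j'"
          using bspec[OF x that(2)] bspec[OF x that(3)] by (auto simp: I_def)
        moreover have "(real i' + 1) * h \<le> real j' * h" using that(1) h by (intro mult_right_mono) auto
        ultimately show False using that by simp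
      qed
      show "i = j" using less[of i j] less[of j i] ij by (cases i j rule: linorder_cases) auto
    qed
    moreover have "x ` {..N} \<subseteq> A" using x by auto
    ultimately have "card {..N} \<le> card A" using assms(1) by (intro card_inj_on_le)
    then show False using assms(4) by simp
  qed
  then obtain j where j: "j \<le> N" "I j \<inter> A = {}" by blast
  define c where "c = a + j * h"
  have "infinite {c + h/3<..<c + 2*h/3}" using h by (simp add: infinite_Ioo)
  then obtain r where r: "r \<in> {c + h/3<..<c + 2*h/3}" "r \<notin> X" by (meson assms(2) finite_subset subsetI)
  have jh: "a \<le> c" "c + h \<le> b"
  proof -
    show "a \<le> c" using h by (simp add: c_def)
    have "c + h = a + (j + 1) * h" by (simp add: c_def algebra_simps)
    also have "\<dots> \<le> a + (N + 1) * h" using j h by (intro add_left_mono mult_right_mono) auto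
    also have "\<dots> = b" by (simp add: h_def)
    finally show "c + h \<le> b" .
  qed
  show ?thesis
  proof (rule that[of r])
    show "a \<le> r" "r \<le> b" using r jh h by auto
    show "r \<notin> X" by (rule r(2))
    fix x assume "x \<in> A"
    then have "x \<notin> I j" using j(2) by blast
    then have "x \<le> c \<or> c + h \<le> x" by (auto simp: I_def c_def algebra_simps)
    then have "h / 3 \<le> \<bar>r - x\<bar>" using r h by auto
    then show "(b - a) / (3 * (N + 1)) \<le> \<bar>r - x\<bar>" by (simp add: h_def mult.commute)
  qed
qed

section \<open>Lower bound for differential polynomials\<close>

lemma norm_le_max_modulus_sphere:
  assumes "g holomorphic_on UNIV" "norm z = r"
  shows "norm (g z) \<le> max_modulus g r"
proof -
  have "compact ((\<lambda>z. norm (g z)) ` sphere 0 r)"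
    using assms(1) by (intro compact_continuous_image continuous_intros)
      (auto intro: holomorphic_on_imp_continuous_on holomorphic_on_subset)
  then have "bdd_above ((\<lambda>z. norm (g z)) ` sphere 0 r)"
    by (intro bounded_imp_bdd_above compact_imp_bounded)
  then show ?thesis unfolding max_modulus_def using assms(2) by (intro cSUP_upper) auto
qed

lemma max_modulus_attained:
  assumes "g holomorphic_on UNIV" "r \<ge> 0"
  obtains z where "norm z = r" "norm (g z) = max_modulus g r"
proof -
  have c: "continuous_on (sphere 0 r) (\<lambda>z. norm (g z))"
    using assms(1) by (intro continuous_intros) (auto intro: holomorphic_on_imp_continuous_on holomorphic_on_subset)
  have "of_real r \<in> sphere (0::complex) r" using assms by simp
  then have ne: "sphere (0::complex) r \<noteq> {}" by blast
  obtain z where z: "z \<in> sphere 0 r" "\<And>y. y \<in> sphere 0 r \<Longrightarrow> norm (g y) \<le> norm (g z)"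
    using continuous_attains_sup[OF compact_sphere ne c] by blast
  then have "max_modulus g r \<le> norm (g z)" unfolding max_modulus_def using ne by (intro cSUP_least) auto
  moreover have "norm (g z) \<le> max_modulus g r" using z by (intro norm_le_max_modulus_sphere assms) auto
  ultimately show ?thesis using that[of z] z by auto
qed

lemma norm_le_max_modulus:
  fixes g :: "complex \<Rightarrow> complex"
  assumes g: "g holomorphic_on UNIV" and z: "norm z \<le> r"
  shows "norm (g z) \<le> max_modulus g r"
proof (cases "r > 0")
  case True
  show ?thesis
  proof (rule maximum_modulus_frontier[of g "cball 0 r"])
    show "g holomorphic_on interior (cball 0 r)" by (rule holomorphic_on_subset[OF g]) simp
    show "continuous_on (closure (cball 0 r)) g"
      by (rule holomorphic_on_imp_continuous_on[OF holomorphic_on_subset[OF g]]) simp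
    show "norm (g x) \<le> max_modulus g r" if "x \<in> frontier (cball 0 r)" for x
      using that True by (intro norm_le_max_modulus_sphere g) (simp add: frontier_cball)
  qed (use z in auto)
next
  case False
  have "norm z = r" using False z norm_ge_zero[of z] by linarith
  then show ?thesis by (intro norm_le_max_modulus_sphere g)
qed

lemma max_modulus_mono:
  assumes "g holomorphic_on UNIV" "0 \<le> r" "r \<le> s"
  shows "max_modulus g r \<le> max_modulus g s"
proof -
  obtain z where "norm z = r" "norm (g z) = max_modulus g r"
    by (rule max_modulus_attained[OF assms(1,2)])
  then show ?thesis using norm_le_max_modulus[OF assms(1), of z s] assms by simp
qed

lemma max_modulus_at_top:
  fixes g :: "complex \<Rightarrow> complex"
  assumes g: "g holomorphic_on UNIV" "\<not> g constant_on UNIV"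
  shows "filterlim (max_modulus g) at_top at_top"
  unfolding filterlim_at_top
proof
  fix B
  have "\<not> bounded (range g)" using Liouville_theorem[OF g(1)] g(2) by (auto simp: constant_on_def)
  then obtain w where w: "norm (g w) > B" unfolding bounded_iff by (auto simp: not_le)
  have "B \<le> max_modulus g r" if "r \<ge> norm w" for r
    using norm_le_max_modulus[OF g(1) that] w by simp
  then show "\<forall>\<^sub>F r in at_top. B \<le> max_modulus g r" by (auto simp: eventually_at_top_linorder)
qed

lemma transcendental_not_constant: "transcendental_entire g \<Longrightarrow> \<not> g constant_on UNIV"
  unfolding transcendental_entire_def constant_on_def by (metis UNIV_I poly_pCons poly_0 add_0_right mult_zero_right)

text \<open>One radius has to serve \<open>g\<close> and its derivatives of order below
  \<open>K\<close> at once. Together their zeros in the disc have O(y) moduli, where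
  \<open>y = ln (max_modulus g (128 * s))\<close>, so some radius has distance at least a constant
  times 1 / y from all of them. There each logarithmic derivative is O(y^2), and the product of
  \<open>j\<close> of them bounds the j-th derivative. A power of \<open>y\<close> is affordable
  because only its logarithm enters the characteristic.\<close>

lemma log_deriv_bound_uniform:
  fixes g :: "complex \<Rightarrow> complex"
  assumes g: "transcendental_entire g" and \<tau>: "2 < \<tau>" "\<tau> \<le> 3"
  obtains c :: real where "c \<ge> 1"
    "\<And>s X. s \<ge> 1 \<Longrightarrow> 1 \<le> ln (max_modulus g (128 * s)) \<Longrightarrow> finite X \<Longrightarrow>
       \<exists>r\<in>{2 * s .. \<tau> * s} - X. \<forall>z j. norm z = r \<longrightarrow> j \<le> K \<longrightarrow>
          norm ((deriv ^^ j) g z) \<le> (c * (ln (max_modulus g (128 * s)))\<^sup>2) ^ j * norm (g z)"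
proof -
  have gh: "g holomorphic_on UNIV" using g by (simp add: transcendental_entire_def)
  define u where "u = (\<lambda>j. (deriv ^^ j) g)"
  have u: "u j holomorphic_on UNIV" for j unfolding u_def by (rule higher_deriv_entire[OF gh])
  have "\<exists>k V. V holomorphic_on UNIV \<and> V 0 \<noteq> 0 \<and> (\<forall>z. u j z = z ^ k * V z)" for j
  proof -
    obtain y where "u j y \<noteq> 0" using transcendental_higher_deriv_nonzero[OF g, of j] by (auto simp: u_def)
    then show ?thesis using entire_leading_factor[OF u] by metis
  qed
  then obtain k V where V: "\<And>j. V j holomorphic_on UNIV" "\<And>j. V j 0 \<noteq> 0" "\<And>j z. u j z = z ^ k j * V j z"
    by metis
  define c1 where "c1 = (\<Sum>j<K. \<bar>ln (fact j) - ln (norm (V j 0)) + 1\<bar>)"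
  have c1: "ln (fact j) - ln (norm (V j 0)) + 1 \<le> c1" if "j < K" for j
  proof -
    have "\<bar>ln (fact j) - ln (norm (V j 0)) + 1\<bar> \<le> c1"
      unfolding c1_def by (rule member_le_sum) (use that in auto)
    then show ?thesis by linarith
  qed
  have c10: "c1 \<ge> 0" unfolding c1_def by (intro sum_nonneg) auto
  \<comment> \<open>Chosen so that \<open>A / \<eta> + 8 * A\<close> is at most \<open>c\<close>
    times the square of \<open>y\<close>, where \<open>A = (1 + c1) * y\<close> and
    \<open>1 / \<eta>\<close> is at most
    \<open>3 * (K * (1 + c1) + 2) * y / (\<tau> - 2)\<close>.\<close>
  define c where "c = (1 + c1) * (3 * (K * (1 + c1) + 2) / (\<tau> - 2) + 8)"
  have "1 * 1 \<le> (1 + c1) * (3 * (K * (1 + c1) + 2) / (\<tau> - 2) + 8)"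
    using c10 \<tau> by (intro mult_mono) (auto intro!: add_increasing divide_nonneg_nonneg add_nonneg_nonneg mult_nonneg_nonneg)
  then have c: "c \<ge> 1" by (simp add: c_def)
  show ?thesis
  proof (rule that[OF c])
    fix s :: real and X :: "real set"
    assume s: "s \<ge> 1" and y1: "1 \<le> ln (max_modulus g (128 * s))" and X: "finite X"
    define y where "y = ln (max_modulus g (128 * s))"
    define A where "A = (1 + c1) * y"
    have y: "y \<ge> 1" using y1 by (simp add: y_def)
    have Mpos: "max_modulus g (128 * s) > 0"
    proof (rule ccontr)
      assume "\<not> ?thesis"
      moreover have "max_modulus g (128 * s) \<ge> 0"
        using order_trans[OF norm_ge_zero norm_le_max_modulus[OF gh, of 0 "128 * s"]] s by simp
      ultimately have "max_modulus g (128 * s) = 0" by simp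
      then show False using y1 by simp
    qed
    have A0: "A \<ge> 1" using mult_mono[of 1 "1 + c1" 1 y] c10 y by (simp add: A_def)
    define Aj where "Aj = (\<lambda>j. ln (fact j * max_modulus g (128 * s)) - ln (norm (V j 0)) + 1)"
    have AjA: "Aj j \<le> A" if "j < K" for j
    proof -
      have "Aj j = ln (fact j) - ln (norm (V j 0)) + 1 + y" using Mpos by (simp add: Aj_def y_def ln_mult)
      also have "\<dots> \<le> c1 * 1 + y" using c1[OF that] by simp
      also have "\<dots> \<le> c1 * y + y" using c10 y by (intro add_right_mono mult_left_mono) auto
      finally show ?thesis by (simp add: A_def algebra_simps)
    qed
    \<comment> \<open>The radius is \<open>16 * s\<close> because the estimate holds on a quarter of
      the disc and the circle may have radius \<open>3 * s\<close>. A bound for the derivatives is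
      then needed up to \<open>64 * s\<close>, hence one for \<open>g\<close> up to
      \<open>64 * s + 1\<close>, which is at most \<open>128 * s\<close>.\<close>
    define Z where "Z = (\<lambda>j. {z\<in>cball 0 (16 * s). u j z = 0})"
    have uM: "norm (u j z) \<le> fact j * max_modulus g (128 * s)" if "norm z \<le> 4 * (16 * s)" for j z
      unfolding u_def
    proof (rule higher_deriv_bound[OF gh _ that])
      show "norm (g x) \<le> max_modulus g (128 * s)" if "norm x \<le> 4 * (16 * s) + 1" for x
        by (rule norm_le_max_modulus[OF gh]) (use that s in linarith)
    qed
    have s16: "16 * s \<ge> 1" using s by simp
    note ld = log_deriv_bound[OF u V(1) V(2) V(3) s16 uM Aj_def[THEN fun_cong] Z_def[THEN fun_cong]]
    define S where "S = (\<Union>j<K. norm ` Z j)"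
    have finS: "finite S" unfolding S_def using ld(1) by blast
    have "real (card S) \<le> K * A"
    proof -
      have "card S \<le> (\<Sum>j<K. card (norm ` Z j))" unfolding S_def by (rule card_UN_le) simp
      also have "\<dots> \<le> (\<Sum>j<K. card (Z j))" by (intro sum_mono card_image_le ld(1))
      finally have "real (card S) \<le> (\<Sum>j<K. real (card (Z j)))" unfolding of_nat_sum[symmetric] of_nat_le_iff .
      also have "\<dots> \<le> (\<Sum>j<K. A)" by (intro sum_mono order_trans[OF ld(2) AjA]) auto
      finally show ?thesis by simp
    qed
    define N where "N = nat \<lceil>K * A\<rceil>"
    have N: "card S \<le> N" "N \<le> K * A + 1"
      using \<open>real (card S) \<le> K * A\<close> A0 by (auto simp: N_def le_nat_iff) linarith+
    have "2 * s < \<tau> * s" using \<tau> s by simp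
    then obtain r where r: "2 * s \<le> r" "r \<le> \<tau> * s" "r \<notin> X"
      "\<And>x. x \<in> S \<Longrightarrow> (\<tau> * s - 2 * s) / (3 * (N + 1)) \<le> \<bar>r - x\<bar>"
      using radius_away_from_finite_set[OF finS X _ N(1)] by metis
    define \<eta> where "\<eta> = (\<tau> * s - 2 * s) / (3 * (N + 1))"
    have \<eta>: "\<eta> > 0" using \<open>2 * s < \<tau> * s\<close> by (simp add: \<eta>_def)
    have "\<tau> * s \<le> 3 * s" using \<tau> s by (intro mult_right_mono) auto
    then have r4: "r \<le> 16 * s / 4" using r(2) s by linarith
    have step: "norm (u (Suc j) z) \<le> c * y\<^sup>2 * norm (u j z)" if z: "norm z = r" and j: "j < K" for z j
    proof -
      have dist: "\<eta> \<le> \<bar>norm z - norm a\<bar>" if "a \<in> Z j" for a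
        using r(4)[of "norm a"] that j z unfolding \<eta>_def S_def by blast
      have uz: "u j z \<noteq> 0"
      proof
        assume "u j z = 0"
        then have "z \<in> Z j" using z r4 s by (simp add: Z_def)
        then show False using dist \<eta> by force
      qed
      have "norm (deriv (u j) z / u j z) \<le> Aj j / \<eta> + 8 * Aj j"
        by (rule ld(3)) (use z r4 \<eta> dist in auto)
      also have "\<dots> \<le> A / \<eta> + 8 * A" using AjA[OF j] \<eta> by (intro add_mono divide_right_mono mult_left_mono) auto
      also have "A / \<eta> \<le> A * (3 * (K * (1 + c1) + 2) * y / (\<tau> - 2))"
      proof -
        have "1 / \<eta> = 3 * (real N + 1) / ((\<tau> - 2) * s)" by (simp add: \<eta>_def left_diff_distrib)
        also have "\<dots> \<le> 3 * (real N + 1) / ((\<tau> - 2) * 1)"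
          using \<tau> s by (intro divide_left_mono mult_left_mono mult_pos_pos) auto
        also have "\<dots> \<le> 3 * (K * A + 2) / (\<tau> - 2)"
          unfolding mult_1_right using N(2) \<tau> by (intro divide_right_mono) auto
        also have "3 * (K * A + 2) \<le> 3 * (K * (1 + c1) + 2) * y"
          using y by (simp add: A_def algebra_simps)
        then have "3 * (K * A + 2) / (\<tau> - 2) \<le> 3 * (K * (1 + c1) + 2) * y / (\<tau> - 2)"
          using \<tau> by (intro divide_right_mono) auto
        finally have "1 / \<eta> \<le> 3 * (K * (1 + c1) + 2) * y / (\<tau> - 2)" .
        then have "A * (1 / \<eta>) \<le> A * (3 * (K * (1 + c1) + 2) * y / (\<tau> - 2))" using A0 by (intro mult_left_mono) auto
        then show ?thesis by simp
      qed
      also have "8 * A \<le> A * (8 * y)" using A0 y by simp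
      then have "A * (3 * (K * (1 + c1) + 2) * y / (\<tau> - 2)) + 8 * A \<le> A * (3 * (K * (1 + c1) + 2) * y / (\<tau> - 2)) + A * (8 * y)"
        by simp
      also have "\<dots> = c * y\<^sup>2" by (simp add: c_def A_def power2_eq_square algebra_simps add_divide_distrib)
      finally have "norm (deriv (u j) z / u j z) \<le> c * y\<^sup>2" by simp
      then show ?thesis using uz by (simp add: norm_divide divide_le_eq u_def)
    qed
    have "norm (u j z) \<le> (c * y\<^sup>2) ^ j * norm (g z)" if z: "norm z = r" and j: "j \<le> K" for z j
      using j
    proof (induction j)
      case (Suc j)
      have "norm (u (Suc j) z) \<le> c * y\<^sup>2 * norm (u j z)" using step[OF z] Suc by simp
      also have "\<dots> \<le> c * y\<^sup>2 * ((c * y\<^sup>2) ^ j * norm (g z))"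
        using Suc c by (intro mult_left_mono) auto
      finally show ?case by (simp add: mult_ac)
    qed (simp add: u_def)
    then show "\<exists>r\<in>{2 * s .. \<tau> * s} - X. \<forall>z j. norm z = r \<longrightarrow> j \<le> K \<longrightarrow>
          norm ((deriv ^^ j) g z) \<le> (c * (ln (max_modulus g (128 * s)))\<^sup>2) ^ j * norm (g z)"
      using r by (intro bexI[of _ r]) (auto simp: u_def y_def)
  qed
qed

lemma diff_monomial_entire:
  assumes "g holomorphic_on UNIV"
  shows "diff_monomial ns g holomorphic_on UNIV"
proof -
  have "(\<lambda>z. \<Prod>i<length ns. ((deriv ^^ i) g z) ^ (ns ! i)) holomorphic_on UNIV"
    by (intro holomorphic_intros higher_deriv_entire assms)
  then show ?thesis by (simp add: diff_monomial_def[abs_def])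
qed

text \<open>
  With \<open>W = g\<^sup>\<alpha>\<^sup>-\<^sup>1 Q\<close> one has \<open>log\<^sup>+ |G| \<ge> log\<^sup>+ |g| + ln |W| - E\<close> on the circle, where \<open>E\<close> bounds
  \<open>log\<^sup>+ |Q|\<close> at the points with \<open>|g| < 1\<close>; the mean of \<open>ln |W|\<close> is bounded below by Jensen's formula.
\<close>
lemma nevanlinna_char_diff_polynomial_lower:
  fixes g Q G :: "complex \<Rightarrow> complex"
  assumes g: "transcendental_entire g" and Q: "diff_polynomial_in g Q"
    and \<alpha>: "\<alpha> \<ge> 1" and G: "G = (\<lambda>z. g z ^ \<alpha> * Q z)" and Gnz: "\<exists>z. G z \<noteq> 0" and \<tau>: "2 < \<tau>" "\<tau> \<le> 3"
  obtains C :: real where "C \<ge> 0"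
    "\<And>s X. s \<ge> 1 \<Longrightarrow> 1 \<le> ln (max_modulus g (128 * s)) \<Longrightarrow> finite X \<Longrightarrow>
       \<exists>r\<in>{2 * s .. \<tau> * s} - X. ln (max_modulus g s) / 3 - C * (1 + ln (ln (max_modulus g (128 * s)))) \<le> nevanlinna_char G r"
proof -
  have gh: "g holomorphic_on UNIV" using g by (simp add: transcendental_entire_def)
  obtain nn :: nat and a :: "nat \<Rightarrow> complex" and ns :: "nat \<Rightarrow> nat list"
    where Qeq: "Q = (\<lambda>z. \<Sum>j=1..nn. a j * diff_monomial (ns j) g z)"
    using Q unfolding diff_polynomial_in_def by blast
  \<comment> \<open>\<open>K\<close> bounds the orders of the derivatives and \<open>L\<close> the
    degree of each monomial. On the circle chosen below, each monomial is therefore at most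
    \<open>B ^ (K * L)\<close> where \<open>norm (g z) < 1\<close>.\<close>
  define K where "K = (\<Sum>j=1..nn. length (ns j))"
  define L where "L = (\<Sum>j=1..nn. \<Sum>i<length (ns j). ns j ! i)"
  have lenK: "length (ns j) \<le> K" if "j \<in> {1..nn}" for j
    unfolding K_def by (rule member_le_sum) (use that in auto)
  have sumL: "(\<Sum>i<length (ns j). ns j ! i) \<le> L" if "j \<in> {1..nn}" for j
    unfolding L_def by (rule member_le_sum[where f="\<lambda>j. \<Sum>i<length (ns j). ns j ! i"]) (use that in auto)
  define W where "W = (\<lambda>z. g z ^ (\<alpha> - 1) * Q z)"
  have Qh: "Q holomorphic_on UNIV" unfolding Qeq by (intro holomorphic_intros diff_monomial_entire gh)
  have Wh: "W holomorphic_on UNIV" unfolding W_def by (intro holomorphic_intros gh Qh)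
  have GW: "G z = g z * W z" for z
    using \<alpha> by (cases \<alpha>) (auto simp: G W_def)
  have Gh: "G holomorphic_on UNIV" unfolding GW[abs_def] by (intro holomorphic_intros gh Wh)
  obtain y0 where y0: "G y0 \<noteq> 0" using Gnz by blast
  then have Wy0: "W y0 \<noteq> 0" by (simp add: GW)
  obtain kW VW where VW: "VW holomorphic_on UNIV" "VW 0 \<noteq> 0" "\<And>z. W z = z ^ kW * VW z"
    using entire_leading_factor[OF Wh Wy0] by metis
  obtain c :: real where c: "c \<ge> 1"
    "\<And>s X. s \<ge> 1 \<Longrightarrow> 1 \<le> ln (max_modulus g (128 * s)) \<Longrightarrow> finite X \<Longrightarrow>
       \<exists>r\<in>{2 * s .. \<tau> * s} - X. \<forall>z j. norm z = r \<longrightarrow> j \<le> K \<longrightarrow>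
          norm ((deriv ^^ j) g z) \<le> (c * (ln (max_modulus g (128 * s)))\<^sup>2) ^ j * norm (g z)"
    using log_deriv_bound_uniform[OF g \<tau>, of K] by metis
  define c3 where "c3 = 1 + (\<Sum>j=1..nn. norm (a j))"
  have c3: "c3 \<ge> 1" unfolding c3_def by (simp add: sum_nonneg)
  define C where "C = \<bar>ln (norm (VW 0))\<bar> + ln c3 + real (K * L) * ln c + 2 * real (K * L)"
  have C0: "ln c3 \<ge> 0" "ln c \<ge> 0" using c3 c(1) by auto
  show ?thesis
  proof (rule that[of C])
    show "C \<ge> 0" unfolding C_def using C0 by (intro add_nonneg_nonneg mult_nonneg_nonneg) auto
    fix s :: real and X :: "real set"
    assume s: "s \<ge> 1" and y1: "1 \<le> ln (max_modulus g (128 * s))" and X: "finite X"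
    define y where "y = ln (max_modulus g (128 * s))"
    have y: "y \<ge> 1" using y1 by (simp add: y_def)
    define B where "B = c * y\<^sup>2"
    have B: "B \<ge> 1" using mult_mono[of 1 c 1 "y\<^sup>2"] c(1) y by (simp add: B_def)
    \<comment> \<open>The moduli of the zeros of \<open>G\<close> are avoided too, so that
      \<open>g\<close> and \<open>W\<close> have no zeros on the circle and
      \<open>ln (norm (W z))\<close> is continuous there.\<close>
    have fin: "finite (X \<union> norm ` {z\<in>cball 0 (\<tau> * s). G z = 0})"
      using X entire_finite_zeros[OF Gh y0] by blast
    obtain r where r: "r \<in> {2 * s .. \<tau> * s}" "r \<notin> X" "r \<notin> norm ` {z\<in>cball 0 (\<tau> * s). G z = 0}"
      "\<And>z j. norm z = r \<Longrightarrow> j \<le> K \<Longrightarrow> norm ((deriv ^^ j) g z) \<le> B ^ j * norm (g z)"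
      using c(2)[OF s y1 fin] unfolding B_def y_def by blast
    have r1: "r \<ge> 1" and r0: "r > 0" using r(1) s by auto
    have Gnz: "G z \<noteq> 0" if "norm z = r" for z using r(1,3) that by force
    have gnz: "g z \<noteq> 0" and Wnz: "W z \<noteq> 0" if "norm z = r" for z using Gnz[OF that] by (auto simp: GW)
    define E where "E = ln (c3 * B ^ (K * L))"
    have cB: "1 * 1 \<le> c3 * B ^ (K * L)" using c3 B by (intro mult_mono one_le_power) auto
    then have E0: "E \<ge> 0" by (simp add: E_def)
    have Qle: "norm (Q z) \<le> c3 * B ^ (K * L)" if z: "norm z = r" and gz: "norm (g z) < 1" for z
    proof -
      have mono: "norm (diff_monomial (ns j) g z) \<le> B ^ (K * L)" if j: "j \<in> {1..nn}" for j
      proof -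
        have "norm (diff_monomial (ns j) g z) = (\<Prod>i<length (ns j). norm ((deriv ^^ i) g z) ^ (ns j ! i))"
          by (simp add: diff_monomial_def prod_norm[symmetric] norm_power)
        also have "\<dots> \<le> (\<Prod>i<length (ns j). (B ^ K) ^ (ns j ! i))"
        proof (intro prod_mono conjI power_mono)
          fix i assume "i \<in> {..<length (ns j)}"
          then have i: "i \<le> K" using lenK[OF j] by simp
          have "norm ((deriv ^^ i) g z) \<le> B ^ i * norm (g z)" by (rule r(4)[OF z i])
          also have "\<dots> \<le> B ^ i * 1" using gz B by (intro mult_left_mono) auto
          also have "\<dots> \<le> B ^ K" using B i by (simp add: power_increasing)
          finally show "norm ((deriv ^^ i) g z) \<le> B ^ K" .
        qed auto
        also have "\<dots> = (B ^ K) ^ (\<Sum>i<length (ns j). ns j ! i)" by (simp add: power_sum)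
        also have "\<dots> \<le> (B ^ K) ^ L" using sumL[OF j] B by (intro power_increasing one_le_power) auto
        finally show ?thesis by (simp add: power_mult)
      qed
      have "norm (Q z) \<le> (\<Sum>j=1..nn. norm (a j * diff_monomial (ns j) g z))" unfolding Qeq by (rule norm_sum)
      also have "\<dots> \<le> (\<Sum>j=1..nn. norm (a j) * B ^ (K * L))"
        unfolding norm_mult by (intro sum_mono mult_left_mono mono) auto
      also have "\<dots> = (\<Sum>j=1..nn. norm (a j)) * B ^ (K * L)" by (simp add: sum_distrib_right)
      also have "\<dots> \<le> c3 * B ^ (K * L)" unfolding c3_def using B by (intro mult_right_mono) auto
      finally show ?thesis .
    qed
    \<comment> \<open>For \<open>norm (g z) \<ge> 1\<close> the logarithm of the product splits
      exactly. For \<open>norm (g z) < 1\<close> the term of \<open>g\<close> is 0 and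
      \<open>W\<close> is dominated by \<open>Q\<close>, as \<open>\<alpha> - 1\<close> is a
      nonnegative exponent.\<close>
    have point: "log_plus (norm (g z)) + (ln (norm (W z)) - E) \<le> log_plus (norm (G z))" if z: "norm z = r" for z
    proof (cases "norm (g z) < 1")
      case False
      have "ln (norm (g z)) + ln (norm (W z)) = ln (norm (G z))"
        using gnz[OF z] Wnz[OF z] by (simp add: GW norm_mult ln_mult)
      moreover have "log_plus (norm (g z)) = ln (norm (g z))" using False by (simp add: log_plus_def)
      ultimately show ?thesis using E0 ln_le_log_plus[of "norm (G z)"] by linarith
    next
      case True
      have "norm (W z) = norm (g z) ^ (\<alpha> - 1) * norm (Q z)" by (simp add: W_def norm_mult norm_power)
      also have "\<dots> \<le> 1 * norm (Q z)" using True by (intro mult_right_mono power_le_one) auto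
      also have "\<dots> \<le> c3 * B ^ (K * L)" using Qle[OF z True] by simp
      finally have "ln (norm (W z)) \<le> E" unfolding E_def using Wnz[OF z] by (intro ln_mono) auto
      moreover have "log_plus (norm (g z)) = 0" using True gnz[OF z] by (simp add: log_plus_def)
      ultimately show ?thesis using log_plus_nonneg[of "norm (G z)"] by linarith
    qed
    have cg: "continuous_on (sphere 0 r) g" and cW: "continuous_on (sphere 0 r) W" and cG: "continuous_on (sphere 0 r) G"
      using gh Wh Gh holomorphic_on_imp_continuous_on holomorphic_on_subset by blast+
    have clW: "continuous_on (sphere 0 r) (\<lambda>z. ln (norm (W z)))"
      by (rule continuous_on_ln_norm[OF cW]) (use Wnz in simp)
    have "proximity_fun g r + (circle_mean (\<lambda>z. ln (norm (W z))) r - E)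
       = circle_mean (\<lambda>z. log_plus (norm (g z)) + (ln (norm (W z)) - E)) r"
      unfolding proximity_fun_eq_circle_mean
      by (subst circle_mean_add, intro continuous_on_log_plus_norm cg, intro continuous_intros clW, use r0 in simp,
          subst circle_mean_diff, intro clW, intro continuous_intros, use r0 in simp, simp)
    also have "\<dots> \<le> proximity_fun G r"
      unfolding proximity_fun_eq_circle_mean
      by (rule circle_mean_mono) (use r0 point in \<open>auto intro!: continuous_intros continuous_on_log_plus_norm cg cG clW\<close>)
    also have "\<dots> = nevanlinna_char G r" by (rule nevanlinna_char_entire[OF Gh r0, symmetric])
    finally have 1: "proximity_fun g r + circle_mean (\<lambda>z. ln (norm (W z))) r - E \<le> nevanlinna_char G r" by simp
    \<comment> \<open>Jensen's formula with all zeros discarded leaves the leading coefficient of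
      \<open>W\<close>.\<close>
    have 2: "ln (norm (VW 0)) \<le> circle_mean (\<lambda>z. ln (norm (W z))) r"
      using jensen_lower_bound[OF Wh Wnz r1 VW, of "{}"] by simp
    obtain w where w: "norm w = s" "norm (g w) = max_modulus g s"
      using max_modulus_attained[OF gh, of s] s by auto
    have ws: "norm w < r" "(r + norm w) / (r - norm w) \<le> 3" using r(1) s w by (auto simp: divide_simps)
    have "ln (max_modulus g s) \<le> log_plus (norm (g w))" unfolding w(2) by (rule ln_le_log_plus)
    also have "\<dots> \<le> (r + norm w) / (r - norm w) * proximity_fun g r"
      by (rule log_plus_le_proximity[OF gh gnz ws(1)])
    also have "\<dots> \<le> 3 * proximity_fun g r" by (intro mult_right_mono ws proximity_fun_nonneg)
    finally have 3: "ln (max_modulus g s) / 3 \<le> proximity_fun g r" by simp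
    \<comment> \<open>As \<open>B\<close> is quadratic in \<open>y\<close>, the error
      \<open>E\<close> is only of order \<open>ln y\<close>.\<close>
    have "E = ln c3 + real (K * L) * (ln c + 2 * ln y)"
      unfolding E_def B_def using c3 c(1) y by (simp add: ln_mult ln_realpow)
    also have "\<dots> = ln c3 + real (K * L) * ln c + 2 * real (K * L) * ln y" by (simp add: algebra_simps)
    finally have "E - ln (norm (VW 0)) \<le> \<bar>ln (norm (VW 0))\<bar> + ln c3 + real (K * L) * ln c + 2 * real (K * L) * ln y"
      by linarith
    also have "\<dots> \<le> C + C * ln y"
    proof (rule add_mono)
      show "\<bar>ln (norm (VW 0))\<bar> + ln c3 + real (K * L) * ln c \<le> C" by (simp add: C_def)
      show "2 * real (K * L) * ln y \<le> C * ln y"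
        using y C0 by (intro mult_right_mono) (auto simp: C_def)
    qed
    finally have 4: "E - ln (norm (VW 0)) \<le> C * (1 + ln y)" by (simp add: algebra_simps)
    have "ln (max_modulus g s) / 3 - C * (1 + ln y) \<le> nevanlinna_char G r" using 1 2 3 4 by linarith
    then show "\<exists>r\<in>{2 * s .. \<tau> * s} - X. ln (max_modulus g s) / 3 - C * (1 + ln (ln (max_modulus g (128 * s)))) \<le> nevanlinna_char G r"
      using r by (intro bexI[of _ r]) (auto simp: y_def)
  qed
qed

section \<open>Iterated logarithms\<close>

lemma iter_log_0 [simp]: "iter_log 0 x = x" by (simp add: iter_log_def)

lemma iter_log_Suc: "iter_log (Suc k) x = ln (iter_log k x)" by (simp add: iter_log_def)

lemma iter_log_1 [simp]: "iter_log (Suc 0) x = ln x" by (simp add: iter_log_Suc)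

lemma iter_log_add: "iter_log (j + k) x = iter_log j (iter_log k x)"
  by (simp add: iter_log_def funpow_add)

lemma iter_log_ln: "iter_log k (ln x) = iter_log (Suc k) x"
  using iter_log_add[of k 1 x] by simp

lemma filterlim_iter_log: "filterlim (iter_log k) at_top at_top"
proof (induction k)
  case 0
  show ?case by (simp add: filterlim_ident iter_log_0[abs_def])
next
  case (Suc k)
  have "filterlim (\<lambda>x. ln (iter_log k x)) at_top at_top"
    by (rule filterlim_compose[OF ln_at_top Suc])
  then show ?case by (simp add: iter_log_Suc[abs_def])
qed

text \<open>The range in which iterated logarithms are used as increasing functions;
  \<open>x\<close> itself is included as the iterate with index 0. The bound 2, rather than mere
  positivity, gives \<open>a + b \<le> a * b\<close> for two iterates \<open>a\<close> and
  \<open>b\<close>.\<close>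

definition log_domain :: "nat \<Rightarrow> real \<Rightarrow> bool" where
  "log_domain k x \<longleftrightarrow> (\<forall>j\<le>k. 2 \<le> iter_log j x)"

lemma log_domainD: "log_domain k x \<Longrightarrow> j \<le> k \<Longrightarrow> 2 \<le> iter_log j x"
  by (simp add: log_domain_def)

lemma log_domain_ge: "log_domain k x \<Longrightarrow> 2 \<le> x"
  using log_domainD[of k x 0] by simp

lemma log_domain_le: "log_domain k x \<Longrightarrow> j \<le> k \<Longrightarrow> log_domain j x"
  by (simp add: log_domain_def)

lemma log_domain_iter_log: "log_domain (j + k) x \<Longrightarrow> log_domain j (iter_log k x)"
  by (auto simp: log_domain_def iter_log_add[symmetric])

lemma iter_log_mono:
  assumes "log_domain k x" "x \<le> y"
  shows "iter_log k x \<le> iter_log k y"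
  using assms(1)
proof (induction k)
  case (Suc k)
  have "2 \<le> iter_log k x" using Suc.prems by (rule log_domainD) simp
  moreover have "iter_log k x \<le> iter_log k y" by (rule Suc.IH[OF log_domain_le[OF Suc.prems]]) simp
  ultimately show ?case by (simp add: iter_log_Suc)
qed (use assms in simp)

lemma log_domain_mono:
  assumes "log_domain k x" "x \<le> y"
  shows "log_domain k y"
  unfolding log_domain_def
proof safe
  fix j assume j: "j \<le> k"
  have "2 \<le> iter_log j x" using assms(1) j by (rule log_domainD)
  also have "\<dots> \<le> iter_log j y" using assms j by (intro iter_log_mono) (auto intro: log_domain_le)
  finally show "2 \<le> iter_log j y" .
qed

lemma eventually_log_domain: "eventually (log_domain k) at_top"
proof -
  have "eventually (\<lambda>x. \<forall>j\<in>{..k}. 2 \<le> iter_log j x) at_top"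
  proof (rule eventually_ball_finite)
    show "\<forall>j\<in>{..k}. eventually (\<lambda>x. 2 \<le> iter_log j x) at_top"
      using filterlim_iter_log unfolding filterlim_at_top by blast
  qed simp
  then show ?thesis by eventually_elim (auto simp: log_domain_def)
qed

lemma log_domain_ex: "\<exists>A. log_domain k A \<and> B \<le> A"
proof -
  have "eventually (\<lambda>x. log_domain k x \<and> B \<le> x) at_top"
    by (intro eventually_conj eventually_log_domain eventually_ge_at_top)
  from eventually_happens[OF this] show ?thesis by simp
qed

text \<open>In the inductive step \<open>a + b \<le> a * b\<close> for \<open>a, b \<ge> 2\<close>,
  so \<open>ln (a + b) \<le> ln a + ln b\<close>. Once a logarithm is taken, a constant factor costs
  only an additive constant, which is negligible against \<open>iter_log k\<close>.\<close>

lemma iter_log_mult_le: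
  assumes "log_domain k x" "log_domain k y" "k \<ge> 1"
  shows "iter_log k (x * y) \<le> iter_log k x + iter_log k y"
  using assms(3,1,2)
proof (induction k rule: dec_induct)
  case base
  then show ?case using log_domain_ge[of 1 x] log_domain_ge[of 1 y] by (simp add: ln_mult)
next
  case (step k)
  have dx: "log_domain k x" and dy: "log_domain k y" by (rule log_domain_le[OF _ le_SucI[OF le_refl]], rule step.prems)+
  have ge: "2 \<le> iter_log k x" "2 \<le> iter_log k y" using dx dy log_domainD by blast+
  have "x * 1 \<le> x * y" using log_domain_ge[OF dx] log_domain_ge[OF dy] by (intro mult_left_mono) auto
  then have pos: "2 \<le> iter_log k (x * y)" using iter_log_mono[OF dx, of "x * y"] ge by simp
  have "iter_log k (x * y) \<le> iter_log k x + iter_log k y" by (rule step.IH[OF dx dy])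
  also have "\<dots> \<le> iter_log k x * iter_log k y"
  proof -
    have "0 \<le> (iter_log k x - 1) * (iter_log k y - 1) - 1"
      using mult_mono[of 1 "iter_log k x - 1" 1 "iter_log k y - 1"] ge by simp
    then show ?thesis by (simp add: algebra_simps)
  qed
  finally have "ln (iter_log k (x * y)) \<le> ln (iter_log k x * iter_log k y)"
    using pos by (intro ln_mono) auto
  then show ?case using ge by (simp add: iter_log_Suc ln_mult)
qed

lemma iter_log_antimono:
  assumes "log_domain k x" "j \<le> k"
  shows "iter_log k x \<le> iter_log j x"
  using assms(2,1)
proof (induction k rule: dec_induct)
  case (step k)
  have "2 \<le> iter_log k x" using step.prems by (rule log_domainD) simp
  then have "ln (iter_log k x) \<le> iter_log k x" using ln_le_minus_one[of "iter_log k x"] by simp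
  moreover have "iter_log k x \<le> iter_log j x" by (rule step.IH[OF log_domain_le[OF step.prems]]) simp
  ultimately show ?case by (simp add: iter_log_Suc)
qed simp

section \<open>Asymptotic estimates with iterated logarithms\<close>

lemma eventually_ln_le:
  assumes "c > 0"
  shows "eventually (\<lambda>x::real. ln x \<le> c * x) at_top"
proof -
  have "((\<lambda>x::real. ln x / x) \<longlongrightarrow> 0) at_top" by (rule ln_x_over_x_tendsto_0)
  then have "eventually (\<lambda>x::real. ln x / x < c) at_top" using assms by (rule order_tendstoD)
  then show ?thesis using eventually_gt_at_top[of 0]
    by eventually_elim (simp add: divide_less_eq mult.commute)
qed

text \<open>As \<open>k \<ge> 1\<close>, the product becomes a sum. The constant contributes a
  constant, the factor \<open>ln M\<close> contributes \<open>iter_log (Suc k) M\<close>, which is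
  at most \<open>ln (iter_log q M)\<close>, and having \<open>R\<close> or \<open>2 * R\<close> in
  place of \<open>M\<close> adds a constant inside \<open>iter_log q\<close>.\<close>

lemma iter_log_upper_bound:
  fixes T :: "real \<Rightarrow> real"
  assumes lim: "\<And>e. e > 0 \<Longrightarrow> eventually (\<lambda>t. iter_log k (T t) \<le> (\<rho> + e) * iter_log q t) at_top"
    and \<rho>: "\<rho> \<ge> 0" and q: "1 \<le> q" "q \<le> k" and C: "C \<ge> 0" and e: "e > 0"
  shows "eventually (\<lambda>M. \<forall>R X. 2 * M \<le> R \<longrightarrow> R \<le> 4 * M \<longrightarrow> log_domain k X \<longrightarrow>
      X \<le> C * (1 + ln R) * (T R + T (2 * R)) \<longrightarrow> iter_log k X \<le> (\<rho> + e) * iter_log q M) at_top"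
proof -
  \<comment> \<open>The 8 is needed because \<open>2 * R \<le> 8 * M\<close>, which must be at most
    \<open>A * M\<close>.\<close>
  obtain A where A: "log_domain k A" "8 \<le> A" using log_domain_ex by blast
  obtain A2 where A2: "log_domain k A2" "max A (8 * C) \<le> A2" using log_domain_ex by blast
  \<comment> \<open>One third each for the limit hypothesis, for the factor \<open>ln M\<close> and
    for the constants collected in \<open>K0\<close>.\<close>
  define d where "d = e / 3"
  have d: "d > 0" using e by (simp add: d_def)
  define K0 where "K0 = iter_log k A2 + iter_log k A + (\<rho> + d) * iter_log q A"
  have Aq: "log_domain q A" using A(1) q(2) by (rule log_domain_le)
  obtain t0 where t0: "\<And>t. t \<ge> t0 \<Longrightarrow> iter_log k (T t) \<le> (\<rho> + d) * iter_log q t"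
    using lim[OF d] by (auto simp: eventually_at_top_linorder)
  have 1: "eventually (\<lambda>M. log_domain (Suc k) M) at_top" by (rule eventually_log_domain)
  have 2: "eventually (\<lambda>M. K0 \<le> d * iter_log q M) at_top"
  proof -
    have "eventually (\<lambda>M. K0 / d \<le> iter_log q M) at_top" using filterlim_iter_log unfolding filterlim_at_top by blast
    then show ?thesis by eventually_elim (use d in \<open>simp add: divide_le_eq mult.commute\<close>)
  qed
  have 3: "eventually (\<lambda>M. ln (iter_log q M) \<le> d * iter_log q M) at_top"
    by (rule eventually_compose_filterlim[OF eventually_ln_le[OF d] filterlim_iter_log])
  have 4: "eventually (\<lambda>M. A \<le> ln M) at_top" using ln_at_top by (auto simp: filterlim_at_top)
  show ?thesis using 1 2 3 4 eventually_ge_at_top[of t0] eventually_ge_at_top[of A]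
  proof eventually_elim
    case (elim M)
    show ?case
    proof safe
      fix R X
      assume R: "2 * M \<le> R" "R \<le> 4 * M" and X: "log_domain k X" and XT: "X \<le> C * (1 + ln R) * (T R + T (2 * R))"
      \<comment> \<open>The maximum with \<open>A\<close> keeps \<open>U\<close> in the logarithmic
        domain even where the values of \<open>T\<close> are small.\<close>
      define U where "U = max A (max (T R) (T (2 * R)))"
      have lnM: "ln M \<ge> 8" using elim A by linarith
      have M8: "M \<ge> 8" using elim A by linarith
      have dM: "log_domain q M" by (rule log_domain_le[OF elim(1)]) (use q in simp)
      have dU: "log_domain k U" using A(1) by (rule log_domain_mono) (simp add: U_def)
      have dlnM: "log_domain k (ln M)" using log_domain_iter_log[of k 1 M] elim(1) by simp
      have Upos: "U > 0" using log_domain_ge[OF dU] by simp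
      have "X \<le> C * (1 + ln R) * (2 * U)"
      proof -
        have "T R + T (2 * R) \<le> 2 * U" by (simp add: U_def)
        moreover have "0 \<le> C * (1 + ln R)" using C R M8 by (intro mult_nonneg_nonneg add_nonneg_nonneg ln_ge_zero) auto
        ultimately have "C * (1 + ln R) * (T R + T (2 * R)) \<le> C * (1 + ln R) * (2 * U)" by (rule mult_left_mono)
        then show ?thesis using XT by simp
      qed
      also have "\<dots> = 2 * C * (1 + ln R) * U" by simp
      also have "\<dots> \<le> 2 * C * (4 * ln M) * U"
      proof (intro mult_right_mono mult_left_mono)
        have "ln R \<le> ln (4 * M)" using R M8 by (intro ln_mono) auto
        also have "\<dots> = ln 4 + ln M" using M8 by (simp add: ln_mult)
        also have "ln (4::real) \<le> 3" using ln_le_minus_one[of "4::real"] by simp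
        finally show "1 + ln R \<le> 4 * ln M" using lnM by simp
      qed (use C Upos in auto)
      also have "\<dots> = 8 * C * ln M * U" by simp
      also have "\<dots> \<le> A2 * ln M * U" using A2 lnM Upos by (intro mult_right_mono) auto
      finally have XU: "X \<le> (A2 * ln M) * U" .
      have dA2: "log_domain k (A2 * ln M)"
      proof (rule log_domain_mono[OF A2(1)])
        have "A2 * 1 \<le> A2 * ln M" using lnM log_domain_ge[OF A2(1)] by (intro mult_left_mono) auto
        then show "A2 \<le> A2 * ln M" by simp
      qed
      have k1: "k \<ge> 1" using q by simp
      have "iter_log k X \<le> iter_log k ((A2 * ln M) * U)" by (rule iter_log_mono[OF X XU])
      also have "\<dots> \<le> iter_log k (A2 * ln M) + iter_log k U" by (rule iter_log_mult_le[OF dA2 dU k1])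
      also have "iter_log k (A2 * ln M) \<le> iter_log k A2 + iter_log k (ln M)" by (rule iter_log_mult_le[OF A2(1) dlnM k1])
      also have "iter_log k (ln M) = iter_log (Suc k) M" by (rule iter_log_ln)
      also have "\<dots> \<le> iter_log (Suc q) M" using q by (intro iter_log_antimono[OF elim(1)]) simp
      also have "\<dots> \<le> d * iter_log q M" using elim(3) by (simp add: iter_log_Suc)
      also have "iter_log k U \<le> iter_log k A + (\<rho> + d) * (iter_log q A + iter_log q M)"
      proof -
        have bound: "(\<rho> + d) * iter_log q t \<le> (\<rho> + d) * (iter_log q A + iter_log q M)" if t: "t = R \<or> t = 2 * R" for t
        proof (rule mult_left_mono)
          have tM: "t \<le> A * M"
          proof -
            have "t \<le> 8 * M" using t R M8 by auto
            also have "\<dots> \<le> A * M" using A M8 by (intro mult_right_mono) auto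
            finally show ?thesis .
          qed
          have "log_domain q t" using dM by (rule log_domain_mono) (use t R M8 in auto)
          then have "iter_log q t \<le> iter_log q (A * M)" using tM by (rule iter_log_mono)
          also have "\<dots> \<le> iter_log q A + iter_log q M" by (rule iter_log_mult_le[OF Aq dM q(1)])
          finally show "iter_log q t \<le> iter_log q A + iter_log q M" .
        qed (use \<rho> d in simp)
        have kA: "iter_log k A \<ge> 0" using log_domainD[OF A(1), of k] by simp
        have "iter_log q A \<ge> 0" "iter_log q M \<ge> 0" using log_domainD[OF Aq, of q] log_domainD[OF dM, of q] by auto
        then have nn: "(\<rho> + d) * (iter_log q A + iter_log q M) \<ge> 0" using \<rho> d by (intro mult_nonneg_nonneg) auto
        consider "U = A" | "U = T R" | "U = T (2 * R)" unfolding U_def max_def by metis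
        then show ?thesis
        proof cases
          case 2
          have "iter_log k (T R) \<le> (\<rho> + d) * iter_log q R" by (rule t0) (use elim R M8 in auto)
          then show ?thesis using bound[of R] kA 2 by simp
        next
          case 3
          have "iter_log k (T (2 * R)) \<le> (\<rho> + d) * iter_log q (2 * R)" by (rule t0) (use elim R M8 in auto)
          then show ?thesis using bound[of "2 * R"] kA 3 by simp
        qed (use nn in simp)
      qed
      finally have "iter_log k X \<le> iter_log k A2 + d * iter_log q M + (iter_log k A + (\<rho> + d) * (iter_log q A + iter_log q M))"
        by simp
      also have "\<dots> = K0 + (\<rho> + 2 * d) * iter_log q M" by (simp add: K0_def algebra_simps)
      also have "\<dots> \<le> d * iter_log q M + (\<rho> + 2 * d) * iter_log q M" using elim(2) by simp
      also have "\<dots> = (\<rho> + e) * iter_log q M" by (simp add: d_def algebra_simps)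
      finally show "iter_log k X \<le> (\<rho> + e) * iter_log q M" .
    qed
  qed
qed

lemma eventually_const_le_iter_log:
  assumes "e > 0"
  shows "eventually (\<lambda>x. c \<le> e * iter_log k x) at_top"
proof -
  have "eventually (\<lambda>x. c / e \<le> iter_log k x) at_top" using filterlim_iter_log unfolding filterlim_at_top by blast
  then show ?thesis by eventually_elim (use assms in \<open>simp add: divide_le_eq mult.commute\<close>)
qed

text \<open>With at least one more logarithm the factor \<open>B\<close> becomes an additive
  constant, so the leading constant is 1 whatever \<open>B\<close> is. This is why the order of
  \<open>f\<close> does not appear in (ii).\<close>

lemma iter_log_shift_bound:
  assumes n: "n \<ge> 1" and e: "e > 0"
  shows "eventually (\<lambda>M. \<forall>Y. log_domain n Y \<longrightarrow> Y \<le> B * iter_log q M \<longrightarrow> iter_log n Y \<le> (1 + e) * iter_log (n + q) M) at_top"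
proof -
  obtain A where A: "log_domain n A" "B \<le> A" using log_domain_ex by blast
  show ?thesis using eventually_log_domain[of "n + q"] eventually_const_le_iter_log[OF e, of "iter_log n A" "n + q"]
  proof eventually_elim
    case (elim M)
    have d: "log_domain n (iter_log q M)" by (rule log_domain_iter_log[OF elim(1)])
    have q0: "0 \<le> iter_log q M" using log_domain_ge[OF d] by simp
    show ?case
    proof safe
      fix Y assume Y: "log_domain n Y" "Y \<le> B * iter_log q M"
      note Y(2)
      also have "B * iter_log q M \<le> A * iter_log q M" using A q0 by (intro mult_right_mono)
      finally have "iter_log n Y \<le> iter_log n (A * iter_log q M)" by (rule iter_log_mono[OF Y(1)])
      also have "\<dots> \<le> iter_log n A + iter_log n (iter_log q M)" by (rule iter_log_mult_le[OF A(1) d n])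
      also have "\<dots> = iter_log n A + iter_log (n + q) M" by (simp add: iter_log_add)
      also have "\<dots> \<le> (1 + e) * iter_log (n + q) M" using elim(2) by (simp add: distrib_right)
      finally show "iter_log n Y \<le> (1 + e) * iter_log (n + q) M" .
    qed
  qed
qed

text \<open>The cases of the theorem are merged. For \<open>l - 1 \<le> q\<close>,
  \<open>iter_log q M\<close> is at most \<open>iter_log (l - 1) M\<close> and the factor
  \<open>\<rho>\<close> stays. Otherwise \<open>l - 1 - q\<close> further logarithms reach depth
  \<open>l - 1\<close>, which explains \<open>N\<close>, and reduce the factor to 1.\<close>

lemma iter_log_numerator_bound:
  fixes T :: "real \<Rightarrow> real" and p q l :: nat
  assumes lim: "\<And>e. e > 0 \<Longrightarrow> eventually (\<lambda>t. iter_log (p - 1) (T t) \<le> (\<rho> + e) * iter_log q t) at_top"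
    and \<rho>: "\<rho> \<ge> 0" and q: "1 \<le> q" "q < p" and l: "2 \<le> l" and C: "C \<ge> 0" and e: "e > 0"
    and N: "N = (if l - 1 \<le> q then p - 1 else p + l - q - 2)" and \<sigma>: "\<sigma> = (if l - 1 \<le> q then \<rho> else 1)"
  shows "eventually (\<lambda>M. \<forall>R X. 2 * M \<le> R \<longrightarrow> R \<le> 4 * M \<longrightarrow> log_domain N X \<longrightarrow>
      X \<le> C * (1 + ln R) * (T R + T (2 * R)) \<longrightarrow> iter_log N X \<le> (\<sigma> + e) * iter_log (l - 1) M) at_top"
proof -
  have qk: "q \<le> p - 1" using q by simp
  have ub: "eventually (\<lambda>M. \<forall>R X. 2 * M \<le> R \<longrightarrow> R \<le> 4 * M \<longrightarrow> log_domain (p - 1) X \<longrightarrow>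
      X \<le> C * (1 + ln R) * (T R + T (2 * R)) \<longrightarrow> iter_log (p - 1) X \<le> (\<rho> + d) * iter_log q M) at_top"
    if "d > 0" for d
    by (rule iter_log_upper_bound[OF _ \<rho> q(1) qk C that]) (rule lim)
  show ?thesis
  proof (cases "l - 1 \<le> q")
    case True
    show ?thesis
      using ub[OF e] eventually_log_domain[of q]
    proof eventually_elim
      case (elim M)
      have "(\<rho> + e) * iter_log q M \<le> (\<rho> + e) * iter_log (l - 1) M"
        using iter_log_antimono[OF elim(2) True] \<rho> e by (intro mult_left_mono) auto
      then show ?case using elim(1) True unfolding N \<sigma> by (auto intro: order_trans)
    qed
  next
    case False
    define n where "n = l - 1 - q"
    have n: "n \<ge> 1" "l - 1 = n + q" "p + l - q - 2 = n + (p - 1)" using False q l by (auto simp: n_def)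
    \<comment> \<open>Any fixed error serves here, since the factor \<open>\<rho> + 1\<close> is
      swallowed by the further logarithms.\<close>
    have one: "(1::real) > 0" by simp
    show ?thesis
      using ub[OF one] iter_log_shift_bound[OF n(1) e, of "\<rho> + 1" q]
    proof eventually_elim
      case (elim M)
      show ?case
      proof safe
        fix R X assume R: "2 * M \<le> R" "R \<le> 4 * M" and X: "log_domain N X" "X \<le> C * (1 + ln R) * (T R + T (2 * R))"
        have X': "log_domain (n + (p - 1)) X" using X(1) False n by (simp add: N)
        have "log_domain (p - 1) X" by (rule log_domain_le[OF X']) simp
        then have "iter_log (p - 1) X \<le> (\<rho> + 1) * iter_log q M" using elim(1) R X(2) by blast
        then have "iter_log n (iter_log (p - 1) X) \<le> (1 + e) * iter_log (n + q) M"
          using elim(2) log_domain_iter_log[OF X'] by blast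
        moreover have "N = n + (p - 1)" "\<sigma> = 1" using False n by (simp_all add: N \<sigma>)
        ultimately show "iter_log N X \<le> (\<sigma> + e) * iter_log (l - 1) M"
          unfolding n(2) by (simp only: iter_log_add)
      qed
    qed
  qed
qed

text \<open>If the claim failed, then \<open>v = iter_log (k - 1) x\<close> would satisfy \<open>v = O(ln v)\<close>.\<close>
lemma ln_le_of_iter_log_le:
  fixes B c :: real
  assumes c: "c > 0" and B: "B \<ge> 1"
  shows "eventually (\<lambda>x. \<forall>y\<ge>x. iter_log k y \<le> B * iter_log k x \<longrightarrow> ln y \<le> c * x) at_top"
proof (cases k)
  case 0
  have "eventually (\<lambda>x. ln B + ln x \<le> c * x) at_top"
  proof -
    have "eventually (\<lambda>x. ln B \<le> c / 2 * x) at_top" using eventually_const_le_iter_log[of "c/2" "ln B" 0] c by simp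
    moreover have "eventually (\<lambda>x. ln x \<le> c / 2 * x) at_top" using c by (intro eventually_ln_le) simp
    ultimately show ?thesis by eventually_elim simp
  qed
  then show ?thesis using eventually_ge_at_top[of 1]
  proof eventually_elim
    case (elim x)
    show ?case
    proof safe
      fix y assume y: "x \<le> y" "iter_log k y \<le> B * iter_log k x"
      then have "ln y \<le> ln (B * x)" using elim 0 by (intro ln_mono) auto
      also have "\<dots> \<le> c * x" using elim B by (simp add: ln_mult)
      finally show "ln y \<le> c * x" .
    qed
  qed
next
  case (Suc k')
  obtain A where A: "log_domain k' A" "max 1 (1 / c) \<le> A" using log_domain_ex by blast
  \<comment> \<open>The loss caused by the scaling with \<open>c\<close>: a factor
    \<open>1 / c\<close> if \<open>k' = 0\<close>, and at most 2 otherwise, when the scaling only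
    adds a constant.\<close>
  define D where "D = max 2 (1 / c)"
  have D: "D > 0" by (simp add: D_def)
  have cx: "filterlim (\<lambda>x. c * x) at_top at_top"
    by (rule filterlim_tendsto_pos_mult_at_top[OF tendsto_const c filterlim_ident])
  have 1: "eventually (\<lambda>x. log_domain k' (c * x)) at_top"
    by (rule eventually_compose_filterlim[OF eventually_log_domain cx])
  have 2: "eventually (\<lambda>x. iter_log k' A \<le> 1 * iter_log k' (c * x)) at_top"
    by (rule eventually_compose_filterlim[OF eventually_const_le_iter_log cx]) simp
  \<comment> \<open>With this slope \<open>B * ln v\<close> is at most \<open>v / (2 * D)\<close>,
    and the estimates combine to the contradiction \<open>v \<le> v / 2\<close>.\<close>
  have "1 / (2 * B * D) > 0" using B D by simp
  from eventually_compose_filterlim[OF eventually_ln_le[OF this] filterlim_iter_log]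
  have 3: "eventually (\<lambda>x. ln (iter_log k' x) \<le> 1 / (2 * B * D) * iter_log k' x) at_top" .
  show ?thesis using 1 2 3 eventually_log_domain[of k]
  proof eventually_elim
    case (elim x)
    define v where "v = iter_log k' x"
    have v: "v \<ge> 2" unfolding v_def using elim(4) Suc by (intro log_domainD) auto
    have x2: "x \<ge> 2" using log_domain_ge[OF elim(4)] .
    have vD: "v \<le> D * iter_log k' (c * x)"
    proof (cases "k' = 0")
      case True
      have "1 = 1 / c * c" using c by simp
      also have "\<dots> \<le> D * c" using c by (intro mult_right_mono) (auto simp: D_def)
      finally have "1 * x \<le> D * c * x" using x2 by (intro mult_right_mono) auto
      then show ?thesis using True by (simp add: v_def mult.assoc)
    next
      case False
      have "1 = 1 / c * c" using c by simp
      also have "\<dots> \<le> A * c" using c A by (intro mult_right_mono) auto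
      finally have "1 * x \<le> A * c * x" using x2 by (intro mult_right_mono) auto
      then have "x \<le> A * (c * x)" by (simp add: mult.assoc)
      moreover have "log_domain k' x" by (rule log_domain_le[OF elim(4)]) (simp add: Suc)
      ultimately have "v \<le> iter_log k' (A * (c * x))" unfolding v_def by (intro iter_log_mono)
      also have "\<dots> \<le> iter_log k' A + iter_log k' (c * x)" using False by (intro iter_log_mult_le A elim) simp
      also have "\<dots> \<le> 2 * iter_log k' (c * x)" using elim(2) by simp
      also have "\<dots> \<le> D * iter_log k' (c * x)"
        using log_domainD[OF elim(1), of k'] by (intro mult_right_mono) (auto simp: D_def)
      finally show ?thesis .
    qed
    show ?case
    proof safe
      fix y assume y: "x \<le> y" "iter_log k y \<le> B * iter_log k x"
      show "ln y \<le> c * x"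
      proof (rule ccontr)
        assume "\<not> ln y \<le> c * x"
        then have "iter_log k' (c * x) \<le> iter_log k' (ln y)" by (intro iter_log_mono elim) simp
        also have "\<dots> = iter_log k y" by (simp add: iter_log_ln Suc)
        also have "\<dots> \<le> B * ln v" using y(2) by (simp add: Suc iter_log_Suc v_def)
        also have "\<dots> \<le> B * (1 / (2 * B * D) * v)" using elim(3) B by (intro mult_left_mono) (auto simp: v_def)
        also have "\<dots> = v / (2 * D)" using B by simp
        finally have "D * iter_log k' (c * x) \<le> D * (v / (2 * D))" using D by (intro mult_left_mono) auto
        also have "\<dots> = v / 2" using D by simp
        finally show False using vD v by simp
      qed
    qed
  qed
qed

text \<open>Meant for \<open>x = ln (max_modulus g s)\<close> and
  \<open>y = ln (max_modulus g (128 * s))\<close>. Regular growth makes \<open>ln y\<close> small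
  against \<open>x\<close>, so \<open>T \<ge> (1 - e) / 3 * x\<close>. For \<open>k \<ge> 1\<close>
  the factor 1/3 turns into an additive constant; for \<open>k = 0\<close> it remains, as recorded
  in \<open>\<kappa>\<close>.\<close>

lemma iter_log_denominator_bound:
  fixes C B e :: real
  assumes C: "C \<ge> 0" and B: "B \<ge> 1" and e: "0 < e" "e < 1" and \<kappa>: "\<kappa> = (if k = 0 then 1 / 3 else 1)"
  shows "eventually (\<lambda>x. \<forall>y T. x \<le> y \<longrightarrow> iter_log k y \<le> B * iter_log k x \<longrightarrow> x / 3 - C * (1 + ln y) \<le> T \<longrightarrow>
    \<kappa> * (1 - e) * iter_log k x \<le> iter_log k T) at_top"
proof -
  \<comment> \<open>Ensures \<open>C * ln y \<le> e / 6 * x\<close>; another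
    \<open>e / 6 * x\<close> covers the summand \<open>C\<close>.\<close>
  define c where "c = e / (6 * (C + 1))"
  have c: "c > 0" using e C by (simp add: c_def)
  obtain A where A: "log_domain k A" "3 / (1 - e) \<le> A" using log_domain_ex by blast
  have 1: "eventually (\<lambda>x. C \<le> e / 6 * x) at_top" using eventually_const_le_iter_log[of "e/6" C 0] e by simp
  have 2: "eventually (\<lambda>x. iter_log k A \<le> e * iter_log k x) at_top" by (rule eventually_const_le_iter_log[OF e(1)])
  have "filterlim (\<lambda>x. (1 - e) / 3 * x) at_top at_top"
    by (rule filterlim_tendsto_pos_mult_at_top[OF tendsto_const _ filterlim_ident]) (use e in simp)
  from eventually_compose_filterlim[OF eventually_log_domain this]
  have 3: "eventually (\<lambda>x. log_domain k ((1 - e) / 3 * x)) at_top" .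
  show ?thesis using 1 2 3 ln_le_of_iter_log_le[OF c B, of k] eventually_log_domain[of k]
  proof eventually_elim
    case (elim x)
    show ?case
    proof safe
      fix y T assume y: "x \<le> y" "iter_log k y \<le> B * iter_log k x" and T: "x / 3 - C * (1 + ln y) \<le> T"
      have x2: "x \<ge> 2" using log_domain_ge[OF elim(5)] .
      have "ln y \<le> c * x" using elim(4) y by blast
      then have "C * ln y \<le> C * (c * x)" using C by (intro mult_left_mono)
      also have "\<dots> \<le> (C + 1) * (c * x)" using c x2 by (intro mult_right_mono) auto
      also have "\<dots> = (C + 1) * c * x" by simp
      also have "(C + 1) * c = e / 6" using C by (simp add: c_def divide_simps)
      finally have "C * (1 + ln y) \<le> e / 3 * x" using elim(1) by (simp add: distrib_left)
      then have T1: "(1 - e) / 3 * x \<le> T" using T by (simp add: left_diff_distrib diff_divide_distrib)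
      show "\<kappa> * (1 - e) * iter_log k x \<le> iter_log k T"
      proof (cases "k = 0")
        case True
        then show ?thesis using T1 by (simp add: \<kappa>)
      next
        case False
        have dT: "log_domain k T" by (rule log_domain_mono[OF elim(3) T1])
        have T0: "T \<ge> 0" using log_domain_ge[OF dT] by simp
        have "x = 3 / (1 - e) * ((1 - e) / 3 * x)" using e by simp
        also have "\<dots> \<le> 3 / (1 - e) * T" using T1 e by (intro mult_left_mono) auto
        also have "\<dots> \<le> A * T" using A T0 by (intro mult_right_mono)
        finally have "iter_log k x \<le> iter_log k (A * T)" by (rule iter_log_mono[OF elim(5)])
        also have "\<dots> \<le> iter_log k A + iter_log k T" by (rule iter_log_mult_le[OF A(1) dT]) (use False in simp)
        finally show ?thesis using elim(2) False by (simp add: \<kappa> algebra_simps)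
      qed
    qed
  qed
qed

text \<open>
  If the claim failed, \<open>\<psi> r / r powr \<nu>\<close> would increase along a geometric progression with bounded
  gaps, hence be bounded below.
\<close>
lemma regular_growth_scale:
  fixes \<psi> :: "real \<Rightarrow> real" and J :: nat
  assumes mono: "\<And>r s. s0 \<le> r \<Longrightarrow> r \<le> s \<Longrightarrow> \<psi> r \<le> \<psi> s" and pos: "\<And>r. s0 \<le> r \<Longrightarrow> \<psi> r > 0"
    and b: "b > 1" and \<mu>: "0 < \<mu>" "\<mu> < \<nu>" and freq: "frequently (\<lambda>r. ln (\<psi> r) / ln r < \<mu>) at_top"
  shows "\<exists>s\<ge>s1. \<forall>j\<le>J. \<psi> (b ^ j * s) \<le> (b ^ j) powr \<nu> * \<psi> s"
proof (rule ccontr)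
  assume neg: "\<not> ?thesis"
  define a where "a = max 1 (max s0 s1)"
  have a: "a \<ge> 1" "a \<ge> s0" "a \<ge> s1" by (auto simp: a_def)
  define \<omega> where "\<omega> = (\<lambda>r. \<psi> r / r powr \<nu>)"
  have bn: "b ^ n \<ge> 1" for n using b by (simp add: one_le_power)
  have ab: "b ^ n * a \<ge> a" for n using bn[of n] a mult_right_mono[of 1 "b ^ n" a] by simp
  have grow: "\<exists>j\<le>J. j \<ge> 1 \<and> \<omega> s < \<omega> (b ^ j * s)" if s: "s \<ge> a" for s
  proof -
    have s0: "s > 0" using s a by simp
    have "s \<ge> s1" using s a by simp
    then obtain j where j: "j \<le> J" "\<not> \<psi> (b ^ j * s) \<le> (b ^ j) powr \<nu> * \<psi> s" using neg by blast
    have bp: "b ^ j > 0" using bn[of j] by linarith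
    have "j \<noteq> 0" using j(2) by (intro notI) simp
    moreover have "\<omega> s < \<omega> (b ^ j * s)"
    proof -
      have "\<omega> s = (b ^ j) powr \<nu> * \<psi> s / ((b ^ j) powr \<nu> * s powr \<nu>)" using bp b by (simp add: \<omega>_def)
      also have "\<dots> < \<psi> (b ^ j * s) / ((b ^ j) powr \<nu> * s powr \<nu>)"
        using j(2) bp b s0 by (intro divide_strict_right_mono mult_pos_pos) auto
      also have "\<dots> = \<omega> (b ^ j * s)" using bp s0 b by (simp add: \<omega>_def powr_mult)
      finally show ?thesis .
    qed
    ultimately show ?thesis using j(1) by (intro exI[of _ j]) auto
  qed
  \<comment> \<open>A jump raises the exponent by at most \<open>J\<close>, so every block of
    \<open>J + 1\<close> consecutive exponents contains one at which \<open>\<omega>\<close> is at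
    least its initial value.\<close>
  have chain: "\<exists>n. N \<le> n \<and> n \<le> N + J \<and> \<omega> a \<le> \<omega> (b ^ n * a)" for N
  proof (induction N)
    case 0
    show ?case by (intro exI[of _ 0]) simp
  next
    case (Suc N)
    then obtain n where n: "N \<le> n" "n \<le> N + J" "\<omega> a \<le> \<omega> (b ^ n * a)" by blast
    show ?case
    proof (cases "n = N")
      case False
      then show ?thesis using n by (intro exI[of _ n]) auto
    next
      case True
      obtain j where j: "j \<le> J" "j \<ge> 1" "\<omega> (b ^ n * a) < \<omega> (b ^ j * (b ^ n * a))" using grow[OF ab] by blast
      then have "\<omega> a \<le> \<omega> (b ^ (j + n) * a)" using n(3) by (simp add: power_add mult.assoc)
      then show ?thesis using j True by (intro exI[of _ "j + n"]) auto
    qed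
  qed
  \<comment> \<open>Every large \<open>t\<close> lies above such a point by a factor of at most
    \<open>b ^ (J + 1)\<close>, which accounts for the denominator.\<close>
  define c where "c = \<omega> a / (b ^ (J + 1)) powr \<nu>"
  have c: "c > 0" unfolding c_def \<omega>_def using pos[OF a(2)] a(1) b by (intro divide_pos_pos) auto
  have lower: "c * t powr \<nu> \<le> \<psi> t" if t: "t \<ge> b ^ J * a" for t
  proof -
    have t0: "t > 0" using t ab[of J] a(1) by linarith
    obtain N0 where N0: "t < b ^ N0 * a"
    proof -
      obtain n where "t < b ^ n" using real_arch_pow[OF b] by blast
      moreover have "b ^ n * 1 \<le> b ^ n * a" using a(1) bn[of n] by (intro mult_left_mono) auto
      ultimately have "t < b ^ n * a" by simp
      then show ?thesis using that by blast
    qed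
    \<comment> \<open>For \<open>m = N + J + 1\<close> the block of exponents from \<open>N\<close>
      to \<open>N + J\<close> stays below \<open>t\<close>, while its end is within one factor
      \<open>b\<close> of \<open>t\<close>.\<close>
    define m where "m = (LEAST n. t < b ^ n * a)"
    have m: "t < b ^ m * a" unfolding m_def using N0 by (rule LeastI)
    have "m > J"
    proof (rule ccontr)
      assume "\<not> m > J"
      then have "b ^ m * a \<le> b ^ J * a" using b a(1) by (intro mult_right_mono power_increasing) auto
      then show False using m t by linarith
    qed
    then obtain N where N: "m = Suc (N + J)" by (metis add.commute less_iff_Suc_add)
    have tN: "b ^ (N + J) * a \<le> t" using not_less_Least[of "N + J" "\<lambda>n. t < b ^ n * a"] N by (simp add: m_def[symmetric] not_less)
    obtain n where n: "N \<le> n" "n \<le> N + J" "\<omega> a \<le> \<omega> (b ^ n * a)" using chain by blast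
    define s where "s = b ^ n * a"
    have s: "s \<ge> a" "s > 0" using ab[of n] a(1) by (auto simp: s_def)
    have "s \<le> b ^ (N + J) * a" unfolding s_def using b a(1) n by (intro mult_right_mono power_increasing) auto
    then have st: "s \<le> t" using tN by linarith
    have "b ^ m * a \<le> b ^ (n + (J + 1)) * a" using b a(1) n N by (intro mult_right_mono power_increasing) auto
    also have "\<dots> = b ^ (J + 1) * s" by (simp add: s_def power_add)
    finally have ts: "t \<le> b ^ (J + 1) * s" using m by linarith
    have "c * t powr \<nu> \<le> c * (b ^ (J + 1) * s) powr \<nu>"
      using ts t0 c \<mu> by (intro mult_left_mono powr_mono2) auto
    also have "\<dots> = \<omega> a * s powr \<nu>" using b s by (simp add: c_def powr_mult)
    also have "\<dots> \<le> \<omega> s * s powr \<nu>" using n(3) by (intro mult_right_mono) (auto simp: s_def)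
    also have "\<dots> = \<psi> s" using s by (simp add: \<omega>_def)
    also have "\<dots> \<le> \<psi> t" using st s a by (intro mono) auto
    finally show ?thesis .
  qed
  \<comment> \<open>As \<open>\<mu> < \<nu>\<close>, the constant \<open>c\<close> is absorbed and
    the lower bound contradicts \<open>freq\<close>.\<close>
  have "eventually (\<lambda>t. - ln c \<le> (\<nu> - \<mu>) * ln t) at_top"
    using eventually_const_le_iter_log[of "\<nu> - \<mu>" "- ln c" 1] \<mu> by simp
  then have "eventually (\<lambda>t. \<not> ln (\<psi> t) / ln t < \<mu>) at_top"
    using eventually_ge_at_top[of "b ^ J * a"] eventually_gt_at_top[of 1]
  proof eventually_elim
    case (elim t)
    have "ln (c * t powr \<nu>) \<le> ln (\<psi> t)" using lower[OF elim(2)] c elim by (intro ln_mono) auto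
    then have "ln c + \<nu> * ln t \<le> ln (\<psi> t)" using c elim by (simp add: ln_mult ln_powr)
    then have "\<mu> * ln t \<le> ln (\<psi> t)" using elim(1) by (simp add: left_diff_distrib)
    then show ?case using elim by (simp add: not_less le_divide_eq)
  qed
  then show False using freq by (simp add: frequently_def)
qed

section \<open>Comparison of the characteristics\<close>

text \<open>Finitely many exceptions cannot exhaust an interval of positive length.\<close>

lemma generic_radius_ex:
  fixes P Q :: "real \<Rightarrow> bool"
  assumes "\<And>b. finite {r\<in>{r0..b}. \<not> P r}" "eventually Q at_top"
  shows "\<exists>r. P r \<and> Q r"
proof -
  obtain r1 where r1: "\<And>r. r \<ge> r1 \<Longrightarrow> Q r" using assms(2) by (auto simp: eventually_at_top_linorder)
  define a where "a = max r0 r1"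
  have "infinite {a<..<a + 1}" by (simp add: infinite_Ioo)
  then have "\<not> {a<..<a + 1} \<subseteq> {r\<in>{r0..a + 1}. \<not> P r}" using assms(1) finite_subset by blast
  then obtain r where r: "r \<in> {a<..<a + 1}" "r \<notin> {r\<in>{r0..a + 1}. \<not> P r}" by blast
  then have "r0 \<le> r" "r1 \<le> r" "r \<le> a + 1" by (auto simp: a_def)
  then show ?thesis using r(2) r1 by auto
qed

text \<open>With total logarithms the quotient in the order could be negative at particular radii.
  If the characteristic is constant, a fixed number is divided by a quantity tending to infinity; if
  it is unbounded, the iterated logarithm is at least 2 at generic large radii.\<close>

lemma pq_order_nonneg:
  assumes f: "f meromorphic_on UNIV"
  shows "pq_order p q f \<ge> 0"
proof (rule ccontr)
  assume "\<not> ?thesis"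
  then have "pq_order p q f < 0" by simp
  then obtain x where x: "pq_order p q f < ereal x" "ereal x < 0" using ereal_dense2 by blast
  have x0: "x < 0" using x(2) by simp
  have "eventually (\<lambda>r. ereal (iter_log (p - 1) (nevanlinna_char f r) / iter_log q r) < ereal x) at_top"
    using x(1) unfolding pq_order_def by (rule Limsup_lessD)
  moreover have "eventually (\<lambda>r. 1 \<le> 1 * iter_log q r) at_top" by (rule eventually_const_le_iter_log) simp
  ultimately have ev: "eventually (\<lambda>r. iter_log (p - 1) (nevanlinna_char f r) < x * iter_log q r \<and> 1 \<le> iter_log q r) at_top"
    by eventually_elim (simp add: divide_less_eq)
  from nevanlinna_char_const_or_unbounded[OF f] show False
  proof
    assume "\<exists>c. \<forall>b. finite {r\<in>{0<..b}. nevanlinna_char f r \<noteq> c}"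
    then obtain c where c: "\<And>b. finite {r\<in>{0<..b}. nevanlinna_char f r \<noteq> c}" by blast
    have fin: "finite {r\<in>{1..b}. \<not> nevanlinna_char f r = c}" for b
      by (rule finite_subset[OF _ c[of b]]) auto
    have "eventually (\<lambda>r. - iter_log (p - 1) c \<le> - x * iter_log q r) at_top"
      by (rule eventually_const_le_iter_log) (use x0 in simp)
    from eventually_conj[OF ev this] obtain r where "nevanlinna_char f r = c"
      "iter_log (p - 1) (nevanlinna_char f r) < x * iter_log q r" "- iter_log (p - 1) c \<le> - x * iter_log q r"
      using generic_radius_ex[OF fin] by blast
    then show False by simp
  next
    assume u: "\<forall>A. \<exists>r0. \<forall>b. finite {r\<in>{r0..b}. nevanlinna_char f r < A}"
    obtain A where A: "log_domain (p - 1) A" using log_domain_ex by blast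
    obtain r0 where "\<And>b. finite {r\<in>{r0..b}. nevanlinna_char f r < A}" using u by blast
    then have fin: "finite {r\<in>{r0..b}. \<not> A \<le> nevanlinna_char f r}" for b by (simp add: not_le)
    obtain r where r: "A \<le> nevanlinna_char f r" "iter_log (p - 1) (nevanlinna_char f r) < x * iter_log q r" "1 \<le> iter_log q r"
      using generic_radius_ex[OF fin ev] by blast
    have "2 \<le> iter_log (p - 1) (nevanlinna_char f r)" using log_domain_mono[OF A r(1)] by (rule log_domainD) simp
    moreover have "x * iter_log q r \<le> 0" using x0 r(3) by (intro mult_nonpos_nonneg) auto
    ultimately show False using r(2) by simp
  qed
qed

lemma pq_order_upper:
  assumes "pq_order p q f = ereal \<rho>" "e > 0"
  shows "eventually (\<lambda>t. iter_log (p - 1) (nevanlinna_char f t) \<le> (\<rho> + e) * iter_log q t) at_top"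
proof -
  have "eventually (\<lambda>r. ereal (iter_log (p - 1) (nevanlinna_char f r) / iter_log q r) < ereal (\<rho> + e)) at_top"
    using assms(1)[unfolded pq_order_def] assms(2) by (intro Limsup_lessD) simp
  moreover have "eventually (\<lambda>r. 1 \<le> 1 * iter_log q r) at_top" by (rule eventually_const_le_iter_log) simp
  ultimately show ?thesis by eventually_elim (simp add: divide_less_eq)
qed

lemma gen_lower_order_nonneg:
  assumes "g holomorphic_on UNIV" "\<not> g constant_on (UNIV :: complex set)"
  shows "gen_lower_order l g \<ge> 0"
  unfolding gen_lower_order_def
proof (rule Liminf_bounded)
  have "eventually (\<lambda>r. log_domain l (max_modulus g r)) at_top"
    by (rule eventually_compose_filterlim[OF eventually_log_domain max_modulus_at_top[OF assms]])
  then show "eventually (\<lambda>r. 0 \<le> ereal (iter_log l (max_modulus g r) / ln r)) at_top"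
    using eventually_gt_at_top[of 1]
  proof eventually_elim
    case (elim r)
    have "2 \<le> iter_log l (max_modulus g r)" using elim(1) by (rule log_domainD) simp
    then show ?case using elim(2) by simp
  qed
qed

lemma Liminf_le_if_frequently:
  fixes F :: "real \<Rightarrow> real"
  assumes "\<And>r1. \<exists>r\<ge>r1. F r \<le> c"
  shows "Liminf at_top (\<lambda>r. ereal (F r)) \<le> ereal c"
proof (rule ccontr)
  assume "\<not> ?thesis"
  then have "ereal c < Liminf at_top (\<lambda>r. ereal (F r))" by simp
  then have "eventually (\<lambda>r. ereal c < ereal (F r)) at_top" by (rule less_LiminfD)
  then obtain r1 where "\<And>r. r \<ge> r1 \<Longrightarrow> c < F r" by (auto simp: eventually_at_top_linorder)
  then show False using assms[of r1] by force
qed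

text \<open>With \<open>e = 1 / m\<close> the numbers 2, \<open>\<tau>\<close> and 128 are the
  powers of the single base \<open>2 powr e\<close> with exponents \<open>m\<close>,
  \<open>m + 1\<close> and \<open>7 * m\<close>. One application of the growth lemma thus gives a
  scale \<open>s\<close> that controls both \<open>\<tau> * s\<close> and \<open>128 * s\<close>.
  The condition \<open>2 \<le> m\<close> keeps \<open>\<tau>\<close> at most 3.\<close>

lemma Liminf_ratio_le_aux:
  fixes f g Q G :: "complex \<Rightarrow> complex" and p q l \<alpha> m :: nat
  assumes f: "f meromorphic_on UNIV" and g: "transcendental_entire g"
    and q: "1 \<le> q" "q < p" and l: "2 \<le> l"
    and \<rho>: "pq_order p q f = ereal \<rho>" and \<Lambda>: "gen_lower_order l g = ereal \<Lambda>"
    and Q: "diff_polynomial_in g Q" and \<alpha>: "1 \<le> \<alpha>" and G: "G = (\<lambda>z. g z ^ \<alpha> * Q z)" and Gnz: "\<exists>z. G z \<noteq> 0"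
    and N: "N = (if l - 1 \<le> q then p - 1 else p + l - q - 2)" and \<sigma>: "\<sigma> = (if l - 1 \<le> q then \<rho> else 1)"
    and \<kappa>: "\<kappa> = (if l - 2 = 0 then 1 / 3 else 1)"
    and m: "2 \<le> m" and e: "e = 1 / real m"
  shows "Liminf at_top (\<lambda>r. ereal (iter_log N (nevanlinna_char (f \<circ> g) r) / iter_log (l - 2) (nevanlinna_char G r)))
    \<le> ereal ((\<sigma> + e) * (2 powr (1 + e)) powr (\<Lambda> + 2 * e) / (\<kappa> * (1 - e)))"
proof (rule Liminf_le_if_frequently)
  fix r1 :: real
  have gh: "g holomorphic_on UNIV" using g by (simp add: transcendental_entire_def)
  have gnc: "\<not> g constant_on UNIV" by (rule transcendental_not_constant[OF g])
  have fgm: "(f \<circ> g) meromorphic_on UNIV" by (rule comp_meromorphic[OF f gh])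
  have \<rho>0: "\<rho> \<ge> 0" using pq_order_nonneg[OF f, of p q] \<rho> by simp
  have \<sigma>0: "\<sigma> \<ge> 0" using \<rho>0 by (simp add: \<sigma>)
  have \<Lambda>0: "\<Lambda> \<ge> 0" using gen_lower_order_nonneg[OF gh gnc, of l] \<Lambda> by simp
  have e0: "0 < e" "e < 1" using m by (auto simp: e)
  have \<kappa>0: "\<kappa> > 0" by (simp add: \<kappa>)
  define b where "b = 2 powr e"
  define \<nu> where "\<nu> = \<Lambda> + 2 * e"
  define \<tau> where "\<tau> = 2 powr (1 + e)"
  have b1: "b > 1" unfolding b_def using e0 by simp
  have bm: "b ^ m = 2"
    unfolding b_def using m by (subst powr_realpow[symmetric]) (auto simp: powr_powr e)
  have b\<tau>: "b ^ (m + 1) = \<tau>" using bm by (simp add: \<tau>_def b_def powr_add)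
  have b128: "b ^ (7 * m) = 128" by (subst mult.commute) (simp only: power_mult bm, simp)
  have \<tau>: "2 < \<tau>" "\<tau> \<le> 3"
  proof -
    show "2 < \<tau>" using b1 by (simp add: \<tau>_def powr_add b_def)
    have "e \<le> 1 / 2" unfolding e using m by (intro divide_left_mono) auto
    then have "b \<le> 2 powr (1 / 2)" unfolding b_def by (intro powr_mono) auto
    also have "\<dots> = sqrt 2" by (simp add: powr_half_sqrt)
    also have "\<dots> \<le> 3 / 2" by (rule real_le_lsqrt) (auto simp: power2_eq_square)
    finally show "\<tau> \<le> 3" by (simp add: \<tau>_def powr_add b_def)
  qed
  define \<psi> where "\<psi> = (\<lambda>s. iter_log (l - 1) (max_modulus g s))"
  obtain l' where l': "l = Suc (Suc l')" using l by (metis Suc_le_D Suc_le_mono numeral_2_eq_2)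
  have \<psi>_ln: "\<psi> s = iter_log (l - 2) (ln (max_modulus g s))" for s by (simp add: \<psi>_def l' iter_log_ln)
  have Mtop: "filterlim (max_modulus g) at_top at_top" by (rule max_modulus_at_top[OF gh gnc])
  have lnMtop: "filterlim (\<lambda>s. ln (max_modulus g s)) at_top at_top" by (rule filterlim_compose[OF ln_at_top Mtop])
  have \<tau>top: "filterlim (\<lambda>s. \<tau> * s) at_top at_top"
    by (rule filterlim_tendsto_pos_mult_at_top[OF tendsto_const _ filterlim_ident]) (use \<tau> in simp)

  obtain C1 where C1: "C1 \<ge> 0"
    "\<And>t M. M \<ge> 1 \<Longrightarrow> (\<And>z. norm z \<le> t \<Longrightarrow> norm (g z) \<le> M) \<Longrightarrow>
       \<exists>R\<in>{2*M..4*M}. finite {r\<in>{1..t}. \<not> nevanlinna_char (f \<circ> g) r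
           \<le> C1 * (1 + ln R) * (nevanlinna_char f R + nevanlinna_char f (2 * R))}"
    by (rule nevanlinna_char_comp_le[OF f gh gnc]) (rule that, assumption, blast)
  obtain C2 where C2: "C2 \<ge> 0"
    "\<And>s X. s \<ge> 1 \<Longrightarrow> 1 \<le> ln (max_modulus g (128 * s)) \<Longrightarrow> finite X \<Longrightarrow>
       \<exists>r\<in>{2 * s .. \<tau> * s} - X. ln (max_modulus g s) / 3 - C2 * (1 + ln (ln (max_modulus g (128 * s)))) \<le> nevanlinna_char G r"
    by (rule nevanlinna_char_diff_polynomial_lower[OF g Q \<alpha> G Gnz \<tau>]) (rule that, assumption, blast)

  have "eventually (\<lambda>M. \<forall>R X. 2 * M \<le> R \<longrightarrow> R \<le> 4 * M \<longrightarrow> log_domain N X \<longrightarrow>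
      X \<le> C1 * (1 + ln R) * (nevanlinna_char f R + nevanlinna_char f (2 * R)) \<longrightarrow> iter_log N X \<le> (\<sigma> + e) * iter_log (l - 1) M) at_top"
    by (rule iter_log_numerator_bound[OF pq_order_upper[OF \<rho>] \<rho>0 q l C1(1) e0(1) N \<sigma>])
  from eventually_compose_filterlim[OF this filterlim_compose[OF Mtop \<tau>top]]
  have ev1: "eventually (\<lambda>s. \<forall>R X. 2 * max_modulus g (\<tau> * s) \<le> R \<longrightarrow> R \<le> 4 * max_modulus g (\<tau> * s) \<longrightarrow> log_domain N X \<longrightarrow>
      X \<le> C1 * (1 + ln R) * (nevanlinna_char f R + nevanlinna_char f (2 * R)) \<longrightarrow> iter_log N X \<le> (\<sigma> + e) * \<psi> (\<tau> * s)) at_top"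
    by (simp add: \<psi>_def)
  define B where "B = 128 powr \<nu>"
  have \<nu>0: "\<nu> > 0" using \<Lambda>0 e0 by (simp add: \<nu>_def)
  have B1: "B \<ge> 1" unfolding B_def using \<nu>0 by (intro ge_one_powr_ge_zero) auto
  from eventually_compose_filterlim[OF iter_log_denominator_bound[OF C2(1) B1 e0 \<kappa>] lnMtop]
  have ev2: "eventually (\<lambda>s. \<forall>y T. ln (max_modulus g s) \<le> y \<longrightarrow> iter_log (l - 2) y \<le> B * \<psi> s \<longrightarrow>
      ln (max_modulus g s) / 3 - C2 * (1 + ln y) \<le> T \<longrightarrow> \<kappa> * (1 - e) * \<psi> s \<le> iter_log (l - 2) T) at_top"
    by (simp add: \<psi>_ln)
  have ev3: "eventually (\<lambda>s. log_domain l (max_modulus g s)) at_top"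
    by (rule eventually_compose_filterlim[OF eventually_log_domain Mtop])
  have ev4: "eventually (\<lambda>s. 1 \<le> ln (max_modulus g s)) at_top" using lnMtop unfolding filterlim_at_top by blast

  \<comment> \<open>If the characteristic of \<open>f \<circ> g\<close> is constant, its iterated
    logarithm is a fixed number and the desired bound holds for large \<open>s\<close>. Otherwise it
    lies in the logarithmic domain, where the numerator estimate applies.\<close>
  obtain r0 where r0: "\<And>s. s \<ge> r0 \<Longrightarrow> \<exists>Y. finite Y \<and>
      (\<forall>r\<in>{s..\<tau> * s} - Y. log_domain N (nevanlinna_char (f \<circ> g) r) \<or> iter_log N (nevanlinna_char (f \<circ> g) r) \<le> (\<sigma> + e) * \<psi> (\<tau> * s))"
    using nevanlinna_char_const_or_unbounded[OF fgm]
  proof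
    assume "\<exists>c. \<forall>b. finite {r\<in>{0<..b}. nevanlinna_char (f \<circ> g) r \<noteq> c}"
    then obtain c where c: "\<And>b. finite {r\<in>{0<..b}. nevanlinna_char (f \<circ> g) r \<noteq> c}" by blast
    have "eventually (\<lambda>x. iter_log N c \<le> (\<sigma> + e) * iter_log (l - 1) x) at_top"
      by (rule eventually_const_le_iter_log) (use \<sigma>0 e0 in simp)
    from eventually_compose_filterlim[OF this filterlim_compose[OF Mtop \<tau>top]]
    obtain r0 where r0: "\<And>s. s \<ge> r0 \<Longrightarrow> iter_log N c \<le> (\<sigma> + e) * \<psi> (\<tau> * s)"
      by (auto simp: eventually_at_top_linorder \<psi>_def)
    show ?thesis
    proof (rule that[of "max 1 r0"])
      fix s assume s: "max 1 r0 \<le> s"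
      show "\<exists>Y. finite Y \<and> (\<forall>r\<in>{s..\<tau> * s} - Y. log_domain N (nevanlinna_char (f \<circ> g) r) \<or> iter_log N (nevanlinna_char (f \<circ> g) r) \<le> (\<sigma> + e) * \<psi> (\<tau> * s))"
        by (rule exI[of _ "{r\<in>{0<..\<tau> * s}. nevanlinna_char (f \<circ> g) r \<noteq> c}"]) (use c r0[of s] s in auto)
    qed
  next
    assume u: "\<forall>A. \<exists>r0. \<forall>b. finite {r\<in>{r0..b}. nevanlinna_char (f \<circ> g) r < A}"
    obtain A where A: "log_domain N A" using log_domain_ex by blast
    obtain r0 where r0: "\<And>b. finite {r\<in>{r0..b}. nevanlinna_char (f \<circ> g) r < A}" using u by blast
    show ?thesis
    proof (rule that[of r0])
      fix s assume s: "r0 \<le> s"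
      show "\<exists>Y. finite Y \<and> (\<forall>r\<in>{s..\<tau> * s} - Y. log_domain N (nevanlinna_char (f \<circ> g) r) \<or> iter_log N (nevanlinna_char (f \<circ> g) r) \<le> (\<sigma> + e) * \<psi> (\<tau> * s))"
        by (rule exI[of _ "{r\<in>{r0..\<tau> * s}. nevanlinna_char (f \<circ> g) r < A}"])
           (use r0 s log_domain_mono[OF A] in \<open>auto simp: not_less\<close>)
    qed
  qed

  have "eventually (\<lambda>s. (\<forall>R X. 2 * max_modulus g (\<tau> * s) \<le> R \<longrightarrow> R \<le> 4 * max_modulus g (\<tau> * s) \<longrightarrow> log_domain N X \<longrightarrow>
      X \<le> C1 * (1 + ln R) * (nevanlinna_char f R + nevanlinna_char f (2 * R)) \<longrightarrow> iter_log N X \<le> (\<sigma> + e) * \<psi> (\<tau> * s)) \<and>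
     (\<forall>y T. ln (max_modulus g s) \<le> y \<longrightarrow> iter_log (l - 2) y \<le> B * \<psi> s \<longrightarrow>
      ln (max_modulus g s) / 3 - C2 * (1 + ln y) \<le> T \<longrightarrow> \<kappa> * (1 - e) * \<psi> s \<le> iter_log (l - 2) T) \<and>
     log_domain l (max_modulus g s) \<and> 1 \<le> ln (max_modulus g s)) at_top"
    using ev1 ev2 ev3 ev4 by eventually_elim blast
  then obtain s0 where s0: "\<And>s. s \<ge> s0 \<Longrightarrow> (\<forall>R X. 2 * max_modulus g (\<tau> * s) \<le> R \<longrightarrow> R \<le> 4 * max_modulus g (\<tau> * s) \<longrightarrow> log_domain N X \<longrightarrow>
      X \<le> C1 * (1 + ln R) * (nevanlinna_char f R + nevanlinna_char f (2 * R)) \<longrightarrow> iter_log N X \<le> (\<sigma> + e) * \<psi> (\<tau> * s)) \<and>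
     (\<forall>y T. ln (max_modulus g s) \<le> y \<longrightarrow> iter_log (l - 2) y \<le> B * \<psi> s \<longrightarrow>
      ln (max_modulus g s) / 3 - C2 * (1 + ln y) \<le> T \<longrightarrow> \<kappa> * (1 - e) * \<psi> s \<le> iter_log (l - 2) T) \<and>
     log_domain l (max_modulus g s) \<and> 1 \<le> ln (max_modulus g s)"
    by (auto simp only: eventually_at_top_linorder)
  define s1 where "s1 = Max {1, s0, r0, r1}"
  have s1: "s1 \<ge> 1" "s1 \<ge> s0" "s1 \<ge> r0" "s1 \<ge> r1" by (auto simp: s1_def)

  \<comment> \<open>\<open>ln (\<psi> r)\<close> is \<open>iter_log l\<close> of the maximum
    modulus, so this is the definition of the lower order, with an exponent below
    \<open>\<nu>\<close>.\<close>
  have freq: "frequently (\<lambda>r. ln (\<psi> r) / ln r < \<Lambda> + e) at_top"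
  proof (rule ccontr)
    assume "\<not> ?thesis"
    then have "eventually (\<lambda>r. \<Lambda> + e \<le> ln (\<psi> r) / ln r) at_top" by (simp add: frequently_def not_less)
    then have "eventually (\<lambda>r. ereal (\<Lambda> + e) \<le> ereal (iter_log l (max_modulus g r) / ln r)) at_top"
      by eventually_elim (simp add: \<psi>_def l' iter_log_Suc)
    then have "ereal (\<Lambda> + e) \<le> gen_lower_order l g" unfolding gen_lower_order_def by (rule Liminf_bounded)
    then show False using \<Lambda> e0 by simp
  qed
  have dom: "log_domain (l - 1) (max_modulus g r)" if "r \<ge> s1" for r
    by (rule log_domain_le[of l]) (use s0[of r] that s1 in auto)
  have \<psi>mono: "\<psi> r \<le> \<psi> s" if "s1 \<le> r" "r \<le> s" for r s
    unfolding \<psi>_def using dom[OF that(1)] by (rule iter_log_mono) (use that s1 in \<open>auto intro!: max_modulus_mono gh\<close>)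
  have \<psi>pos: "\<psi> r > 0" if "s1 \<le> r" for r
    using log_domainD[OF dom[OF that], of "l - 1"] by (simp add: \<psi>_def)
  obtain s where s: "s \<ge> s1" "\<And>j. j \<le> 7 * m \<Longrightarrow> \<psi> (b ^ j * s) \<le> (b ^ j) powr \<nu> * \<psi> s"
    using regular_growth_scale[OF \<psi>mono \<psi>pos b1 _ _ freq, where \<nu>=\<nu> and ?s1.0=s1 and J="7 * m"] \<Lambda>0 e0
    by (auto simp: \<nu>_def)
  have s\<tau>: "\<psi> (\<tau> * s) \<le> \<tau> powr \<nu> * \<psi> s" using s(2)[of "m + 1"] m unfolding b\<tau> by simp
  have s128: "\<psi> (128 * s) \<le> B * \<psi> s" using s(2)[of "7 * m"] unfolding b128 B_def by simp
  have sge: "s \<ge> 1" "s \<ge> s0" "s \<ge> r0" "s \<ge> r1" using s(1) s1 by auto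
  have \<tau>s: "2 * s \<le> \<tau> * s" "s \<le> \<tau> * s" using \<tau> sge(1) by (intro mult_right_mono, simp_all)

  define M where "M = max_modulus g (\<tau> * s)"
  have "M \<ge> 1"
  proof -
    have "log_domain l M" unfolding M_def using s0[of "\<tau> * s"] \<tau>s sge by auto
    from log_domain_ge[OF this] show ?thesis by simp
  qed
  then obtain R where R: "R \<in> {2 * M..4 * M}" "finite {r\<in>{1..\<tau> * s}. \<not> nevanlinna_char (f \<circ> g) r
           \<le> C1 * (1 + ln R) * (nevanlinna_char f R + nevanlinna_char f (2 * R))}"
    using C1(2)[of M "\<tau> * s"] norm_le_max_modulus[OF gh, of _ "\<tau> * s"] unfolding M_def by blast
  obtain Y where Y: "finite Y" "\<And>r. r \<in> {s..\<tau> * s} - Y \<Longrightarrow> log_domain N (nevanlinna_char (f \<circ> g) r) \<or>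
      iter_log N (nevanlinna_char (f \<circ> g) r) \<le> (\<sigma> + e) * \<psi> (\<tau> * s)"
    using r0[OF sge(3)] by blast
  have "max_modulus g s \<le> max_modulus g (128 * s)" using sge by (intro max_modulus_mono gh) auto
  moreover have "max_modulus g s > 0" using s0[OF sge(2)] log_domain_ge by fastforce
  ultimately have x_le_y: "ln (max_modulus g s) \<le> ln (max_modulus g (128 * s))" by (intro ln_mono)
  then have y1: "1 \<le> ln (max_modulus g (128 * s))" using s0[OF sge(2)] by linarith
  \<comment> \<open>The exceptional radii of both numerator statements are handed to the lower bound
    as the set to be avoided; this yields the common radius.\<close>
  obtain r where r: "r \<in> {2 * s..\<tau> * s}" "r \<notin> Y"
      "nevanlinna_char (f \<circ> g) r \<le> C1 * (1 + ln R) * (nevanlinna_char f R + nevanlinna_char f (2 * R))"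
      "ln (max_modulus g s) / 3 - C2 * (1 + ln (ln (max_modulus g (128 * s)))) \<le> nevanlinna_char G r"
    using C2(2)[OF sge(1) y1 finite_UnI[OF R(2) Y(1)]] sge(1) by force
  have "iter_log N (nevanlinna_char (f \<circ> g) r) \<le> (\<sigma> + e) * \<psi> (\<tau> * s)"
    using Y(2)[of r] s0[OF sge(2)] r R(1) sge(1) unfolding M_def by auto
  also have "\<dots> \<le> (\<sigma> + e) * (\<tau> powr \<nu> * \<psi> s)" using s\<tau> \<sigma>0 e0 by (intro mult_left_mono) auto
  finally have num: "iter_log N (nevanlinna_char (f \<circ> g) r) \<le> (\<sigma> + e) * (\<tau> powr \<nu> * \<psi> s)" .
  have den: "\<kappa> * (1 - e) * \<psi> s \<le> iter_log (l - 2) (nevanlinna_char G r)"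
    using s0[OF sge(2)] x_le_y s128 r(4) unfolding \<psi>_ln[of "128 * s"] by blast
  have \<psi>s: "\<psi> s > 0" by (rule \<psi>pos[OF s(1)])
  have d0: "0 < \<kappa> * (1 - e) * \<psi> s" using \<kappa>0 e0 \<psi>s by (intro mult_pos_pos) auto
  have "iter_log N (nevanlinna_char (f \<circ> g) r) / iter_log (l - 2) (nevanlinna_char G r)
      \<le> ((\<sigma> + e) * (\<tau> powr \<nu> * \<psi> s)) / iter_log (l - 2) (nevanlinna_char G r)"
    using num d0 den by (intro divide_right_mono) auto
  also have "\<dots> \<le> ((\<sigma> + e) * (\<tau> powr \<nu> * \<psi> s)) / (\<kappa> * (1 - e) * \<psi> s)"
  proof (rule divide_left_mono[OF den])
    show "0 \<le> (\<sigma> + e) * (\<tau> powr \<nu> * \<psi> s)" using \<sigma>0 e0 \<psi>s by (intro mult_nonneg_nonneg) auto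
    show "0 < iter_log (l - 2) (nevanlinna_char G r) * (\<kappa> * (1 - e) * \<psi> s)"
      by (rule mult_pos_pos[OF less_le_trans[OF d0 den] d0])
  qed
  also have "\<dots> = (\<sigma> + e) * \<tau> powr \<nu> / (\<kappa> * (1 - e))" using \<psi>s by simp
  finally have "iter_log N (nevanlinna_char (f \<circ> g) r) / iter_log (l - 2) (nevanlinna_char G r) \<le> (\<sigma> + e) * \<tau> powr \<nu> / (\<kappa> * (1 - e))" .
  moreover have "r \<ge> r1" using r(1) sge by auto
  ultimately show "\<exists>r\<ge>r1. iter_log N (nevanlinna_char (f \<circ> g) r) / iter_log (l - 2) (nevanlinna_char G r)
      \<le> (\<sigma> + e) * (2 powr (1 + e)) powr (\<Lambda> + 2 * e) / (\<kappa> * (1 - e))"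
    unfolding \<tau>_def \<nu>_def by blast
qed

lemma iter_log_at_0 [simp]: "iter_log k 0 = 0"
  by (induction k) (simp_all add: iter_log_Suc)

lemma Liminf_ratio_le:
  fixes f g Q G :: "complex \<Rightarrow> complex" and p q l \<alpha> :: nat
  assumes f: "f meromorphic_on UNIV" and g: "transcendental_entire g"
    and q: "1 \<le> q" "q < p" and l: "2 \<le> l"
    and \<rho>: "pq_order p q f = ereal \<rho>" and \<Lambda>: "gen_lower_order l g = ereal \<Lambda>"
    and Q: "diff_polynomial_in g Q" and \<alpha>: "1 \<le> \<alpha>" and G: "G = (\<lambda>z. g z ^ \<alpha> * Q z)"
    and N: "N = (if l - 1 \<le> q then p - 1 else p + l - q - 2)" and \<sigma>: "\<sigma> = (if l - 1 \<le> q then \<rho> else 1)"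
    and \<kappa>: "\<kappa> = (if l - 2 = 0 then 1 / 3 else 1)"
  shows "Liminf at_top (\<lambda>r. ereal (iter_log N (nevanlinna_char (f \<circ> g) r) / iter_log (l - 2) (nevanlinna_char G r)))
    \<le> ereal (\<sigma> * 2 powr \<Lambda> / \<kappa>)"
proof (cases "\<exists>z. G z \<noteq> 0")
  case False
  have "\<rho> \<ge> 0" using pq_order_nonneg[OF f, of p q] \<rho> by simp
  then have rhs: "0 \<le> \<sigma> * 2 powr \<Lambda> / \<kappa>" by (simp add: \<sigma> \<kappa>)
  \<comment> \<open>The conventions \<open>iter_log k 0 = 0\<close> and \<open>x / 0 = 0\<close>
    make the quotient 0 at every positive radius.\<close>
  have G0: "G = (\<lambda>_. 0)" using False by auto
  have T0: "nevanlinna_char G r = 0" if "r > 0" for r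
    unfolding G0 using that by (subst nevanlinna_char_entire) (auto simp: proximity_fun_eq_circle_mean log_plus_def)
  show ?thesis
  proof (rule Liminf_le_if_frequently)
    fix r1 :: real
    show "\<exists>r\<ge>r1. iter_log N (nevanlinna_char (f \<circ> g) r) / iter_log (l - 2) (nevanlinna_char G r) \<le> \<sigma> * 2 powr \<Lambda> / \<kappa>"
      by (rule exI[of _ "max 1 r1"]) (use rhs T0[of "max 1 r1"] in simp)
  qed
next
  case True
  have \<kappa>0: "\<kappa> \<noteq> 0" by (simp add: \<kappa>)
  \<comment> \<open>As \<open>m\<close> tends to infinity, \<open>2 powr (1 + 1 / m)\<close> tends
    to 2 and all error terms disappear.\<close>
  have "(\<lambda>m. (\<sigma> + 1 / real m) * (2 powr (1 + 1 / real m)) powr (\<Lambda> + 2 * (1 / real m)) / (\<kappa> * (1 - 1 / real m)))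
     \<longlonglongrightarrow> (\<sigma> + 0) * (2 powr (1 + 0)) powr (\<Lambda> + 2 * 0) / (\<kappa> * (1 - 0))"
    using \<kappa>0 by (intro tendsto_intros lim_1_over_n) auto
  then have lim: "(\<lambda>m. ereal ((\<sigma> + 1 / real m) * (2 powr (1 + 1 / real m)) powr (\<Lambda> + 2 * (1 / real m)) / (\<kappa> * (1 - 1 / real m))))
     \<longlonglongrightarrow> ereal (\<sigma> * 2 powr \<Lambda> / \<kappa>)" by (intro tendsto_ereal) simp
  show ?thesis
    by (rule LIMSEQ_le_const[OF lim])
       (use Liminf_ratio_le_aux[OF f g q l \<rho> \<Lambda> Q \<alpha> G True N \<sigma> \<kappa> _ refl] in blast)
qed

theorem theorem5:
  fixes f g Q G :: "complex \<Rightarrow> complex" and p q l \<alpha> :: nat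
  assumes "f meromorphic_on UNIV"
    and "transcendental_entire g"
    and "q \<ge> 1" and "p > q" and "l \<ge> 2"
    and "\<bar>pq_order p q f\<bar> \<noteq> \<infinity>"
    and "\<bar>gen_lower_order l g\<bar> \<noteq> \<infinity>"
    and "diff_polynomial_in g Q"
    and "\<alpha> \<ge> 1"
    and "G = (\<lambda>z. g z ^ \<alpha> * Q z)"
  shows
    "(q \<ge> l - 1 \<and> l - 1 > 1 \<longrightarrow>
        Liminf at_top (\<lambda>r::real. ereal (iter_log (p - 1) (nevanlinna_char (f \<circ> g) r)
                                  / iter_log (l - 2) (nevanlinna_char G r)))
        \<le> ereal (real_of_ereal (pq_order p q f) * 2 powr real_of_ereal (gen_lower_order l g)))
     \<and> (q < l - 1 \<longrightarrow>
        Liminf at_top (\<lambda>r::real. ereal (iter_log (p + l - q - 2) (nevanlinna_char (f \<circ> g) r)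
                                  / iter_log (l - 2) (nevanlinna_char G r)))
        \<le> ereal (2 powr real_of_ereal (gen_lower_order l g)))
     \<and> (q \<ge> l - 1 \<and> l - 1 = 1 \<longrightarrow>
        (\<forall>\<beta>::real. \<beta> > 1 \<longrightarrow>
          Liminf at_top (\<lambda>r::real. ereal (iter_log (p - 1) (nevanlinna_char (f \<circ> g) r)
                                    / nevanlinna_char G r))
          \<le> ereal (3 * \<beta> * real_of_ereal (pq_order p q f)
                    * 2 powr real_of_ereal (lower_order g))))"
proof -
  define \<rho> where "\<rho> = real_of_ereal (pq_order p q f)"
  define \<Lambda> where "\<Lambda> = real_of_ereal (gen_lower_order l g)"
  have \<rho>: "pq_order p q f = ereal \<rho>" and \<Lambda>: "gen_lower_order l g = ereal \<Lambda>"
    using assms(6,7) by (simp_all add: \<rho>_def \<Lambda>_def ereal_real')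
  have \<rho>0: "\<rho> \<ge> 0" using pq_order_nonneg[OF assms(1), of p q] \<rho> by simp
  \<comment> \<open>In (ii), \<open>q \<ge> 1\<close> and \<open>q < l - 1\<close> force
    \<open>l > 2\<close>, so \<open>\<kappa>\<close> is 1 in both (i) and (ii). Only
    \<open>l = 2\<close> leaves \<open>\<kappa> = 1 / 3\<close>, whose reciprocal is the 3 of
    (iii).\<close>
  note main = Liminf_ratio_le[OF assms(1-5) \<rho> \<Lambda> assms(8-10) refl refl refl]
  show ?thesis
  proof (intro conjI impI allI)
    assume ql: "q \<ge> l - 1 \<and> l - 1 > 1"
    then have "\<not> l \<le> 2" by auto
    with ql show "Liminf at_top (\<lambda>r::real. ereal (iter_log (p - 1) (nevanlinna_char (f \<circ> g) r)
                                  / iter_log (l - 2) (nevanlinna_char G r)))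
        \<le> ereal (real_of_ereal (pq_order p q f) * 2 powr real_of_ereal (gen_lower_order l g))"
      using main by (simp add: \<rho>_def \<Lambda>_def)
  next
    assume ql: "q < l - 1"
    then have "\<not> l \<le> 2" using assms(3) by auto
    with ql show "Liminf at_top (\<lambda>r::real. ereal (iter_log (p + l - q - 2) (nevanlinna_char (f \<circ> g) r)
                                  / iter_log (l - 2) (nevanlinna_char G r)))
        \<le> ereal (2 powr real_of_ereal (gen_lower_order l g))"
      using main assms(3) by (simp add: \<Lambda>_def)
  next
    fix \<beta> :: real
    assume ql: "q \<ge> l - 1 \<and> l - 1 = 1" and \<beta>: "\<beta> > 1"
    then have l2: "l = 2" by arith
    have "Liminf at_top (\<lambda>r::real. ereal (iter_log (p - 1) (nevanlinna_char (f \<circ> g) r) / nevanlinna_char G r))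
        \<le> ereal (3 * \<rho> * 2 powr \<Lambda>)"
      using main ql by (simp add: l2 mult_ac)
    also have "\<dots> \<le> ereal (3 * \<beta> * \<rho> * 2 powr \<Lambda>)"
      using \<beta> \<rho>0 by (simp add: mult_right_mono mult_le_cancel_right1)
    finally show "Liminf at_top (\<lambda>r::real. ereal (iter_log (p - 1) (nevanlinna_char (f \<circ> g) r) / nevanlinna_char G r))
          \<le> ereal (3 * \<beta> * real_of_ereal (pq_order p q f) * 2 powr real_of_ereal (lower_order g))"
      by (simp add: \<rho>_def \<Lambda>_def lower_order_def l2)
  qed
qed

end
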